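(* Let $\boldsymbol{x}:M^2\to E_1^3$ be a non-degenerate surface of revolution with nowhere vanishing Gauss curvature, and suppose that there is a real $3\times3$ matrix $A$ with $\Delta^{III}\boldsymbol{x}=A\boldsymbol{x}$ on $M^2$. Then $M^2$ is one of the following: (i) an open part of a catenoid of the 1st kind, the 2nd kind, the 3rd kind, the 4th kind or the 5th kind; (ii) an open part of a surface of Enneper of the 2nd kind or the 3rd kind; (iii) an open part of the pseudosphere $\mathbb{S}^2_1(0,c)$ centered at the origin with radius $c$, for some $c>0$; (iv) an open part of the hyperbolic space $\mathbb{H}^2(0,c)$ centered at the origin with radius $c$, for some $c>0$.
   Context: $E_1^3$ is $\mathbb{R}^3$ with coordinates $(x,y,z)$ and the Lorentzian metric $\langle\cdot,\cdot\rangle=dx^2+dy^2-dz^2$. A surface of revolution is a surface given, for $s\in(a,b)$, $\theta\in\mathbb{R}$ and smooth functions $f,g$ on $(a,b)$, by one of the parametrizations (spacelike axis) $\boldsymbol{x}=(f\cosh\theta,g,f\sinh\theta)$ or $\boldsymbol{x}=(f\sinh\theta,g,f\cosh\theta)$ with $f$ nowhere zero; (timelike axis) $\boldsymbol{x}=(f\cos\theta,f\sin\theta,g)$ with $f$ nowhere zero; (lightlike axis) $\boldsymbol{x}=(\theta h,\,g+\frac12\theta^2h,\,f+\frac12\theta^2h)$ with $h=f-g$ nowhere zero. In the spacelike and timelike axis cases the profile curve is parametrized by arclength ($\langle\boldsymbol{x}_s,\boldsymbol{x}_s\rangle$ is constantly $1$ or constantly $-1$). For a parametrized surface put $E=\langle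 \boldsymbol{x}_s,\boldsymbol{x}_s\rangle$, $F=\langle \boldsymbol{x}_s,\boldsymbol{x}_\theta\rangle$, $G=\langle \boldsymbol{x}_\theta,\boldsymbol{x}_\theta\rangle$. The surface is non-degenerate if $EG-F^2\neq 0$ everywhere; then $\boldsymbol{n}$ denotes a unit normal field ($\langle\boldsymbol{n},\boldsymbol{n}\rangle=\pm1$), and $L=\langle \boldsymbol{x}_{ss},\boldsymbol{n}\rangle$, $M=\langle \boldsymbol{x}_{s\theta},\boldsymbol{n}\rangle$, $N=\langle \boldsymbol{x}_{\theta\theta},\boldsymbol{n}\rangle$. Nowhere vanishing Gauss curvature means $LN-M^2\neq0$ everywhere. The third fundamental form $III$ has coefficients $e_{11}=\langle\boldsymbol{n}_s,\boldsymbol{n}_s\rangle$, $e_{12}=e_{21}=\langle\boldsymbol{n}_s,\boldsymbol{n}_\theta\rangle$, $e_{22}=\langle\boldsymbol{n}_\theta,\boldsymbol{n}_\theta\rangle$; it is non-degenerate when $LN-M^2\ne0$. With $e=\det(e_{km})$, $(e^{km})$ the inverse matrix of $(e_{km})$ and $(u^1,u^2)=(s,\theta)$, the Laplace operator with respect to $III$ is $$\Delta^{III}p=-\frac{1}{\sqrt{|e|}}\sum_{k,m}\frac{\partial}{\partial u^m}\Big(\sqrt{|e|}\,e^{km}\frac{\partial p}{\partial u^k}\Big)$$ for smooth functions $p$, and $\Delta^{III}\boldsymbol{x}$ is defined componentwise. $\mathbb{S}_1^2(0,c)=\{x^2+y^2-z^2=c^2\}$ and $\mathbb{H}^2(0,c)=\{x^2+y^2-z^2=-c^2\}$.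 The catenoids of the five kinds are, up to isometries of $E_1^3$ and for a constant $\alpha>0$, the non-degenerate parts of the following five surfaces of revolution with zero mean curvature and non-lightlike axis (the numbering among the kinds plays no role in the statement): spacelike ones: $(\alpha\sinh(t/\alpha)\cos\theta,\ \alpha\sinh(t/\alpha)\sin\theta,\ t)$ and $(\alpha\sin(t/\alpha)\sinh\theta,\ t,\ \alpha\sin(t/\alpha)\cosh\theta)$; timelike ones: $(\alpha\sin(t/\alpha)\cos\theta,\ \alpha\sin(t/\alpha)\sin\theta,\ t)$, $(\alpha\cosh(t/\alpha)\cosh\theta,\ t,\ \alpha\cosh(t/\alpha)\sinh\theta)$ and $(\alpha\sinh(t/\alpha)\sinh\theta,\ t,\ \alpha\sinh(t/\alpha)\cosh\theta)$. The surfaces of Enneper of the 2nd and 3rd kind are, up to isometries of $E_1^3$, the surfaces of revolution with lightlike axis and zero mean curvature $$(-2s\theta,\ \alpha s^3+s-\theta^2 s,\ \alpha s^3-s-\theta^2 s),\qquad s\neq0,$$ with constant $\alpha>0$ (2nd kind, spacelike) and $\alpha<0$ (3rd kind, timelike), respectively. *)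

theory Defs
  imports "HOL-Analysis.Analysis"
begin

section \<open>Lorentz 3-space\<close>

definition lorentz :: "real^3 \<Rightarrow> real^3 \<Rightarrow> real" where
  "lorentz u v = u$1 * v$1 + u$2 * v$2 - u$3 * v$3"

text \<open>The isometries of \<open>E\<^sub>1\<^sup>3\<close> are the affine maps whose linear part preserves the
  Lorentzian metric.\<close>

definition lorentz_isometry :: "(real^3 \<Rightarrow> real^3) \<Rightarrow> bool" where
  "lorentz_isometry \<Phi> \<longleftrightarrow>
     (\<exists>(Q :: real^3^3) b. (\<forall>u v. lorentz (Q *v u) (Q *v v) = lorentz u v) \<and>
        \<Phi> = (\<lambda>p. Q *v p + b))"

section \<open>Parametrized surfaces\<close>

text \<open>A surface is a map \<open>x s \<theta>\<close>. The type \<^typ>\<open>2\<close>, with elements \<open>1\<close> and \<open>2\<close>, indexes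
  the parameters \<open>(u\<^sup>1, u\<^sup>2) = (s, \<theta>)\<close>.\<close>

definition pd :: "2 \<Rightarrow> (real \<Rightarrow> real \<Rightarrow> 'a::real_normed_vector) \<Rightarrow> real \<Rightarrow> real \<Rightarrow> 'a" where
  "pd k p s \<theta> =
     (if k = 1 then vector_derivative (\<lambda>s'. p s' \<theta>) (at s)
      else vector_derivative (\<lambda>\<theta>'. p s \<theta>') (at \<theta>))"

definition coeff_E :: "(real \<Rightarrow> real \<Rightarrow> real^3) \<Rightarrow> real \<Rightarrow> real \<Rightarrow> real" where
  "coeff_E x s \<theta> = lorentz (pd 1 x s \<theta>) (pd 1 x s \<theta>)"

definition coeff_F :: "(real \<Rightarrow> real \<Rightarrow> real^3) \<Rightarrow> real \<Rightarrow> real \<Rightarrow> real" where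
  "coeff_F x s \<theta> = lorentz (pd 1 x s \<theta>) (pd 2 x s \<theta>)"

definition coeff_G :: "(real \<Rightarrow> real \<Rightarrow> real^3) \<Rightarrow> real \<Rightarrow> real \<Rightarrow> real" where
  "coeff_G x s \<theta> = lorentz (pd 2 x s \<theta>) (pd 2 x s \<theta>)"

definition nondegenerate_at :: "(real \<Rightarrow> real \<Rightarrow> real^3) \<Rightarrow> real \<Rightarrow> real \<Rightarrow> bool" where
  "nondegenerate_at x s \<theta> \<longleftrightarrow> coeff_E x s \<theta> * coeff_G x s \<theta> - (coeff_F x s \<theta>)\<^sup>2 \<noteq> 0"

text \<open>On a non-degenerate surface a continuous unit normal field is locally plus or minus the
  normalized Lorentzian cross product of the two tangent vectors, hence automatically smooth.\<close>

definition unit_normal_field ::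
    "real set \<Rightarrow> (real \<Rightarrow> real \<Rightarrow> real^3) \<Rightarrow> (real \<Rightarrow> real \<Rightarrow> real^3) \<Rightarrow> bool" where
  "unit_normal_field I x n \<longleftrightarrow>
     continuous_on (I \<times> UNIV) (\<lambda>(s, \<theta>). n s \<theta>) \<and>
     (\<forall>s\<in>I. \<forall>\<theta>. lorentz (n s \<theta>) (pd 1 x s \<theta>) = 0 \<and> lorentz (n s \<theta>) (pd 2 x s \<theta>) = 0 \<and>
        (lorentz (n s \<theta>) (n s \<theta>) = 1 \<or> lorentz (n s \<theta>) (n s \<theta>) = -1))"

definition coeff_L ::
    "(real \<Rightarrow> real \<Rightarrow> real^3) \<Rightarrow> (real \<Rightarrow> real \<Rightarrow> real^3) \<Rightarrow> real \<Rightarrow> real \<Rightarrow> real" where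
  "coeff_L x n s \<theta> = lorentz (pd 1 (pd 1 x) s \<theta>) (n s \<theta>)"

definition coeff_M ::
    "(real \<Rightarrow> real \<Rightarrow> real^3) \<Rightarrow> (real \<Rightarrow> real \<Rightarrow> real^3) \<Rightarrow> real \<Rightarrow> real \<Rightarrow> real" where
  "coeff_M x n s \<theta> = lorentz (pd 2 (pd 1 x) s \<theta>) (n s \<theta>)"

definition coeff_N ::
    "(real \<Rightarrow> real \<Rightarrow> real^3) \<Rightarrow> (real \<Rightarrow> real \<Rightarrow> real^3) \<Rightarrow> real \<Rightarrow> real \<Rightarrow> real" where
  "coeff_N x n s \<theta> = lorentz (pd 2 (pd 2 x) s \<theta>) (n s \<theta>)"

definition third_form :: "(real \<Rightarrow> real \<Rightarrow> real^3) \<Rightarrow> real \<Rightarrow> real \<Rightarrow> real^2^2" where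
  "third_form n s \<theta> = (\<chi> k m. lorentz (pd k n s \<theta>) (pd m n s \<theta>))"

definition laplace_III ::
    "(real \<Rightarrow> real \<Rightarrow> real^3) \<Rightarrow> (real \<Rightarrow> real \<Rightarrow> real) \<Rightarrow> real \<Rightarrow> real \<Rightarrow> real" where
  "laplace_III n p s \<theta> =
     - (1 / sqrt \<bar>det (third_form n s \<theta>)\<bar>) *
       (\<Sum>k\<in>UNIV. \<Sum>m\<in>UNIV.
          pd m (\<lambda>s' \<theta>'. sqrt \<bar>det (third_form n s' \<theta>')\<bar> *
                  matrix_inv (third_form n s' \<theta>') $ k $ m * pd k p s' \<theta>') s \<theta>)"

definition laplace_III_vec ::
    "(real \<Rightarrow> real \<Rightarrow> real^3) \<Rightarrow> (real \<Rightarrow> real \<Rightarrow> real^3) \<Rightarrow> real \<Rightarrow> real \<Rightarrow> real^3" where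
  "laplace_III_vec n x s \<theta> = (\<chi> i. laplace_III n (\<lambda>s' \<theta>'. x s' \<theta>' $ i) s \<theta>)"

section \<open>Surfaces of revolution\<close>

definition rev_spacelike1 :: "(real \<Rightarrow> real) \<Rightarrow> (real \<Rightarrow> real) \<Rightarrow> real \<Rightarrow> real \<Rightarrow> real^3" where
  "rev_spacelike1 f g s \<theta> = vector [f s * cosh \<theta>, g s, f s * sinh \<theta>]"

definition rev_spacelike2 :: "(real \<Rightarrow> real) \<Rightarrow> (real \<Rightarrow> real) \<Rightarrow> real \<Rightarrow> real \<Rightarrow> real^3" where
  "rev_spacelike2 f g s \<theta> = vector [f s * sinh \<theta>, g s, f s * cosh \<theta>]"

definition rev_timelike :: "(real \<Rightarrow> real) \<Rightarrow> (real \<Rightarrow> real) \<Rightarrow> real \<Rightarrow> real \<Rightarrow> real^3" where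
  "rev_timelike f g s \<theta> = vector [f s * cos \<theta>, f s * sin \<theta>, g s]"

definition rev_lightlike :: "(real \<Rightarrow> real) \<Rightarrow> (real \<Rightarrow> real) \<Rightarrow> real \<Rightarrow> real \<Rightarrow> real^3" where
  "rev_lightlike f g s \<theta> =
     (let h = f s - g s in vector [\<theta> * h, g s + \<theta>\<^sup>2 * h / 2, f s + \<theta>\<^sup>2 * h / 2])"

text \<open>To be used for open \<open>I\<close> only, where \<open>deriv\<close> is the derivative relative to \<open>I\<close>.\<close>

definition smooth_fun_on :: "(real \<Rightarrow> real) \<Rightarrow> real set \<Rightarrow> bool" where
  "smooth_fun_on f I \<longleftrightarrow> (\<forall>k. (deriv ^^ k) f differentiable_on I)"

definition arclength_profile :: "real set \<Rightarrow> (real \<Rightarrow> real \<Rightarrow> real^3) \<Rightarrow> bool" where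
  "arclength_profile I x \<longleftrightarrow>
     (\<forall>s\<in>I. \<forall>\<theta>. coeff_E x s \<theta> = 1) \<or> (\<forall>s\<in>I. \<forall>\<theta>. coeff_E x s \<theta> = -1)"

definition surface_of_revolution :: "real set \<Rightarrow> (real \<Rightarrow> real \<Rightarrow> real^3) \<Rightarrow> bool" where
  "surface_of_revolution I x \<longleftrightarrow>
     (\<exists>f g. smooth_fun_on f I \<and> smooth_fun_on g I \<and>
       (((\<forall>s\<in>I. f s \<noteq> 0) \<and> arclength_profile I x \<and>
           ((\<forall>s\<in>I. \<forall>\<theta>. x s \<theta> = rev_spacelike1 f g s \<theta>) \<or>
            (\<forall>s\<in>I. \<forall>\<theta>. x s \<theta> = rev_spacelike2 f g s \<theta>) \<or>
            (\<forall>s\<in>I. \<forall>\<theta>. x s \<theta> = rev_timelike f g s \<theta>))) \<or>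
        ((\<forall>s\<in>I. f s - g s \<noteq> 0) \<and>
           (\<forall>s\<in>I. \<forall>\<theta>. x s \<theta> = rev_lightlike f g s \<theta>))))"

section \<open>The model surfaces\<close>

definition pseudosphere :: "real \<Rightarrow> (real^3) set" where
  "pseudosphere c = {p. lorentz p p = c\<^sup>2}"

definition hyperbolic_space :: "real \<Rightarrow> (real^3) set" where
  "hyperbolic_space c = {p. lorentz p p = - c\<^sup>2}"

text \<open>Kinds 1 and 2 are the spacelike catenoids, kinds 3, 4 and 5 the timelike ones.\<close>

definition catenoid1 :: "real \<Rightarrow> real \<Rightarrow> real \<Rightarrow> real^3" where
  "catenoid1 \<alpha> = rev_timelike (\<lambda>t. \<alpha> * sinh (t / \<alpha>)) (\<lambda>t. t)"

definition catenoid2 :: "real \<Rightarrow> real \<Rightarrow> real \<Rightarrow> real^3" where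
  "catenoid2 \<alpha> = rev_spacelike2 (\<lambda>t. \<alpha> * sin (t / \<alpha>)) (\<lambda>t. t)"

definition catenoid3 :: "real \<Rightarrow> real \<Rightarrow> real \<Rightarrow> real^3" where
  "catenoid3 \<alpha> = rev_timelike (\<lambda>t. \<alpha> * sin (t / \<alpha>)) (\<lambda>t. t)"

definition catenoid4 :: "real \<Rightarrow> real \<Rightarrow> real \<Rightarrow> real^3" where
  "catenoid4 \<alpha> = rev_spacelike1 (\<lambda>t. \<alpha> * cosh (t / \<alpha>)) (\<lambda>t. t)"

definition catenoid5 :: "real \<Rightarrow> real \<Rightarrow> real \<Rightarrow> real^3" where
  "catenoid5 \<alpha> = rev_spacelike2 (\<lambda>t. \<alpha> * sinh (t / \<alpha>)) (\<lambda>t. t)"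

definition enneper :: "real \<Rightarrow> real \<Rightarrow> real \<Rightarrow> real^3" where
  "enneper \<alpha> s \<theta> =
     vector [- 2 * s * \<theta>, \<alpha> * s ^ 3 + s - \<theta>\<^sup>2 * s, \<alpha> * s ^ 3 - s - \<theta>\<^sup>2 * s]"

definition nondegenerate_part :: "(real \<Rightarrow> real \<Rightarrow> real^3) \<Rightarrow> (real^3) set" where
  "nondegenerate_part x = {x t \<theta> | t \<theta>. nondegenerate_at x t \<theta>}"

definition open_part :: "(real^3) set \<Rightarrow> (real^3) set \<Rightarrow> bool" where
  "open_part S T \<longleftrightarrow> openin (top_of_set T) S"

definition open_part_of_catenoid :: "(real \<Rightarrow> real \<Rightarrow> real \<Rightarrow> real^3) \<Rightarrow> (real^3) set \<Rightarrow> bool" where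
  "open_part_of_catenoid C S \<longleftrightarrow>
     (\<exists>\<alpha>>0. \<exists>\<Phi>. lorentz_isometry \<Phi> \<and> open_part S (\<Phi> ` nondegenerate_part (C \<alpha>)))"

definition enneper_surface :: "real \<Rightarrow> (real^3) set" where
  "enneper_surface \<alpha> = {enneper \<alpha> s \<theta> | s \<theta>. s \<noteq> 0}"

definition open_part_of_enneper2 :: "(real^3) set \<Rightarrow> bool" where
  "open_part_of_enneper2 S \<longleftrightarrow>
     (\<exists>\<alpha>>0. \<exists>\<Phi>. lorentz_isometry \<Phi> \<and> open_part S (\<Phi> ` enneper_surface \<alpha>))"

definition open_part_of_enneper3 :: "(real^3) set \<Rightarrow> bool" where
  "open_part_of_enneper3 S \<longleftrightarrow>
     (\<exists>\<alpha><0. \<exists>\<Phi>. lorentz_isometry \<Phi> \<and> open_part S (\<Phi> ` enneper_surface \<alpha>))"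

end

theory Submission
  imports Defs "HOL-Computational_Algebra.Polynomial"
begin

text \<open>Each of the four parametrizations has the form \<open>x = f r(\<theta>) + g e\<close>, where \<open>e\<close> is fixed by the
  rotations and \<open>r\<close> is one of their orbits. For the first three \<open>e\<close> spans the axis and \<open>r\<close> is a unit
  circle or hyperbola orthogonal to it. For a lightlike axis \<open>r\<close> is a parabola of null vectors, \<open>e\<close> is
  a null vector, and \<open>f\<close>, \<open>g\<close> stand for \<open>h = f - g\<close> and \<open>m = f + g\<close>. In all cases the Gram matrix of
  \<open>r(\<theta>), e\<close> does not depend on \<open>\<theta>\<close>, and \<open>r''\<close> is a constant combination of \<open>r\<close> and \<open>e\<close>. The
  geometry of the surface depends on the rotations only through these constants, so it is done once, for a
  \<open>rotation_frame\<close>.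

  The unit normal is \<open>\<plusminus>(u r(\<theta>) + v e)\<close> with \<open>u\<close>, \<open>v\<close> depending on \<open>s\<close> alone (\<open>normal_eq\<close>), so the
  third form is diagonal with coefficients depending on \<open>s\<close> alone, and \<open>\<Delta>\<^sup>I\<^sup>I\<^sup>I x\<close> is again of the form
  \<open>p(s) r(\<theta>) + q(s) e\<close> (\<open>laplace_III_eq\<close>). Differentiating \<open>p r + q e = A x\<close> twice in \<open>\<theta>\<close> removes
  the matrix: it becomes \<open>p = \<Lambda> f, q = \<mu> g\<close> for a non-lightlike axis and \<open>p = \<Lambda> h, q = \<tau> h + \<Lambda> m\<close> for a
  lightlike one, with constants \<open>\<Lambda>, \<mu>, \<tau>\<close>.

  For a non-lightlike axis, let \<open>w\<close> be the radius of curvature of the profile curve. The equation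
  for \<open>g\<close> expresses \<open>w'\<close> through \<open>g, w\<close> and the velocity, so the equation for \<open>f\<close> turns into a relation that is
  linear in \<open>f, g, w\<close> and polynomial in \<open>f', g'\<close>. Differentiating it twice and eliminating gives a
  polynomial in \<open>f'\<^sup>2\<close> alone, with constant coefficients. As \<open>f'\<close> is not constant, all coefficients
  vanish, and this forces \<open>\<Lambda> = \<mu>\<close> (\<open>axial_eigenvalue_dichotomy\<close>). If \<open>\<Lambda> = \<mu> \<noteq> 0\<close>, the first derived
  relation says that the position vector is orthogonal to the velocity, so \<open>\<langle>x, x\<rangle>\<close> is a non-zero constant. If
  \<open>\<Lambda> = \<mu> = 0\<close>, then \<open>f g'\<close> is constant, which is the first integral of the catenary equation
  (\<open>catenary_profile\<close>). For a lightlike axis the same elimination gives \<open>\<tau> = 0\<close>, and then either \<open>h m\<close> is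
  constant or \<open>m\<close> is a cubic \<open>C h\<^sup>3 + t0\<close> (\<open>lightlike_profile\<close>).

  Finally, one linear coordinate (\<open>g\<close>, respectively \<open>h\<close>) has non-vanishing derivative, so its values fill an
  open interval. The surface is the part of the model surface over that interval, hence open in it.\<close>

section \<open>Lorentzian linear algebra\<close>

lemma lorentz_add_left: "lorentz (u + v) w = lorentz u w + lorentz v w"
  and lorentz_add_right: "lorentz w (u + v) = lorentz w u + lorentz w v"
  and lorentz_scaleR_left: "lorentz (t *\<^sub>R u) w = t * lorentz u w"
  and lorentz_scaleR_right: "lorentz w (t *\<^sub>R u) = t * lorentz w u"
  by (simp_all add: lorentz_def algebra_simps)

lemma lorentz_diff_left: "lorentz (u - v) w = lorentz u w - lorentz v w"
  and lorentz_diff_right: "lorentz w (u - v) = lorentz w u - lorentz w v"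
  by (simp_all add: lorentz_def algebra_simps)

lemmas lorentz_linear =
  lorentz_add_left lorentz_add_right lorentz_scaleR_left lorentz_scaleR_right
  lorentz_diff_left lorentz_diff_right

lemma lorentz_commute: "lorentz u v = lorentz v u"
  by (simp add: lorentz_def)

lemma lorentz_zero [simp]: "lorentz 0 u = 0" "lorentz u 0 = 0"
  by (simp_all add: lorentz_def)

lemma lorentz_nondegenerate:
  assumes "\<And>v. lorentz w v = 0"
  shows "w = 0"
proof -
  have "lorentz w (axis 1 1) = 0" "lorentz w (axis 2 1) = 0" "lorentz w (axis 3 1) = 0"
    using assms by auto
  then show ?thesis
    by (simp add: lorentz_def vec_eq_iff forall_3 axis_def)
qed

text \<open>Three mutually orthogonal non-null vectors are linearly independent, hence a basis, and the
  metric is non-degenerate.\<close>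

lemma orthogonal_to_frame_eq_0:
  assumes pq: "lorentz p q = 0" and pt: "lorentz p t = 0" and qt: "lorentz q t = 0"
    and pp: "lorentz p p \<noteq> 0" and qq: "lorentz q q \<noteq> 0" and tt: "lorentz t t \<noteq> 0"
    and w: "lorentz w p = 0" "lorentz w q = 0" "lorentz w t = 0"
  shows "w = 0"
proof -
  note comm = lorentz_commute[of q p] lorentz_commute[of t p] lorentz_commute[of t q]
  have ne: "p \<noteq> q" "p \<noteq> t" "q \<noteq> t"
    using assms by auto
  have "independent {p, q, t}"
  proof (rule independent_if_scalars_zero)
    fix c y assume s: "(\<Sum>x\<in>{p, q, t}. c x *\<^sub>R x) = 0" and y: "y \<in> {p, q, t}"
    have s': "c p *\<^sub>R p + (c q *\<^sub>R q + c t *\<^sub>R t) = 0"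
      using s ne by simp
    have "lorentz (c p *\<^sub>R p + (c q *\<^sub>R q + c t *\<^sub>R t)) z = 0" for z
      unfolding s' by simp
    from this[of p] this[of q] this[of t] show "c y = 0"
      using assms comm y by (auto simp: lorentz_linear)
  qed simp
  then have "span {p, q, t} = UNIV"
    using ne by (intro card_ge_dim_independent[of _ UNIV, THEN top.extremum_uniqueI]) auto
  moreover have "span {p, q, t} \<subseteq> {v. lorentz w v = 0}"
    by (rule span_minimal) (auto simp: w lorentz_linear subspace_def)
  ultimately have "lorentz w v = 0" for v
    by blast
  then show ?thesis
    by (rule lorentz_nondegenerate)
qed

lemma continuous_on_lorentz [continuous_intros]:
  assumes "continuous_on S p" "continuous_on S q"
  shows "continuous_on S (\<lambda>z. lorentz (p z) (q z))"
  unfolding lorentz_def by (intro continuous_intros assms)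

lemma lorentz_isometry_translation: "lorentz_isometry (\<lambda>p. p + c)"
  unfolding lorentz_isometry_def by (intro exI[of _ "mat 1"] exI[of _ c]) auto

section \<open>Calculus on an open interval\<close>

lemma pd1_eqI:
  assumes "open I" "s \<in> I" "\<And>s'. s' \<in> I \<Longrightarrow> p s' \<theta> = q s'"
    and "(q has_vector_derivative D) (at s)"
  shows "pd 1 p s \<theta> = D"
proof -
  have "((\<lambda>s'. p s' \<theta>) has_vector_derivative D) (at s)"
    by (rule has_vector_derivative_transform_within_open[OF assms(4,1,2)]) (simp add: assms(3))
  then show ?thesis
    by (simp add: pd_def vector_derivative_at)
qed

lemma pd2_eqI:
  assumes "\<And>\<theta>'. p s \<theta>' = q \<theta>'" and "(q has_vector_derivative D) (at \<theta>)"
  shows "pd 2 p s \<theta> = D"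
proof -
  have "p s = q"
    using assms(1) by blast
  with assms(2) show ?thesis
    by (simp add: pd_def vector_derivative_at)
qed

lemma has_real_derivative_scaleR_const:
  assumes "(f has_real_derivative f') (at s)"
  shows "((\<lambda>s. f s *\<^sub>R c) has_vector_derivative f' *\<^sub>R c) (at s)"
  using has_vector_derivative_scaleR[OF assms has_vector_derivative_const[of c]] by simp

lemma curve_has_vector_derivative:
  assumes "(f has_real_derivative f') (at s)" "(g has_real_derivative g') (at s)"
  shows "((\<lambda>s. f s *\<^sub>R c + g s *\<^sub>R e) has_vector_derivative f' *\<^sub>R c + g' *\<^sub>R e) (at s)"
  by (intro has_vector_derivative_add has_real_derivative_scaleR_const assms)

lemma has_real_derivative_transform_on:
  assumes "(f has_real_derivative D) (at s)" "open I" "s \<in> I" "\<And>t. t \<in> I \<Longrightarrow> f t = g t"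
  shows "(g has_real_derivative D) (at s)"
  using assms has_field_derivative_transform_within_open by blast

lemma smooth_fun_on_derivative:
  assumes "smooth_fun_on f I" "open I" "s \<in> I"
  shows "((deriv ^^ k) f has_real_derivative (deriv ^^ Suc k) f s) (at s)"
proof -
  have "(deriv ^^ k) f differentiable (at s)"
    using assms differentiable_on_eq_differentiable_at unfolding smooth_fun_on_def by blast
  then show ?thesis
    by (simp add: DERIV_deriv_iff_real_differentiable)
qed

lemma derivative_of_vanishing:
  assumes "open I" "s \<in> I" "\<And>t. t \<in> I \<Longrightarrow> F t = 0" "(F has_real_derivative D) (at s)"
  shows "D = 0"
  using has_field_derivative_transform_within_open[OF assms(4,1,2), of "\<lambda>_. 0"] assms(3)
    DERIV_unique[OF _ DERIV_const] by fastforce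

lemma constant_on_interval:
  fixes F :: "real \<Rightarrow> real"
  assumes "is_interval I" "\<And>s. s \<in> I \<Longrightarrow> (F has_real_derivative 0) (at s)"
  obtains c where "\<And>s. s \<in> I \<Longrightarrow> F s = c"
  using has_field_derivative_zero_constant[of I F] assms
  by (meson DERIV_subset is_interval_convex subset_UNIV)

text \<open>A continuous function on an interval that takes finitely many values is constant.\<close>

lemma polynomial_on_nonconstant_range_eq_0:
  fixes y :: "real \<Rightarrow> real" and p :: "real poly"
  assumes I: "is_interval I" and y: "\<And>s. s \<in> I \<Longrightarrow> (y has_real_derivative y' s) (at s)"
    and s: "s \<in> I" "y' s \<noteq> 0" "open I"
    and p: "\<And>s. s \<in> I \<Longrightarrow> poly p (y s) = 0"
  shows "p = 0"
proof (rule ccontr)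
  assume "p \<noteq> 0"
  then have "finite {t. poly p t = 0}"
    by (rule poly_roots_finite)
  then have "finite (y ` I)"
    by (rule finite_subset[rotated]) (use p in auto)
  moreover have "connected I" "continuous_on I y"
    using I y by (auto simp: is_interval_connected_1 intro!: continuous_at_imp_continuous_on DERIV_isCont)
  ultimately have "y constant_on I"
    by (simp add: continuous_finite_range_constant)
  then obtain c where "\<And>s. s \<in> I \<Longrightarrow> y s - c = 0"
    by (auto simp: constant_on_def)
  then have "y' s = 0"
    by (rule derivative_of_vanishing[OF s(3,1)]) (auto intro!: derivative_eq_intros y s)
  with s show False by simp
qed

lemma constant_sign_on_interval:
  fixes V :: "real \<Rightarrow> real"
  assumes "is_interval I" "continuous_on I V" "\<And>s. s \<in> I \<Longrightarrow> V s \<noteq> 0"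
  shows "\<exists>\<sigma>\<in>{1,-1}. \<forall>s\<in>I. \<bar>V s\<bar> = \<sigma> * V s"
proof -
  have conn: "connected (V ` I)"
    using assms by (simp add: connected_continuous_image is_interval_connected_1)
  have zero: "0 \<notin> V ` I"
    using assms(3) by force
  have "\<not> (V s < 0 \<and> V t > 0)" if "s \<in> I" "t \<in> I" for s t
    using connectedD_interval[OF conn, of "V s" "V t" 0] zero that by auto
  then have "(\<forall>s\<in>I. V s > 0) \<or> (\<forall>s\<in>I. V s < 0)"
    using assms(3) by (meson linorder_neqE_linordered_idom)
  then show ?thesis
    by auto
qed

lemma open_image_nonzero_derivative:
  fixes g :: "real \<Rightarrow> real"
  assumes I: "open I" "is_interval I"
    and g: "\<And>s. s \<in> I \<Longrightarrow> (g has_real_derivative g1 s) (at s)" "\<And>s. s \<in> I \<Longrightarrow> g1 s \<noteq> 0"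
  shows "open (g ` I)"
proof -
  have cont: "continuous_on I g"
    using g(1) by (auto intro!: continuous_at_imp_continuous_on DERIV_isCont)
  have "g s \<noteq> g t" if st: "s \<in> I" "t \<in> I" "s < t" for s t
  proof
    assume eq: "g s = g t"
    have sub: "{s..t} \<subseteq> I"
      using mem_is_interval_1_I[OF I(2) st(1,2)] by auto
    have "\<exists>z. s < z \<and> z < t \<and> (g has_real_derivative 0) (at z)"
    proof (rule Rolle[OF st(3) eq])
      show "continuous_on {s..t} g"
        using cont sub by (rule continuous_on_subset)
      show "g differentiable (at y)" if "s < y" "y < t" for y
      proof -
        have "y \<in> I"
          using sub that by auto
        then show ?thesis
          using g(1) real_differentiable_def by blast
      qed
    qed
    then obtain z where z: "s < z" "z < t" "(g has_real_derivative 0) (at z)"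
      by blast
    then have "z \<in> I"
      using sub by auto
    then show False
      using g[of z] DERIV_unique[OF z(3)] by auto
  qed
  then have "inj_on g I"
    by (metis inj_onI linorder_less_linear)
  then show ?thesis
    using injective_eq_1d_open_map_UNIV[OF cont I(2)] I(1) by blast
qed

section \<open>Surfaces swept out by a rotated curve\<close>

text \<open>The curve \<open>r\<close> is an orbit of a one-parameter group of Lorentz transformations fixing \<open>e\<close>, which is why the Gram matrix is
  constant. Differentiating \<open>\<langle>r', r\<rangle> = 0\<close> and \<open>\<langle>r', e\<rangle> = 0\<close> gives the two relations \<open>second\<close> between \<open>\<kappa>\<close>, \<open>\<nu>\<close> and
  the other constants.\<close>

locale rotation_frame =
  fixes r r1 :: "real \<Rightarrow> real^3" and e :: "real^3" and a b d \<rho> \<kappa> \<nu> :: real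
  assumes r_deriv: "\<And>\<theta>. (r has_vector_derivative r1 \<theta>) (at \<theta>)"
    and r1_deriv: "\<And>\<theta>. (r1 has_vector_derivative \<kappa> *\<^sub>R r \<theta> + \<nu> *\<^sub>R e) (at \<theta>)"
    and gram: "\<And>\<theta>. lorentz (r \<theta>) (r \<theta>) = a" "\<And>\<theta>. lorentz (r \<theta>) e = b" "lorentz e e = d"
      "\<And>\<theta>. lorentz (r1 \<theta>) (r \<theta>) = 0" "\<And>\<theta>. lorentz (r1 \<theta>) e = 0"
      "\<And>\<theta>. lorentz (r1 \<theta>) (r1 \<theta>) = \<rho>"
    and rho: "\<rho> = 1 \<or> \<rho> = -1"
    and second: "\<kappa> * a + \<nu> * b = - \<rho>" "\<kappa> * b + \<nu> * d = 0"
begin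

lemma gram':
  "lorentz e (r \<theta>) = b" "lorentz (r \<theta>) (r1 \<theta>) = 0" "lorentz e (r1 \<theta>) = 0"
  using gram by (simp_all add: lorentz_commute)

lemma lorentz_meridian_plane:
  "lorentz (p *\<^sub>R r \<theta> + q *\<^sub>R e) (p' *\<^sub>R r \<theta> + q' *\<^sub>R e)
     = (a * p + b * q) * p' + (b * p + d * q) * q'"
  by (simp add: lorentz_linear gram gram' algebra_simps)

lemma lorentz_r1_meridian_plane [simp]:
  "lorentz (r1 \<theta>) (p *\<^sub>R r \<theta> + q *\<^sub>R e) = 0" "lorentz (p *\<^sub>R r \<theta> + q *\<^sub>R e) (r1 \<theta>) = 0"
  by (simp_all add: lorentz_linear gram gram')

end

text \<open>The functions \<open>u\<close> and \<open>v\<close> are the coefficients of a unit normal \<open>u r(\<theta>) + v e\<close>, and \<open>\<epsilon>\<close> is its square. They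
  are parameters because the convenient choice depends on the parametrization of the profile curve: rational in
  the velocity for arclength, with a square root otherwise.\<close>

locale rotation_surface = rotation_frame +
  fixes I :: "real set" and x n :: "real \<Rightarrow> real \<Rightarrow> real^3"
    and f g f1 g1 f2 g2 u v u1 v1 :: "real \<Rightarrow> real" and \<epsilon> :: real
  assumes I: "open I" "is_interval I"
    and x_eq: "\<And>s \<theta>. s \<in> I \<Longrightarrow> x s \<theta> = f s *\<^sub>R r \<theta> + g s *\<^sub>R e"
    and derivs: "\<And>s. s \<in> I \<Longrightarrow> (f has_real_derivative f1 s) (at s)"
      "\<And>s. s \<in> I \<Longrightarrow> (g has_real_derivative g1 s) (at s)"
      "\<And>s. s \<in> I \<Longrightarrow> (f1 has_real_derivative f2 s) (at s)"
      "\<And>s. s \<in> I \<Longrightarrow> (g1 has_real_derivative g2 s) (at s)"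
      "\<And>s. s \<in> I \<Longrightarrow> (u has_real_derivative u1 s) (at s)"
      "\<And>s. s \<in> I \<Longrightarrow> (v has_real_derivative v1 s) (at s)"
    and nondeg: "\<And>s \<theta>. s \<in> I \<Longrightarrow> nondegenerate_at x s \<theta>"
    and normal: "unit_normal_field I x n"
    and curved: "\<And>s \<theta>. s \<in> I \<Longrightarrow> coeff_L x n s \<theta> * coeff_N x n s \<theta> - (coeff_M x n s \<theta>)\<^sup>2 \<noteq> 0"
    and conormal: "\<And>s. s \<in> I \<Longrightarrow> (a * u s + b * v s) * f1 s + (b * u s + d * v s) * g1 s = 0"
      "\<And>s. s \<in> I \<Longrightarrow> (a * u s + b * v s) * u s + (b * u s + d * v s) * v s = \<epsilon>"
    and eps: "\<epsilon> = 1 \<or> \<epsilon> = -1"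
begin

lemma x_s: "s \<in> I \<Longrightarrow> pd 1 x s \<theta> = f1 s *\<^sub>R r \<theta> + g1 s *\<^sub>R e"
  by (rule pd1_eqI[OF I(1) _ x_eq curve_has_vector_derivative]) (auto intro: derivs)

lemma x_\<theta>: "s \<in> I \<Longrightarrow> pd 2 x s \<theta> = f s *\<^sub>R r1 \<theta>"
  by (rule pd2_eqI[where q = "\<lambda>\<theta>. f s *\<^sub>R r \<theta> + g s *\<^sub>R e"])
     (auto intro!: derivative_eq_intros r_deriv simp: x_eq)

lemma speed_nonzero:
  assumes "s \<in> I"
  shows "f s \<noteq> 0" "(a * f1 s + b * g1 s) * f1 s + (b * f1 s + d * g1 s) * g1 s \<noteq> 0"
  using nondeg[OF assms, of 0] assms
  by (auto simp: nondegenerate_at_def coeff_E_def coeff_F_def coeff_G_def x_s x_\<theta>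
      lorentz_meridian_plane lorentz_scaleR_right)

abbreviation "n0 s \<theta> \<equiv> u s *\<^sub>R r \<theta> + v s *\<^sub>R e"

text \<open>Both \<open>n\<close> and \<open>n0\<close> are unit vectors orthogonal to the tangent plane, so \<open>n = K n0\<close> with \<open>K = \<plusminus>1\<close> at every
  point; \<open>K\<close> is continuous on a connected domain, hence constant.\<close>

lemma normal_eq: "\<exists>\<sigma>\<in>{1,-1}. \<forall>s\<in>I. \<forall>\<theta>. n s \<theta> = \<sigma> *\<^sub>R n0 s \<theta>"
proof -
  define K where "K = (\<lambda>(s, \<theta>). \<epsilon> * lorentz (n s \<theta>) (n0 s \<theta>))"
  have n_eq: "n s \<theta> = K (s, \<theta>) *\<^sub>R n0 s \<theta>" if s: "s \<in> I" for s \<theta>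
  proof -
    have un: "lorentz (n s \<theta>) (f1 s *\<^sub>R r \<theta> + g1 s *\<^sub>R e) = 0" "lorentz (n s \<theta>) (r1 \<theta>) = 0"
      using normal s speed_nonzero(1)[OF s]
      by (auto simp: unit_normal_field_def x_s x_\<theta> lorentz_scaleR_right)
    have sq: "\<epsilon> * \<epsilon> = 1"
      using eps by auto
    have "n s \<theta> - K (s, \<theta>) *\<^sub>R n0 s \<theta> = 0"
    proof (rule orthogonal_to_frame_eq_0)
      show "lorentz (n0 s \<theta>) (f1 s *\<^sub>R r \<theta> + g1 s *\<^sub>R e) = 0"
        using conormal(1)[OF s] by (simp add: lorentz_meridian_plane)
      show "lorentz (n0 s \<theta>) (r1 \<theta>) = 0" "lorentz (f1 s *\<^sub>R r \<theta> + g1 s *\<^sub>R e) (r1 \<theta>) = 0"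
        by simp_all
      show "lorentz (n0 s \<theta>) (n0 s \<theta>) \<noteq> 0"
        using conormal(2)[OF s] eps by (auto simp: lorentz_meridian_plane)
      show "lorentz (f1 s *\<^sub>R r \<theta> + g1 s *\<^sub>R e) (f1 s *\<^sub>R r \<theta> + g1 s *\<^sub>R e) \<noteq> 0"
        using speed_nonzero(2)[OF s] by (simp add: lorentz_meridian_plane)
      show "lorentz (r1 \<theta>) (r1 \<theta>) \<noteq> 0"
        using rho by (auto simp: gram)
      show "lorentz (n s \<theta> - K (s, \<theta>) *\<^sub>R n0 s \<theta>) (n0 s \<theta>) = 0"
        using conormal(2)[OF s] sq
        by (simp add: K_def lorentz_diff_left lorentz_scaleR_left[of _ "n0 s \<theta>"] lorentz_meridian_plane)
      show "lorentz (n s \<theta> - K (s, \<theta>) *\<^sub>R n0 s \<theta>) (f1 s *\<^sub>R r \<theta> + g1 s *\<^sub>R e) = 0"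
        using conormal(1)[OF s] un
        by (simp add: lorentz_diff_left lorentz_scaleR_left[of _ "n0 s \<theta>"] lorentz_meridian_plane)
      show "lorentz (n s \<theta> - K (s, \<theta>) *\<^sub>R n0 s \<theta>) (r1 \<theta>) = 0"
        using un by (simp add: lorentz_diff_left lorentz_scaleR_left[of _ "n0 s \<theta>"])
    qed
    then show ?thesis by simp
  qed
  have K_values: "K z \<in> {1,-1}" if z: "z \<in> I \<times> UNIV" for z
  proof -
    obtain s \<theta> where z_eq: "z = (s, \<theta>)" and s: "s \<in> I"
      using z by auto
    have "lorentz (n s \<theta>) (n s \<theta>) = (K z)\<^sup>2 * \<epsilon>"
      unfolding z_eq using conormal(2)[OF s]
      by (subst (1 2) n_eq[OF s])
         (simp add: lorentz_scaleR_left[of _ "n0 s \<theta>"] lorentz_scaleR_right[of _ _ "n0 s \<theta>"] lorentz_meridian_plane power2_eq_square)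
    moreover have "lorentz (n s \<theta>) (n s \<theta>) = 1 \<or> lorentz (n s \<theta>) (n s \<theta>) = -1"
      using normal s by (auto simp: unit_normal_field_def)
    ultimately have "(K z)\<^sup>2 = 1"
      using eps by (smt (verit) zero_le_power2 mult_cancel_left1 mult_minus_right)
    then show ?thesis
      by (simp add: power2_eq_1_iff)
  qed
  have cont: "continuous_on (I \<times> UNIV) K"
  proof -
    have c: "continuous_on I u" "continuous_on I v"
      using derivs by (auto intro!: continuous_at_imp_continuous_on DERIV_isCont)
    have "continuous_on UNIV r"
      using r_deriv by (auto intro!: continuous_at_imp_continuous_on has_vector_derivative_continuous)
    then have n0: "continuous_on (I \<times> UNIV) (\<lambda>z. n0 (fst z) (snd z))"
      by (auto intro!: continuous_intros continuous_on_compose2[OF c(1)] continuous_on_compose2[OF c(2)]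
          continuous_on_compose2[of UNIV r])
    have "continuous_on (I \<times> UNIV) (\<lambda>z. n (fst z) (snd z))"
      using normal by (simp add: unit_normal_field_def case_prod_unfold)
    from continuous_on_lorentz[OF this n0] show ?thesis
      unfolding K_def case_prod_unfold by (intro continuous_on_mult continuous_on_const)
  qed
  have "connected (I \<times> (UNIV :: real set))"
    by (intro connected_Times) (use I in \<open>auto simp: is_interval_connected_1\<close>)
  from continuous_finite_range_constant[OF this cont]
  have "K constant_on (I \<times> UNIV)"
    using K_values finite_subset[of "K ` (I \<times> UNIV)" "{1,-1}"] by blast
  then obtain \<sigma> where \<sigma>: "\<And>z. z \<in> I \<times> UNIV \<Longrightarrow> K z = \<sigma>"
    by (auto simp: constant_on_def)
  show ?thesis
  proof (cases "I = {}")
    case False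
    then have "\<sigma> \<in> {1,-1}"
      using K_values \<sigma> by fastforce
    then show ?thesis
      using n_eq \<sigma> by fastforce
  qed auto
qed

lemma third_form_eq:
  assumes s: "s \<in> I"
  shows "third_form n s \<theta> = (\<chi> k m. if k = m then
           if k = 1 then (a * u1 s + b * v1 s) * u1 s + (b * u1 s + d * v1 s) * v1 s
           else \<rho> * (u s)\<^sup>2 else 0)"
proof -
  obtain \<sigma> where \<sigma>: "\<sigma> \<in> {1,-1}" and n: "\<And>s \<theta>. s \<in> I \<Longrightarrow> n s \<theta> = \<sigma> *\<^sub>R n0 s \<theta>"
    using normal_eq by blast
  have n_s: "pd 1 n s \<theta> = \<sigma> *\<^sub>R (u1 s *\<^sub>R r \<theta> + v1 s *\<^sub>R e)"
    by (rule pd1_eqI[OF I(1) s n])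
       (auto intro!: bounded_linear.has_vector_derivative[OF bounded_linear_scaleR_right] curve_has_vector_derivative derivs s simp del: scaleR_add_right)
  have n_\<theta>: "pd 2 n s \<theta> = \<sigma> *\<^sub>R u s *\<^sub>R r1 \<theta>"
    by (rule pd2_eqI[where q = "\<lambda>\<theta>. \<sigma> *\<^sub>R n0 s \<theta>"]) (auto simp: n s intro!: derivative_eq_intros r_deriv)
  have "\<sigma> * \<sigma> = 1"
    using \<sigma> by auto
  then have sq: "\<sigma> * (\<sigma> * t) = t" for t
    by (metis mult.assoc mult_1)
  show ?thesis
    unfolding third_form_def vec_eq_iff
    by (simp add: forall_2 n_s n_\<theta> lorentz_scaleR_left lorentz_scaleR_right lorentz_meridian_plane sq gram
        power2_eq_square del: scaleR_add_right)
qed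

text \<open>The mixed coefficient \<open>M\<close> vanishes, \<open>N\<close> is a multiple of \<open>f u\<close>, and \<open>L\<close> is, up to sign, the
  second of the two quantities.\<close>

lemma curvature_nonzero:
  assumes s: "s \<in> I"
  shows "u s \<noteq> 0" "(a * u s + b * v s) * f2 s + (b * u s + d * v s) * g2 s \<noteq> 0"
proof -
  obtain \<sigma> where \<sigma>: "\<sigma> \<in> {1,-1}" and n: "\<And>s \<theta>. s \<in> I \<Longrightarrow> n s \<theta> = \<sigma> *\<^sub>R n0 s \<theta>"
    using normal_eq by blast
  have x_ss: "pd 1 (pd 1 x) s \<theta> = f2 s *\<^sub>R r \<theta> + g2 s *\<^sub>R e" for \<theta>
    by (rule pd1_eqI[OF I(1) s x_s]) (auto intro!: curve_has_vector_derivative derivs s)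
  have x_s\<theta>: "pd 2 (pd 1 x) s \<theta> = f1 s *\<^sub>R r1 \<theta>" for \<theta>
    by (rule pd2_eqI[where q = "\<lambda>\<theta>. f1 s *\<^sub>R r \<theta> + g1 s *\<^sub>R e"])
       (auto intro!: derivative_eq_intros r_deriv simp: x_s s)
  have x_\<theta>\<theta>: "pd 2 (pd 2 x) s \<theta> = f s *\<^sub>R (\<kappa> *\<^sub>R r \<theta> + \<nu> *\<^sub>R e)" for \<theta>
    by (rule pd2_eqI[where q = "\<lambda>\<theta>. f s *\<^sub>R r1 \<theta>"]) (auto simp: x_\<theta> s intro!: bounded_linear.has_vector_derivative[OF bounded_linear_scaleR_right] r1_deriv simp del: scaleR_add_right)
  have "coeff_N x n s 0 = \<sigma> * f s * ((a * \<kappa> + b * \<nu>) * u s + (b * \<kappa> + d * \<nu>) * v s)"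
    by (simp add: coeff_N_def n[OF s] x_\<theta>\<theta> lorentz_scaleR_left lorentz_scaleR_right lorentz_meridian_plane del: scaleR_add_right)
  also have "\<dots> = \<sigma> * f s * (- \<rho> * u s)"
    using second by (simp add: mult.commute)
  finally have N: "coeff_N x n s 0 = \<sigma> * f s * (- \<rho> * u s)" .
  have M: "coeff_M x n s 0 = 0"
    by (simp add: coeff_M_def n[OF s] x_s\<theta> lorentz_scaleR_left lorentz_scaleR_right del: scaleR_add_right)
  have L: "coeff_L x n s 0 = \<sigma> * ((a * u s + b * v s) * f2 s + (b * u s + d * v s) * g2 s)"
    by (simp only: coeff_L_def n[OF s] x_ss lorentz_scaleR_right lorentz_meridian_plane)
       (simp add: algebra_simps)
  show "u s \<noteq> 0" "(a * u s + b * v s) * f2 s + (b * u s + d * v s) * g2 s \<noteq> 0"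
    using curved[OF s, of 0] unfolding L M N by auto
qed

text \<open>The derivative of the normal is parallel to the velocity of the profile curve, because both are
  orthogonal to the normal within the plane of \<open>r(\<theta>), e\<close>. By Lagrange's identity the Gram determinant of these two
  vectors is therefore zero, so \<open>e\<^sub>1\<^sub>1 E = L\<^sup>2\<close>.\<close>

lemma third_form_nonzero:
  assumes s: "s \<in> I"
  shows "(a * u1 s + b * v1 s) * u1 s + (b * u1 s + d * v1 s) * v1 s \<noteq> 0"
proof -
  let ?p = "a * u s + b * v s" and ?q = "b * u s + d * v s"
  have "((\<lambda>s. (a * u s + b * v s) * f1 s + (b * u s + d * v s) * g1 s) has_real_derivative
      (a * u1 s + b * v1 s) * f1 s + (b * u1 s + d * v1 s) * g1 s + (?p * f2 s + ?q * g2 s)) (at s)"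
    by (auto intro!: derivative_eq_intros derivs s simp: algebra_simps)
  from has_real_derivative_transform_on[OF this I(1) s conormal(1)]
  have 1: "(a * u1 s + b * v1 s) * f1 s + (b * u1 s + d * v1 s) * g1 s + (?p * f2 s + ?q * g2 s) = 0"
    by (auto dest: DERIV_unique[OF _ DERIV_const])
  have "((\<lambda>s. (a * u s + b * v s) * u s + (b * u s + d * v s) * v s) has_real_derivative
      2 * (?p * u1 s + ?q * v1 s)) (at s)"
    by (auto intro!: derivative_eq_intros derivs s simp: algebra_simps)
  from has_real_derivative_transform_on[OF this I(1) s conormal(2)]
  have 2: "?p * u1 s + ?q * v1 s = 0"
    by (auto dest: DERIV_unique[OF _ DERIV_const])
  have 3: "?p * f1 s + ?q * g1 s = 0"
    using conormal(1)[OF s] .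
  have "?p \<noteq> 0 \<or> ?q \<noteq> 0"
    using conormal(2)[OF s] eps by auto
  have par: "u1 s * g1 s = v1 s * f1 s"
  proof -
    have "?p * (u1 s * g1 s - v1 s * f1 s) = g1 s * (?p * u1 s + ?q * v1 s) - v1 s * (?p * f1 s + ?q * g1 s)"
      "?q * (u1 s * g1 s - v1 s * f1 s) = u1 s * (?p * f1 s + ?q * g1 s) - f1 s * (?p * u1 s + ?q * v1 s)"
      by (simp_all add: algebra_simps)
    then show ?thesis
      using 2 3 \<open>?p \<noteq> 0 \<or> ?q \<noteq> 0\<close> by auto
  qed
  define E where "E = (a * f1 s + b * g1 s) * f1 s + (b * f1 s + d * g1 s) * g1 s"
  define III where "III = (a * u1 s + b * v1 s) * u1 s + (b * u1 s + d * v1 s) * v1 s"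
  define II where "II = (a * u1 s + b * v1 s) * f1 s + (b * u1 s + d * v1 s) * g1 s"
  have "II \<noteq> 0"
    using 1 curvature_nonzero(2)[OF s] by (auto simp: II_def)
  moreover have "E * III = II\<^sup>2 + (a * d - b\<^sup>2) * (u1 s * g1 s - v1 s * f1 s)\<^sup>2"
    unfolding E_def II_def III_def by (simp add: power2_eq_square algebra_simps)
  ultimately show ?thesis
    using par by (auto simp: III_def)
qed

end

section \<open>The Laplace operator of the third fundamental form\<close>

lemma matrix_inv_diag2:
  fixes p q :: real
  assumes "p \<noteq> 0" "q \<noteq> 0"
  shows "matrix_inv (\<chi> k m. if k = m then if k = 1 then p else q else 0 :: real^2^2)
       = (\<chi> k m. if k = m then if k = 1 then 1 / p else 1 / q else 0)"
    (is "matrix_inv ?M = ?N")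
proof -
  have MN: "?M ** ?N = mat 1" "?N ** ?M = mat 1"
    using assms by (simp_all add: matrix_matrix_mult_def vec_eq_iff forall_2 sum_2 mat_def)
  then have "?M ** matrix_inv ?M = mat 1"
    unfolding matrix_inv_def by (rule_tac someI2[of _ ?N]) auto
  then have "?N ** (?M ** matrix_inv ?M) = ?N"
    by simp
  then show ?thesis
    by (simp add: matrix_mul_assoc MN)
qed

text \<open>The factor \<open>\<surd>|e|\<close> is the absolute value of \<open>V\<close>. As \<open>V\<close> has constant sign and occurs once inside
  and once, inverted, outside the derivative, it may replace \<open>\<surd>|e|\<close>, which avoids differentiating an absolute value.\<close>

lemma laplace_III_separated:
  assumes I: "open I" "is_interval I"
    and x: "\<And>s \<theta>. s \<in> I \<Longrightarrow> x s \<theta> = f s *\<^sub>R r \<theta> + g s *\<^sub>R e"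
    and r: "\<And>\<theta>. (r has_vector_derivative r1 \<theta>) (at \<theta>)"
      "\<And>\<theta>. (r1 has_vector_derivative r2 \<theta>) (at \<theta>)"
    and fg: "\<And>s. s \<in> I \<Longrightarrow> (f has_real_derivative f1 s) (at s)"
      "\<And>s. s \<in> I \<Longrightarrow> (g has_real_derivative g1 s) (at s)"
    and III: "\<And>s \<theta>. s \<in> I \<Longrightarrow>
      third_form n s \<theta> = (\<chi> k m. if k = m then if k = 1 then P s else Q s else 0)"
    and V: "\<And>s. s \<in> I \<Longrightarrow> (V s)\<^sup>2 = \<bar>P s * Q s\<bar>" "continuous_on I V" "\<And>s. s \<in> I \<Longrightarrow> V s \<noteq> 0"
    and XY: "\<And>s. s \<in> I \<Longrightarrow> ((\<lambda>s. V s * f1 s / P s) has_real_derivative X s) (at s)"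
      "\<And>s. s \<in> I \<Longrightarrow> ((\<lambda>s. V s * g1 s / P s) has_real_derivative Y s) (at s)"
    and s: "s \<in> I"
  shows "laplace_III_vec n x s \<theta>
    = - (1 / V s) *\<^sub>R (X s *\<^sub>R r \<theta> + Y s *\<^sub>R e) - (f s / Q s) *\<^sub>R r2 \<theta>"
proof -
  obtain \<sigma> where \<sigma>: "\<sigma> = 1 \<or> \<sigma> = -1" "\<And>s. s \<in> I \<Longrightarrow> \<bar>V s\<bar> = \<sigma> * V s"
    using constant_sign_on_interval[OF I(2) V(2,3)] by blast
  have PQ: "P s \<noteq> 0" "Q s \<noteq> 0" if "s \<in> I" for s
    using V(1,3)[OF that] by auto
  have det: "sqrt \<bar>det (third_form n s \<theta>)\<bar> = \<sigma> * V s" if "s \<in> I" for s \<theta>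
    using \<sigma>(2)[OF that] by (simp add: III[OF that] det_2 flip: V(1)[OF that])
  have inv: "matrix_inv (third_form n s \<theta>)
      = (\<chi> k m. if k = m then if k = 1 then 1 / P s else 1 / Q s else 0)" if "s \<in> I" for s \<theta>
    by (simp add: III[OF that] matrix_inv_diag2 PQ[OF that])
  have component: "laplace_III n (\<lambda>s' \<theta>'. x s' \<theta>' $ i) s \<theta>
    = - (1 / V s) * (X s * r \<theta> $ i + Y s * e $ i) - f s / Q s * r2 \<theta> $ i" for i
  proof -
    define p where "p = (\<lambda>s' \<theta>'. x s' \<theta>' $ i)"
    define flux where "flux k m = (\<lambda>s' \<theta>'. sqrt \<bar>det (third_form n s' \<theta>')\<bar> *
        matrix_inv (third_form n s' \<theta>') $ k $ m * pd k p s' \<theta>')" for k m :: 2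
    have p: "p s \<theta> = f s * r \<theta> $ i + g s * e $ i" if "s \<in> I" for s \<theta>
      by (simp add: p_def x[OF that])
    have ri: "((\<lambda>\<theta>. r \<theta> $ i) has_real_derivative r1 \<theta> $ i) (at \<theta>)"
      "((\<lambda>\<theta>. r1 \<theta> $ i) has_real_derivative r2 \<theta> $ i) (at \<theta>)" for \<theta>
      using bounded_linear.has_vector_derivative[OF bounded_linear_vec_nth r(1)]
        bounded_linear.has_vector_derivative[OF bounded_linear_vec_nth r(2)]
      by (simp_all add: has_real_derivative_iff_has_vector_derivative)
    have p_s: "pd 1 p s \<theta> = f1 s * r \<theta> $ i + g1 s * e $ i" if "s \<in> I" for s \<theta>
      by (rule pd1_eqI[OF I(1) that, where q = "\<lambda>s. f s * r \<theta> $ i + g s * e $ i"])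
         (auto simp: p simp flip: has_real_derivative_iff_has_vector_derivative
            intro!: derivative_eq_intros fg that)
    have p_\<theta>: "pd 2 p s \<theta> = f s * r1 \<theta> $ i" if "s \<in> I" for s \<theta>
      by (rule pd2_eqI[where q = "\<lambda>\<theta>. f s * r \<theta> $ i + g s * e $ i"])
         (auto simp: p that simp flip: has_real_derivative_iff_has_vector_derivative
            intro!: derivative_eq_intros ri)
    have flux11: "flux 1 1 s \<theta> = \<sigma> * (V s * f1 s / P s * r \<theta> $ i + V s * g1 s / P s * e $ i)"
      and flux22: "flux 2 2 s \<theta> = \<sigma> * V s / Q s * f s * r1 \<theta> $ i"
      and flux12: "flux 1 2 s \<theta> = 0"
      and flux21: "flux 2 1 s \<theta> = 0" if "s \<in> I" for s \<theta>
      by (simp_all add: flux_def det[OF that] inv[OF that] p_s[OF that] p_\<theta>[OF that] ring_distribs)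
    have "pd 1 (flux 1 1) s \<theta> = \<sigma> * (X s * r \<theta> $ i + Y s * e $ i)"
      by (rule pd1_eqI[OF I(1) s, where q = "\<lambda>s. \<sigma> * (V s * f1 s / P s * r \<theta> $ i + V s * g1 s / P s * e $ i)"])
         (simp_all only: flux11 DERIV_cmult DERIV_add DERIV_cmult_right XY s
            flip: has_real_derivative_iff_has_vector_derivative)
    moreover have "pd 2 (flux 2 2) s \<theta> = \<sigma> * V s / Q s * f s * r2 \<theta> $ i"
      by (rule pd2_eqI[where q = "\<lambda>\<theta>. \<sigma> * V s / Q s * f s * r1 \<theta> $ i"])
         (simp_all only: flux22 s DERIV_cmult ri flip: has_real_derivative_iff_has_vector_derivative)
    moreover have "pd 2 (flux 1 2) s \<theta> = 0"
      by (rule pd2_eqI[where q = "\<lambda>\<theta>. 0"]) (auto simp: flux12 s)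
    moreover have "pd 1 (flux 2 1) s \<theta> = 0"
      by (rule pd1_eqI[OF I(1) s, where q = "\<lambda>s. 0"]) (auto simp: flux21)
    moreover have "laplace_III n p s \<theta> = - (1 / sqrt \<bar>det (third_form n s \<theta>)\<bar>) *
        (\<Sum>k\<in>UNIV. \<Sum>m\<in>UNIV. pd m (flux k m) s \<theta>)"
      unfolding laplace_III_def flux_def ..
    ultimately have "laplace_III n p s \<theta>
        = - (1 / (\<sigma> * V s)) * (\<sigma> * (X s * r \<theta> $ i + Y s * e $ i) + \<sigma> * V s / Q s * f s * r2 \<theta> $ i)"
      by (simp only: sum_2 det[OF s] add_0_left add_0_right)
    also have "\<dots> = - (1 / V s) * (X s * r \<theta> $ i + Y s * e $ i) - f s / Q s * r2 \<theta> $ i"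
    proof -
      have canc: "1 / (\<sigma> * V s) * \<sigma> = 1 / V s" "1 / (\<sigma> * V s) * (\<sigma> * V s / Q s) = 1 / Q s"
        using \<sigma>(1) V(3)[OF s] PQ[OF s] by auto
      have distr: "- y * (\<sigma> * A + k * h * t) = - (y * \<sigma>) * A - (y * k) * h * t" for y A k h t :: real
        by (simp add: algebra_simps)
      show ?thesis
        unfolding distr canc by simp
    qed
    finally show ?thesis
      unfolding p_def .
  qed
  show ?thesis
    unfolding vec_eq_iff
    by (simp only: laplace_III_vec_def component vec_lambda_beta vector_add_component
        vector_minus_component vector_scaleR_component real_scaleR_def simp_thms)
qed

context rotation_surface
begin

lemma laplace_III_eq:
  fixes P V X Y :: "real \<Rightarrow> real"
  assumes P: "\<And>s. s \<in> I \<Longrightarrow> P s = (a * u1 s + b * v1 s) * u1 s + (b * u1 s + d * v1 s) * v1 s"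
    and V: "\<And>s. s \<in> I \<Longrightarrow> (V s)\<^sup>2 = \<bar>P s * (\<rho> * (u s)\<^sup>2)\<bar>" "continuous_on I V"
    and XY: "\<And>s. s \<in> I \<Longrightarrow> ((\<lambda>s. V s * f1 s / P s) has_real_derivative X s) (at s)"
      "\<And>s. s \<in> I \<Longrightarrow> ((\<lambda>s. V s * g1 s / P s) has_real_derivative Y s) (at s)"
    and s: "s \<in> I"
  shows "laplace_III_vec n x s \<theta>
    = (- X s / V s - f s * \<kappa> / (\<rho> * (u s)\<^sup>2)) *\<^sub>R r \<theta> + (- Y s / V s - f s * \<nu> / (\<rho> * (u s)\<^sup>2)) *\<^sub>R e"
proof -
  have Vnz: "V s \<noteq> 0" if "s \<in> I" for s
    using V(1)[OF that] P[OF that] curvature_nonzero(1)[OF that] third_form_nonzero[OF that] rho by auto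
  have III: "third_form n s \<theta> = (\<chi> k m. if k = m then if k = 1 then P s else \<rho> * (u s)\<^sup>2 else 0)"
    if "s \<in> I" for s \<theta>
    unfolding third_form_eq[OF that] P[OF that] ..
  have "laplace_III_vec n x s \<theta>
    = - (1 / V s) *\<^sub>R (X s *\<^sub>R r \<theta> + Y s *\<^sub>R e) - (f s / (\<rho> * (u s)\<^sup>2)) *\<^sub>R (\<kappa> *\<^sub>R r \<theta> + \<nu> *\<^sub>R e)"
  proof (rule laplace_III_separated[where P = P and Q = "\<lambda>s. \<rho> * (u s)\<^sup>2" and V = V
        and X = X and Y = Y and f = f and g = g and r = r and e = e, OF I x_eq r_deriv r1_deriv derivs(1,2)])
    show "(V s)\<^sup>2 = \<bar>P s * (\<rho> * (u s)\<^sup>2)\<bar>" if "s \<in> I" for s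
      using V(1)[OF that] .
    show "third_form n s \<theta> = (\<chi> k m. if k = m then if k = 1 then P s else \<rho> * (u s)\<^sup>2 else 0)"
      if "s \<in> I" for s \<theta>
      using III[OF that] .
  qed (use V(2) Vnz XY s in auto)
  also have "\<dots> = (- X s / V s - f s * \<kappa> / (\<rho> * (u s)\<^sup>2)) *\<^sub>R r \<theta>
      + (- Y s / V s - f s * \<nu> / (\<rho> * (u s)\<^sup>2)) *\<^sub>R e"
  proof -
    have comp: "- (1 / y) * (p * w + q * t) - m / z * (k * w + l * t)
        = (- p / y - m * k / z) * w + (- q / y - m * l / z) * t" for y z p q m k l w t :: real
      by (simp add: divide_inverse algebra_simps)
    show ?thesis
      unfolding vec_eq_iff
      by (simp only: comp vector_add_component vector_minus_component vector_scaleR_component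
          real_scaleR_def simp_thms)
  qed
  finally show ?thesis .
qed

end

section \<open>Eliminating the matrix\<close>

context rotation_frame
begin

text \<open>Two differentiations in \<open>\<theta>\<close> remove the constant summands \<open>q e\<close> and \<open>A (g e)\<close> and replace \<open>r\<close> by \<open>r''\<close>.\<close>

lemma matrix_on_parallel:
  assumes eq: "\<And>\<theta>. p *\<^sub>R r \<theta> + q *\<^sub>R e = A *v (f *\<^sub>R r \<theta> + g *\<^sub>R e)"
  shows "p *\<^sub>R (\<kappa> *\<^sub>R r \<theta> + \<nu> *\<^sub>R e) = f *\<^sub>R (A *v (\<kappa> *\<^sub>R r \<theta> + \<nu> *\<^sub>R e))"
proof -
  note lin = bounded_linear.has_vector_derivative[OF matrix_vector_mul_bounded_linear]
  have "((\<lambda>\<theta>. p *\<^sub>R r \<theta> + q *\<^sub>R e) has_vector_derivative p *\<^sub>R r1 \<theta>) (at \<theta>)" for \<theta>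
    by (auto intro!: derivative_eq_intros r_deriv)
  moreover have "((\<lambda>\<theta>. A *v (f *\<^sub>R r \<theta> + g *\<^sub>R e)) has_vector_derivative A *v (f *\<^sub>R r1 \<theta>)) (at \<theta>)" for \<theta>
    by (intro lin) (auto intro!: derivative_eq_intros r_deriv)
  ultimately have eq1: "p *\<^sub>R r1 \<theta> = A *v (f *\<^sub>R r1 \<theta>)" for \<theta>
    unfolding eq by (rule vector_derivative_unique_at)
  have "((\<lambda>\<theta>. p *\<^sub>R r1 \<theta>) has_vector_derivative p *\<^sub>R (\<kappa> *\<^sub>R r \<theta> + \<nu> *\<^sub>R e)) (at \<theta>)"
    by (intro bounded_linear.has_vector_derivative[OF bounded_linear_scaleR_right] r1_deriv)
  moreover have "((\<lambda>\<theta>. A *v (f *\<^sub>R r1 \<theta>)) has_vector_derivative A *v (f *\<^sub>R (\<kappa> *\<^sub>R r \<theta> + \<nu> *\<^sub>R e))) (at \<theta>)"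
    by (intro lin bounded_linear.has_vector_derivative[OF bounded_linear_scaleR_right] r1_deriv)
  ultimately have "p *\<^sub>R (\<kappa> *\<^sub>R r \<theta> + \<nu> *\<^sub>R e) = A *v (f *\<^sub>R (\<kappa> *\<^sub>R r \<theta> + \<nu> *\<^sub>R e))"
    unfolding eq1 by (rule vector_derivative_unique_at)
  then show ?thesis
    by (simp add: matrix_vector_mult_scaleR)
qed

text \<open>Here \<open>r''\<close> is a multiple of \<open>r\<close>, so that \<open>A r(0)\<close> and \<open>A e\<close> are multiples of \<open>r(0)\<close> and \<open>e\<close>
  wherever \<open>f\<close> and \<open>g\<close> do not vanish; pairing with \<open>r(0)\<close> and \<open>e\<close> gives factors that do not depend on \<open>s\<close>.\<close>

lemma eigenvalues_axial:
  assumes frame: "\<kappa> \<noteq> 0" "\<nu> = 0" "a \<noteq> 0" "d \<noteq> 0"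
    and eq: "\<And>s \<theta>. s \<in> I \<Longrightarrow> p s *\<^sub>R r \<theta> + q s *\<^sub>R e = A *v (f s *\<^sub>R r \<theta> + g s *\<^sub>R e)"
  obtains \<Lambda> \<mu> where "\<And>s. s \<in> I \<Longrightarrow> p s = \<Lambda> * f s" "\<And>s. s \<in> I \<Longrightarrow> q s = \<mu> * g s"
proof
  fix s assume s: "s \<in> I"
  have r: "p s *\<^sub>R r 0 = f s *\<^sub>R (A *v r 0)"
  proof -
    have "\<kappa> *\<^sub>R (p s *\<^sub>R r 0) = \<kappa> *\<^sub>R (f s *\<^sub>R (A *v r 0))"
      using matrix_on_parallel[OF eq[OF s], of 0] frame(1,2)
      by (simp add: matrix_vector_mult_scaleR mult.commute)
    with frame(1) show ?thesis
      by (rule scaleR_left_imp_eq)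
  qed
  have e: "q s *\<^sub>R e = g s *\<^sub>R (A *v e)"
    using eq[OF s, of 0] r by (simp add: matrix_vector_mult_add_rdistrib matrix_vector_mult_scaleR vec.add vec.scale)
  show "p s = (lorentz (A *v r 0) (r 0) / a) * f s"
    using arg_cong[OF r, of "\<lambda>z. lorentz z (r 0)"] frame(3)
    by (simp add: lorentz_scaleR_left gram field_simps)
  show "q s = (lorentz (A *v e) e / d) * g s"
    using arg_cong[OF e, of "\<lambda>z. lorentz z e"] frame(4)
    by (simp add: lorentz_scaleR_left gram field_simps)
qed

text \<open>Here \<open>r''\<close> is a multiple of \<open>e\<close>, so \<open>e\<close> is an eigenvector of \<open>A\<close>. Its eigenvalue governs both
  coefficients, and \<open>A r(0)\<close> may have a component along \<open>e\<close>, which produces \<open>\<tau>\<close>.\<close>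

lemma eigenvalues_lightlike:
  assumes frame: "\<kappa> = 0" "\<nu> \<noteq> 0" "a = 0" "b \<noteq> 0"
    and f: "\<And>s. s \<in> I \<Longrightarrow> f s \<noteq> 0"
    and eq: "\<And>s \<theta>. s \<in> I \<Longrightarrow> p s *\<^sub>R r \<theta> + q s *\<^sub>R e = A *v (f s *\<^sub>R r \<theta> + g s *\<^sub>R e)"
  obtains \<Lambda> \<tau> where "\<And>s. s \<in> I \<Longrightarrow> p s = \<Lambda> * f s" "\<And>s. s \<in> I \<Longrightarrow> q s = \<tau> * f s + \<Lambda> * g s"
proof
  fix s assume s: "s \<in> I"
  have e: "p s *\<^sub>R e = f s *\<^sub>R (A *v e)"
  proof -
    have "\<nu> *\<^sub>R (p s *\<^sub>R e) = \<nu> *\<^sub>R (f s *\<^sub>R (A *v e))"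
      using matrix_on_parallel[OF eq[OF s], of 0] frame(1,2)
      by (simp add: matrix_vector_mult_scaleR mult.commute)
    with frame(2) show ?thesis
      by (rule scaleR_left_imp_eq)
  qed
  show p: "p s = (lorentz (A *v e) (r 0) / b) * f s"
    using arg_cong[OF e, of "\<lambda>z. lorentz z (r 0)"] frame(4)
    by (simp add: lorentz_scaleR_left gram gram' field_simps)
  have "f s * (q s * b) = f s * lorentz (p s *\<^sub>R r 0 + q s *\<^sub>R e) (r 0)"
    using frame(3) by (simp add: lorentz_linear gram gram')
  also have "\<dots> = f s * lorentz (f s *\<^sub>R (A *v r 0)) (r 0) + g s * lorentz (f s *\<^sub>R (A *v e)) (r 0)"
    unfolding eq[OF s] by (simp add: matrix_vector_mult_scaleR vec.add vec.scale lorentz_linear algebra_simps)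
  also have "\<dots> = f s * (f s * lorentz (A *v r 0) (r 0) + g s * lorentz (A *v e) (r 0))"
    by (simp add: lorentz_linear algebra_simps)
  finally have "q s * b = f s * lorentz (A *v r 0) (r 0) + g s * lorentz (A *v e) (r 0)"
    using f[OF s] by simp
  then show "q s = (lorentz (A *v r 0) (r 0) / b) * f s + (lorentz (A *v e) (r 0) / b) * g s"
    using frame(4) by (simp add: field_simps)
qed

end

section \<open>The differential equations of the profile curve\<close>

text \<open>Here \<open>k\<close> is the curvature of the profile curve, \<open>w = 1 / k\<close>, and \<open>W\<close> is the derivative of \<open>w\<close> with respect to the
  angle, for which \<open>d/ds = k d/d\<phi>\<close>. Writing all derivatives with the factor \<open>k\<close> makes the system
  \<open>Df = w f', Dg = w g', Df' = - d g', Dg' = a f'\<close> linear with constant coefficients in \<open>f'\<close> and \<open>g'\<close>.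

  Eliminating \<open>W\<close> between the two equations gives \<open>A\<close>; its derivative is \<open>B\<close>. Combining them to eliminate
  \<open>g\<close> gives \<open>E1\<close>, in which \<open>f'\<close> enters only through \<open>y = f'\<^sup>2\<close>. From the derivative \<open>E2\<close> of \<open>E1\<close> both \<open>f\<close> and \<open>g\<close> can
  be eliminated by means of \<open>A\<close> and \<open>E1\<close>, and \<open>w\<close> cancels as a common factor. What remains is a polynomial in \<open>y\<close>
  that vanishes on an interval.\<close>

lemma axial_eigenvalue_dichotomy:
  fixes f g f1 g1 k w W :: "real \<Rightarrow> real" and a d \<epsilon> \<Lambda> \<mu> :: real
  assumes I: "open I" "is_interval I" "I \<noteq> {}"
    and signs: "a = 1 \<or> a = -1" "d = 1 \<or> d = -1" "\<epsilon> = 1 \<or> \<epsilon> = -1"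
    and D: "\<And>s. s \<in> I \<Longrightarrow> (f has_real_derivative k s * (w s * f1 s)) (at s)"
      "\<And>s. s \<in> I \<Longrightarrow> (g has_real_derivative k s * (w s * g1 s)) (at s)"
      "\<And>s. s \<in> I \<Longrightarrow> (f1 has_real_derivative k s * (- d * g1 s)) (at s)"
      "\<And>s. s \<in> I \<Longrightarrow> (g1 has_real_derivative k s * (a * f1 s)) (at s)"
      "\<And>s. s \<in> I \<Longrightarrow> (w has_real_derivative k s * W s) (at s)"
    and nz: "\<And>s. s \<in> I \<Longrightarrow> k s \<noteq> 0" "\<And>s. s \<in> I \<Longrightarrow> w s \<noteq> 0" "\<And>s. s \<in> I \<Longrightarrow> f s \<noteq> 0" "\<And>s. s \<in> I \<Longrightarrow> g1 s \<noteq> 0"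
    and arc: "\<And>s. s \<in> I \<Longrightarrow> a * (f1 s)\<^sup>2 + d * (g1 s)\<^sup>2 = \<epsilon>"
    and eq_g: "\<And>s. s \<in> I \<Longrightarrow> - \<epsilon> * (2 * a * f1 s * w s + g1 s * W s) = \<mu> * g s"
    and eq_f: "\<And>s. s \<in> I \<Longrightarrow> - \<epsilon> * g1 s * (a * (f1 s)\<^sup>2 * w s - d * (g1 s)\<^sup>2 * w s + g1 s * f1 s * W s)
        + a * f s = \<Lambda> * (g1 s)\<^sup>2 * f s"
  shows "(\<exists>C. C \<noteq> 0 \<and> (\<forall>s\<in>I. a * (f s)\<^sup>2 + d * (g s)\<^sup>2 = C)) \<or> (\<forall>s\<in>I. a * f s + g1 s * w s = 0)"
proof -
  have sq: "a * a = 1" "d * d = 1" "\<epsilon> * \<epsilon> = 1"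
    using signs by auto
  have W: "g1 s * W s = - \<epsilon> * \<mu> * g s - 2 * a * f1 s * w s" if "s \<in> I" for s
  proof -
    have "\<epsilon> * (- \<epsilon> * (2 * a * f1 s * w s + g1 s * W s)) = \<epsilon> * (\<mu> * g s)"
      using eq_g[OF that] by simp
    then show ?thesis using sq(3) by algebra
  qed
  have A: "a * f s - \<Lambda> * (g1 s)\<^sup>2 * f s + \<mu> * (g1 s * f1 s * g s) + g1 s * w s = 0" if s: "s \<in> I" for s
  proof -
    have "g1 s * f1 s * W s = f1 s * (- \<epsilon> * \<mu> * g s - 2 * a * f1 s * w s)"
      using W[OF s] by (metis mult.assoc mult.commute)
    then have "a * (f1 s)\<^sup>2 * w s - d * (g1 s)\<^sup>2 * w s + g1 s * f1 s * W s
        = - (a * (f1 s)\<^sup>2 + d * (g1 s)\<^sup>2) * w s - \<epsilon> * \<mu> * f1 s * g s"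
      by (simp add: algebra_simps power2_eq_square)
    also have "\<dots> = - \<epsilon> * (w s + \<mu> * f1 s * g s)"
      by (simp add: arc[OF s] algebra_simps)
    finally show ?thesis
      using eq_f[OF s] sq(3) by algebra
  qed
  have B: "- 2 * \<Lambda> * a * f1 s * f s - 2 * d * \<mu> * g1 s * g s + (\<mu> - \<Lambda>) * g1 s * f1 s * w s = 0"
    if s: "s \<in> I" for s
  proof -
    have "((\<lambda>s. a * f s - \<Lambda> * (g1 s)\<^sup>2 * f s + \<mu> * (g1 s * f1 s * g s) + g1 s * w s) has_real_derivative
       k s * (2 * a * f1 s * w s + g1 s * W s - \<Lambda> * (2 * a * g1 s * f1 s * f s + (g1 s)\<^sup>2 * w s * f1 s)
         + \<mu> * ((a * (f1 s)\<^sup>2 - d * (g1 s)\<^sup>2) * g s + (g1 s)\<^sup>2 * f1 s * w s))) (at s)"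
      by (auto intro!: derivative_eq_intros D s simp: algebra_simps power2_eq_square)
    from derivative_of_vanishing[OF I(1) s A this]
    have "2 * a * f1 s * w s + g1 s * W s - \<Lambda> * (2 * a * g1 s * f1 s * f s + (g1 s)\<^sup>2 * w s * f1 s)
         + \<mu> * ((a * (f1 s)\<^sup>2 - d * (g1 s)\<^sup>2) * g s + (g1 s)\<^sup>2 * f1 s * w s) = 0"
      using nz(1)[OF s] by simp
    then have "g1 s * (- 2 * \<Lambda> * a * f1 s * f s - 2 * d * \<mu> * g1 s * g s + (\<mu> - \<Lambda>) * g1 s * f1 s * w s) = 0"
      unfolding W[OF s] using arc[OF s] by algebra
    then show ?thesis
      using nz(4)[OF s] by simp
  qed
  have "\<not> (\<forall>s\<in>I. f1 s = 0)"
  proof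
    assume z: "\<forall>s\<in>I. f1 s = 0"
    obtain s where s: "s \<in> I" using I(3) by auto
    from derivative_of_vanishing[OF I(1) s _ D(3)[OF s]] z show False
      using s nz[OF s] signs by auto
  qed
  then obtain s0 where s0: "s0 \<in> I" "f1 s0 \<noteq> 0"
    by blast
  define y where "y s = (f1 s)\<^sup>2" for s
  define y' where "y' s = - 2 * k s * d * g1 s * f1 s" for s
  have y: "(y has_real_derivative y' s) (at s)" if "s \<in> I" for s
    unfolding y_def y'_def by (auto intro!: derivative_eq_intros D that)
  have y'0: "y' s0 \<noteq> 0"
    using s0 nz[OF s0(1)] signs by (auto simp: y'_def)
  \<comment> \<open>\<open>\<delta> = 0\<close> is the goal; \<open>\<kappa> = 0\<close> is the case in which \<open>E1\<close> does not determine \<open>f\<close>.\<close>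
  define \<delta> where "\<delta> = \<mu> - \<Lambda>"
  define \<kappa> where "\<kappa> = 2 * a * d - 2 * \<Lambda> * \<epsilon>"
  have E1: "\<kappa> * f s + g1 s * w s * (2 * d + \<delta> * y s) = 0" if s: "s \<in> I" for s
  proof -
    have c2: "d * (g1 s)\<^sup>2 = \<epsilon> - a * y s"
      using arc[OF s] by (simp add: y_def)
    have "f1 s * (- 2 * \<Lambda> * a * f1 s * f s - 2 * d * \<mu> * g1 s * g s + (\<mu> - \<Lambda>) * g1 s * f1 s * w s)
        + 2 * d * (a * f s - \<Lambda> * (g1 s)\<^sup>2 * f s + \<mu> * (g1 s * f1 s * g s) + g1 s * w s)
        = 2 * a * d * f s - 2 * \<Lambda> * (a * y s + d * (g1 s)\<^sup>2) * f s + g1 s * w s * (2 * d + \<delta> * y s)"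
      unfolding y_def \<delta>_def by (simp add: algebra_simps power2_eq_square)
    then show ?thesis
      unfolding A[OF s] B[OF s] c2 by (simp add: \<kappa>_def algebra_simps)
  qed
  have "\<delta> = 0"
  proof (cases "\<kappa> = 0")
    case True
    have "[:2 * d, \<delta>:] = 0"
    proof (rule polynomial_on_nonconstant_range_eq_0[OF I(2) y s0(1) y'0 I(1)])
      show "poly [:2 * d, \<delta>:] (y s) = 0" if "s \<in> I" for s
        using E1[OF that] nz[OF that] True by (simp add: mult.commute)
    qed
    then show ?thesis by simp
  next
    case False
    define q0 where "q0 = \<kappa>\<^sup>2 - 2 * a * d * \<kappa> - 4 * \<epsilon> * \<Lambda> * a * d - 3 * \<epsilon> * \<kappa> * \<delta>"
    define q1 where "q1 = a * \<kappa> * \<delta> - \<epsilon> * d * \<kappa> * \<delta>\<^sup>2 / 2 - 4 * \<epsilon> * \<Lambda> * a * \<delta>"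
    define q2 where "q2 = - \<epsilon> * \<Lambda> * a * d * \<delta>\<^sup>2"
    have "[:0, q0, q1, q2:] = 0"
    proof (rule polynomial_on_nonconstant_range_eq_0[OF I(2) y s0(1) y'0 I(1)])
      fix s assume s: "s \<in> I"
      have "((\<lambda>s. \<kappa> * f s + g1 s * w s * (2 * d + \<delta> * y s)) has_real_derivative
          k s * (\<kappa> * w s * f1 s + (a * f1 s * w s + g1 s * W s) * (2 * d + \<delta> * y s)
            - 2 * d * \<delta> * (g1 s)\<^sup>2 * w s * f1 s)) (at s)"
        by (auto intro!: derivative_eq_intros D y s simp: y'_def algebra_simps power2_eq_square)
      from derivative_of_vanishing[OF I(1) s E1 this]
      have "\<kappa> * w s * f1 s + (a * f1 s * w s + g1 s * W s) * (2 * d + \<delta> * y s)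
            - 2 * d * \<delta> * (g1 s)\<^sup>2 * w s * f1 s = 0"
        using nz(1)[OF s] by simp
      then have E2: "\<kappa> * w s * f1 s - (a * f1 s * w s + \<epsilon> * \<mu> * g s) * (2 * d + \<delta> * y s)
            - 2 * d * \<delta> * (g1 s)\<^sup>2 * w s * f1 s = 0"
        unfolding W[OF s] by (simp add: algebra_simps)
      define Z where "Z = 2 * d + \<delta> * y s"
      have c2: "(g1 s)\<^sup>2 = d * (\<epsilon> - a * y s)"
      proof -
        have "\<epsilon> - a * y s = d * (g1 s)\<^sup>2"
          using arc[OF s] by (simp add: y_def)
        then show ?thesis
          by (simp add: sq(2) flip: mult.assoc)
      qed
      have kf: "\<kappa> * f s = - (g1 s * w s * Z)"
        using E1[OF s] by (simp add: Z_def)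
      have "\<kappa> * (\<mu> * (g1 s * f1 s * g s)) = - (a - \<Lambda> * (g1 s)\<^sup>2) * (\<kappa> * f s) - \<kappa> * g1 s * w s"
        using A[OF s] by algebra
      also have "\<dots> = g1 s * w s * ((a - \<Lambda> * (g1 s)\<^sup>2) * Z - \<kappa>)"
        unfolding kf by (simp add: algebra_simps)
      finally have G: "\<kappa> * (\<mu> * (g1 s * f1 s * g s)) = g1 s * w s * ((a - \<Lambda> * (g1 s)\<^sup>2) * Z - \<kappa>)" .
      have "0 = \<kappa> * g1 s * f1 s * (\<kappa> * w s * f1 s - (a * f1 s * w s + \<epsilon> * \<mu> * g s) * Z
            - 2 * d * \<delta> * (g1 s)\<^sup>2 * w s * f1 s)"
        using E2 by (simp add: Z_def)
      also have "\<dots> = \<kappa>\<^sup>2 * (g1 s * w s) * y s - a * \<kappa> * (g1 s * w s) * y s * Z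
          - \<epsilon> * Z * (\<kappa> * (\<mu> * (g1 s * f1 s * g s))) - 2 * d * \<delta> * \<kappa> * (g1 s)\<^sup>2 * (g1 s * w s) * y s"
        unfolding y_def by (simp add: algebra_simps power2_eq_square)
      also have "\<dots> = g1 s * w s * (\<kappa>\<^sup>2 * y s - a * \<kappa> * y s * Z
          - \<epsilon> * Z * ((a - \<Lambda> * (g1 s)\<^sup>2) * Z - \<kappa>) - 2 * d * \<delta> * \<kappa> * (g1 s)\<^sup>2 * y s)"
        unfolding G by (simp add: algebra_simps)
      finally have "\<kappa>\<^sup>2 * y s - a * \<kappa> * y s * Z
          - \<epsilon> * Z * ((a - \<Lambda> * (g1 s)\<^sup>2) * Z - \<kappa>) - 2 * d * \<delta> * \<kappa> * (g1 s)\<^sup>2 * y s = 0"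
        using nz[OF s] by simp
      moreover have "a - \<Lambda> * (g1 s)\<^sup>2 = d * \<kappa> / 2 + \<Lambda> * a * d * y s"
        unfolding c2 \<kappa>_def using signs(2) by (auto simp: field_simps)
      ultimately have "\<kappa>\<^sup>2 * y s - a * \<kappa> * y s * Z
          - \<epsilon> * Z * ((d * \<kappa> / 2 + \<Lambda> * a * d * y s) * Z - \<kappa>) - 2 * d * \<delta> * \<kappa> * (d * (\<epsilon> - a * y s)) * y s = 0"
        by (simp add: c2)
      then show "poly [:0, q0, q1, q2:] (y s) = 0"
        unfolding Z_def q0_def q1_def q2_def using signs(2) by (auto simp: algebra_simps power2_eq_square)
    qed
    then have q: "q0 = 0" "q2 = 0"
      by auto
    \<comment> \<open>The leading coefficient \<open>q2\<close> gives \<open>\<delta> = 0\<close> unless \<open>\<Lambda> = 0\<close>; in that case \<open>q0\<close> does.\<close>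
    show ?thesis
    proof (cases "\<Lambda> = 0")
      case True
      then have "q0 = - 6 * \<epsilon> * (a * d) * \<delta>"
        using sq by (simp add: q0_def \<kappa>_def power2_eq_square algebra_simps)
      with q signs show ?thesis by auto
    next
      case False
      with q signs show ?thesis by (auto simp: q2_def)
    qed
  qed
  then have \<mu>: "\<mu> = \<Lambda>"
    by (simp add: \<delta>_def)
  show ?thesis
  proof (cases "\<Lambda> = 0")
    case True
    then show ?thesis
      using A \<mu> by auto
  next
    case False
    have radial: "a * f1 s * f s + d * g1 s * g s = 0" if "s \<in> I" for s
    proof -
      have "- 2 * \<Lambda> * (a * f1 s * f s + d * g1 s * g s) = 0"
        using B[OF that] \<mu> by (simp add: algebra_simps)
      then show ?thesis using False by simp
    qed
    have "((\<lambda>s. a * (f s)\<^sup>2 + d * (g s)\<^sup>2) has_real_derivative 0) (at s)" if s: "s \<in> I" for s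
    proof -
      have "((\<lambda>s. a * (f s)\<^sup>2 + d * (g s)\<^sup>2) has_real_derivative
          2 * k s * w s * (a * f1 s * f s + d * g1 s * g s)) (at s)"
        by (auto intro!: derivative_eq_intros D s simp: algebra_simps)
      then show ?thesis by (simp add: radial[OF s])
    qed
    from constant_on_interval[OF I(2) this]
    obtain C where C: "\<And>s. s \<in> I \<Longrightarrow> a * (f s)\<^sup>2 + d * (g s)\<^sup>2 = C" by blast
    \<comment> \<open>If the profile curve were on the null cone, it would be a null line, which has no arclength parameter.\<close>
    have "C \<noteq> 0"
    proof
      assume "C = 0"
      then have c: "a * (f s0)\<^sup>2 + d * (g s0)\<^sup>2 = 0"
        using C[OF s0(1)] by simp
      have "(a * (f s0)\<^sup>2 + d * (g s0)\<^sup>2) * (a * (f1 s0)\<^sup>2 + d * (g1 s0)\<^sup>2)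
        = (a * f1 s0 * f s0 + d * g1 s0 * g s0)\<^sup>2 + a * d * (f s0 * g1 s0 - g s0 * f1 s0)\<^sup>2"
        using sq by (simp add: power2_eq_square algebra_simps)
      then have par: "f s0 * g1 s0 = g s0 * f1 s0"
        using c radial[OF s0(1)] signs by auto
      have "g s0 * (a * (f1 s0)\<^sup>2 + d * (g1 s0)\<^sup>2) = g1 s0 * (a * f1 s0 * f s0 + d * g1 s0 * g s0)
          - a * f1 s0 * (f s0 * g1 s0 - g s0 * f1 s0)"
        by (simp add: power2_eq_square algebra_simps)
      then have "g s0 = 0"
        using arc[OF s0(1)] radial[OF s0(1)] par signs by auto
      then show False
        using par nz[OF s0(1)] by simp
    qed
    with C show ?thesis by blast
  qed
qed

text \<open>The condition \<open>minimal\<close> makes \<open>f g'\<close> a constant \<open>C\<close>. With \<open>\<alpha> = |C|\<close>, the rescaled radius \<open>R = f / \<alpha>\<close> is then, as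
  a function of \<open>T = g / \<alpha>\<close>, a solution of \<open>R'' = \<plusminus>R\<close>, and the arclength condition is its energy integral. The
  energy separates \<open>sinh\<close> from \<open>cosh\<close>, and the sign separates these from \<open>sin\<close>.\<close>

lemma catenary_profile:
  fixes f g f1 g1 f2 k w :: "real \<Rightarrow> real" and a d \<epsilon> :: real
  assumes I: "open I" "is_interval I" "I \<noteq> {}"
    and signs: "a = 1 \<or> a = -1" "d = 1 \<or> d = -1" "\<epsilon> = 1 \<or> \<epsilon> = -1"
    and D: "\<And>s. s \<in> I \<Longrightarrow> (f has_real_derivative f1 s) (at s)"
      "\<And>s. s \<in> I \<Longrightarrow> (g has_real_derivative g1 s) (at s)"
      "\<And>s. s \<in> I \<Longrightarrow> (f1 has_real_derivative k s * (- d * g1 s)) (at s)"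
      "\<And>s. s \<in> I \<Longrightarrow> (g1 has_real_derivative k s * (a * f1 s)) (at s)"
    and nz: "\<And>s. s \<in> I \<Longrightarrow> f s \<noteq> 0" "\<And>s. s \<in> I \<Longrightarrow> g1 s \<noteq> 0"
    and arc: "\<And>s. s \<in> I \<Longrightarrow> a * (f1 s)\<^sup>2 + d * (g1 s)\<^sup>2 = \<epsilon>"
    and minimal: "\<And>s. s \<in> I \<Longrightarrow> k s * (a * f s) + g1 s = 0"
  obtains \<alpha> \<sigma> t0 where "\<alpha> > 0" "\<sigma> = 1 \<or> \<sigma> = -1"
    "(a * d = -1 \<and> a * \<epsilon> = 1 \<and> (\<forall>s\<in>I. f s = \<sigma> * (\<alpha> * sinh ((g s - t0) / \<alpha>)))) \<or>
     (a * d = -1 \<and> a * \<epsilon> = -1 \<and> (\<forall>s\<in>I. f s = \<sigma> * (\<alpha> * sin ((g s - t0) / \<alpha>)))) \<or>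
     (a * d = 1 \<and> a * \<epsilon> = 1 \<and> (\<forall>s\<in>I. f s = \<sigma> * (\<alpha> * cosh ((g s - t0) / \<alpha>))))"
proof -
  have sq: "a * a = 1" "d * d = 1" "\<epsilon> * \<epsilon> = 1"
    using signs by auto
  have "((\<lambda>s. f s * g1 s) has_real_derivative 0) (at s)" if s: "s \<in> I" for s
  proof -
    have "((\<lambda>s. f s * g1 s) has_real_derivative f1 s * (k s * (a * f s) + g1 s)) (at s)"
      by (auto intro!: derivative_eq_intros D s simp: algebra_simps)
    then show ?thesis by (simp add: minimal[OF s])
  qed
  from constant_on_interval[OF I(2) this]
  obtain C where C: "\<And>s. s \<in> I \<Longrightarrow> f s * g1 s = C" by blast
  obtain s0 where s0: "s0 \<in> I" using I by auto
  have C0: "C \<noteq> 0"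
    using C[OF s0] nz[OF s0] by auto
  define \<alpha> where "\<alpha> = \<bar>C\<bar>"
  have \<alpha>: "\<alpha> > 0" "\<alpha>\<^sup>2 = C\<^sup>2"
    using C0 by (auto simp: \<alpha>_def)
  \<comment> \<open>\<open>F\<close> is the slope \<open>f' / g'\<close>, written without a division by \<open>g'\<close>.\<close>
  define F where "F s = f1 s * f s / C" for s
  define T where "T s = g s / \<alpha>" for s
  define R where "R s = f s / \<alpha>" for s
  have f1: "f1 s = g1 s * F s" if "s \<in> I" for s
    using C[OF that] C0 by (simp add: F_def field_simps)
  have F': "(F has_real_derivative a * \<epsilon> * (g1 s / \<alpha>) * R s) (at s)" if s: "s \<in> I" for s
  proof -
    have "(F has_real_derivative (k s * (- d * g1 s) * f s + f1 s * f1 s) / C) (at s)"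
      unfolding F_def using C0 by (auto intro!: derivative_eq_intros D s)
    moreover have "k s * (- d * g1 s) * f s + f1 s * f1 s = a * \<epsilon>"
    proof -
      have "a * (k s * (- d * g1 s) * f s + f1 s * f1 s) = - d * g1 s * (k s * (a * f s)) + a * (f1 s)\<^sup>2"
        by (simp add: algebra_simps power2_eq_square)
      also have "\<dots> = \<epsilon>"
        using minimal[OF s] arc[OF s] by algebra
      finally have "a * \<epsilon> = (a * a) * (k s * (- d * g1 s) * f s + f1 s * f1 s)"
        by (simp only: mult.assoc)
      then show ?thesis by (simp add: sq)
    qed
    moreover have "a * \<epsilon> / C = a * \<epsilon> * (g1 s / \<alpha>) * R s"
    proof -
      have "g1 s / \<alpha> * R s = C / \<alpha>\<^sup>2"
        using C[OF s] by (simp add: R_def power2_eq_square mult.commute)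
      also have "\<dots> = 1 / C"
        unfolding \<alpha>(2) using C0 by (simp add: power2_eq_square)
      finally show ?thesis
        by (metis divide_inverse_commute mult.assoc mult.commute inverse_eq_divide)
    qed
    ultimately show ?thesis by simp
  qed
  have R': "(R has_real_derivative (g1 s / \<alpha>) * F s) (at s)" if "s \<in> I" for s
    unfolding R_def using f1[OF that] \<alpha> by (auto intro!: derivative_eq_intros D that)
  have T': "(T has_real_derivative g1 s / \<alpha>) (at s)" if "s \<in> I" for s
    unfolding T_def using \<alpha> by (auto intro!: derivative_eq_intros D that)
  have energy: "(F s)\<^sup>2 = a * \<epsilon> * (R s)\<^sup>2 - a * d" if s: "s \<in> I" for s
  proof -
    have "(g1 s)\<^sup>2 * (F s)\<^sup>2 = (f1 s)\<^sup>2"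
      using f1[OF s] by (simp add: power_mult_distrib)
    also have "\<dots> = (a * a) * (f1 s)\<^sup>2"
      by (simp add: sq)
    also have "\<dots> = a * \<epsilon> - a * d * (g1 s)\<^sup>2"
      unfolding arc[OF s, symmetric] by (simp add: algebra_simps)
    also have "\<dots> = (g1 s)\<^sup>2 * (a * \<epsilon> * (R s)\<^sup>2 - a * d)"
    proof -
      have "(g1 s)\<^sup>2 * (R s)\<^sup>2 = (f s * g1 s)\<^sup>2 / \<alpha>\<^sup>2"
        by (simp add: R_def power_mult_distrib power_divide)
      also have "\<dots> = 1"
        using C0 by (simp add: C[OF s] \<alpha>(2))
      finally have *: "(g1 s)\<^sup>2 * (R s)\<^sup>2 = 1" .
      have "(g1 s)\<^sup>2 * (a * \<epsilon> * (R s)\<^sup>2 - a * d) = a * \<epsilon> * ((g1 s)\<^sup>2 * (R s)\<^sup>2) - a * d * (g1 s)\<^sup>2"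
        by (simp add: algebra_simps)
      then show ?thesis by (simp add: *)
    qed
    finally show ?thesis
      using nz(2)[OF s] by simp
  qed
  show thesis
  proof (cases "a * \<epsilon> = 1")
    case True
    \<comment> \<open>\<open>X\<close> and \<open>Y\<close> are the coefficients of \<open>R\<close> with respect to \<open>exp T\<close> and \<open>exp (- T)\<close>, up to factors.\<close>
    have "((\<lambda>s. (F s + R s) * exp (- T s)) has_real_derivative 0) (at s)"
      "((\<lambda>s. (F s - R s) * exp (T s)) has_real_derivative 0) (at s)" if s: "s \<in> I" for s
      using True by (auto intro!: derivative_eq_intros F'[OF s] R'[OF s] T'[OF s] simp: algebra_simps)
    from constant_on_interval[OF I(2) this(1)] constant_on_interval[OF I(2) this(2)]
    obtain X Y where X: "\<And>s. s \<in> I \<Longrightarrow> (F s + R s) * exp (- T s) = X"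
      and Y: "\<And>s. s \<in> I \<Longrightarrow> (F s - R s) * exp (T s) = Y" by metis
    have XY: "X * Y = - a * d"
    proof -
      have "X * Y = ((F s0)\<^sup>2 - (R s0)\<^sup>2) * (exp (- T s0) * exp (T s0))"
        unfolding X[OF s0, symmetric] Y[OF s0, symmetric] by (simp add: power2_eq_square algebra_simps)
      also have "\<dots> = - a * d"
        using energy[OF s0] True by (simp add: exp_minus_inverse mult.commute flip: exp_add)
      finally show ?thesis .
    qed
    have "X \<noteq> 0"
      using XY signs by auto
    define \<sigma> where "\<sigma> = sgn X"
    define \<tau> where "\<tau> = ln \<bar>X\<bar>"
    have \<sigma>: "\<sigma> = 1 \<or> \<sigma> = -1"
      using \<open>X \<noteq> 0\<close> by (auto simp: \<sigma>_def sgn_if)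
    have X': "X = \<sigma> * exp \<tau>"
      using \<open>X \<noteq> 0\<close> by (simp add: \<sigma>_def \<tau>_def sgn_mult_abs)
    have Y': "Y = - a * d * \<sigma> * exp (- \<tau>)"
    proof -
      have "\<sigma> * exp (- \<tau>) * (X * Y) = (\<sigma> * \<sigma>) * (exp (- \<tau>) * exp \<tau>) * Y"
        by (simp add: X')
      also have "\<dots> = Y"
        using \<sigma> by (auto simp flip: exp_add)
      finally show ?thesis by (simp add: XY algebra_simps)
    qed
    have R: "R s = \<sigma> * (exp (T s + \<tau>) + a * d * exp (- (T s + \<tau>))) / 2" if s: "s \<in> I" for s
    proof -
      have "F s + R s = X * exp (T s)" "F s - R s = Y * exp (- T s)"
        unfolding X[OF s, symmetric] Y[OF s, symmetric] by (simp_all add: exp_minus)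
      then have "2 * R s = X * exp (T s) - Y * exp (- T s)"
        by simp
      then show ?thesis
        by (simp add: X' Y' exp_add exp_minus algebra_simps exp_diff) (simp add: field_simps)
    qed
    have arg: "(g s - (- \<tau> * \<alpha>)) / \<alpha> = T s + \<tau>" for s
      using \<alpha> by (simp add: T_def add_divide_distrib)
    have fR: "f s = \<alpha> * R s" for s
      using \<alpha> by (simp add: R_def)
    show thesis
    proof (cases "a * d = 1")
      case ad: True
      have "\<forall>s\<in>I. f s = \<sigma> * (\<alpha> * cosh ((g s - (- \<tau> * \<alpha>)) / \<alpha>))"
        unfolding arg fR by (simp add: R ad cosh_def)
      with that[OF \<alpha>(1) \<sigma>] ad True show thesis by blast
    next
      case False
      then have ad: "a * d = -1"
        using signs by auto
      have "\<forall>s\<in>I. f s = \<sigma> * (\<alpha> * sinh ((g s - (- \<tau> * \<alpha>)) / \<alpha>))"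
        unfolding arg fR by (simp add: R ad sinh_def)
      with that[OF \<alpha>(1) \<sigma>] ad True show thesis by blast
    qed
  next
    case False
    then have ae: "a * \<epsilon> = -1"
      using signs by auto
    have ad: "a * d = -1"
    proof -
      have "0 \<le> (F s0)\<^sup>2 + (R s0)\<^sup>2" by simp
      also have "\<dots> = - (a * d)"
        using energy[OF s0] ae by simp
      finally show ?thesis using signs by auto
    qed
    \<comment> \<open>\<open>X\<close> and \<open>Y\<close> are the coefficients of \<open>R\<close> with respect to \<open>sin T\<close> and \<open>cos T\<close>.\<close>
    have "((\<lambda>s. F s * cos (T s) + R s * sin (T s)) has_real_derivative 0) (at s)"
      "((\<lambda>s. R s * cos (T s) - F s * sin (T s)) has_real_derivative 0) (at s)" if s: "s \<in> I" for s
      using ae by (auto intro!: derivative_eq_intros F'[OF s] R'[OF s] T'[OF s] simp: algebra_simps)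
    from constant_on_interval[OF I(2) this(1)] constant_on_interval[OF I(2) this(2)]
    obtain X Y where X: "\<And>s. s \<in> I \<Longrightarrow> F s * cos (T s) + R s * sin (T s) = X"
      and Y: "\<And>s. s \<in> I \<Longrightarrow> R s * cos (T s) - F s * sin (T s) = Y" by metis
    have "X\<^sup>2 + Y\<^sup>2 = ((F s0)\<^sup>2 + (R s0)\<^sup>2) * ((sin (T s0))\<^sup>2 + (cos (T s0))\<^sup>2)"
    proof -
      have "(p * c + q * z)\<^sup>2 + (q * c - p * z)\<^sup>2 = (p\<^sup>2 + q\<^sup>2) * (z\<^sup>2 + c\<^sup>2)" for p q c z :: real
        by (simp add: power2_eq_square algebra_simps)
      then show ?thesis
        unfolding X[OF s0, symmetric] Y[OF s0, symmetric] .
    qed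
    also have "\<dots> = 1"
      using energy[OF s0] ae ad by simp
    finally obtain \<tau> where \<tau>: "X = cos \<tau>" "Y = sin \<tau>"
      using sincos_total_2pi by metis
    have R: "R s = sin (T s + \<tau>)" if s: "s \<in> I" for s
    proof -
      have "sin (T s + \<tau>) = R s * ((sin (T s))\<^sup>2 + (cos (T s))\<^sup>2)"
      proof -
        have "z * (p * c + q * z) + c * (q * c - p * z) = q * (z\<^sup>2 + c\<^sup>2)" for p q c z :: real
          by (simp add: power2_eq_square algebra_simps)
        then show ?thesis
          unfolding sin_add \<tau>[symmetric] X[OF s, symmetric] Y[OF s, symmetric] .
      qed
      then show ?thesis by simp
    qed
    have arg: "(g s - (- \<tau> * \<alpha>)) / \<alpha> = T s + \<tau>" for s
      using \<alpha> by (simp add: T_def add_divide_distrib)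
    have "\<forall>s\<in>I. f s = 1 * (\<alpha> * sin ((g s - (- \<tau> * \<alpha>)) / \<alpha>))"
      unfolding arg using \<alpha> R by (auto simp: R_def field_simps)
    with that[OF \<alpha>(1), of 1] ad ae show thesis by blast
  qed
qed

text \<open>The function \<open>u\<close> serves as the independent variable: \<open>H\<close> and \<open>K\<close> are the first and second derivative of \<open>h\<close> with
  respect to \<open>u\<close>. The equation \<open>eq_h\<close> gives \<open>K\<close>, so \<open>eq_m\<close> becomes the relation \<open>A\<close> between \<open>h, H, m\<close>; its derivative
  is free of \<open>m\<close> after another use of \<open>A\<close>, which is \<open>B\<close>. Differentiating \<open>B\<close> and cancelling \<open>h\<close> leaves a polynomial in
  \<open>u\<^sup>2\<close>, whose coefficients give \<open>\<tau> = 0\<close> and \<open>\<epsilon> \<Lambda> \<in> {0, 2}\<close>.\<close>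

lemma lightlike_profile:
  fixes h m u H u1 :: "real \<Rightarrow> real" and \<epsilon> \<Lambda> \<tau> :: real
  assumes I: "open I" "is_interval I" "I \<noteq> {}"
    and eps: "\<epsilon> = 1 \<or> \<epsilon> = -1"
    and D: "\<And>s. s \<in> I \<Longrightarrow> (h has_real_derivative u1 s * H s) (at s)"
      "\<And>s. s \<in> I \<Longrightarrow> (m has_real_derivative u1 s * (\<epsilon> * H s / (u s)\<^sup>2)) (at s)"
      "\<And>s. s \<in> I \<Longrightarrow> (u has_real_derivative u1 s) (at s)"
      "\<And>s. s \<in> I \<Longrightarrow> (H has_real_derivative u1 s * K s) (at s)"
    and nz: "\<And>s. s \<in> I \<Longrightarrow> u1 s \<noteq> 0" "\<And>s. s \<in> I \<Longrightarrow> h s \<noteq> 0" "\<And>s. s \<in> I \<Longrightarrow> u s \<noteq> 0" "\<And>s. s \<in> I \<Longrightarrow> H s \<noteq> 0"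
    and eq_h: "\<And>s. s \<in> I \<Longrightarrow> \<epsilon> * (2 * u s * H s + (u s)\<^sup>2 * K s) = \<Lambda> * h s"
    and eq_m: "\<And>s. s \<in> I \<Longrightarrow> K s - 2 * h s / (u s)\<^sup>2 = \<tau> * h s + \<Lambda> * m s"
  shows "(\<exists>C. C \<noteq> 0 \<and> (\<forall>s\<in>I. h s * m s = C)) \<or> (\<exists>C t0. C \<noteq> 0 \<and> (\<forall>s\<in>I. m s = C * h s ^ 3 + t0))"
proof -
  have ee: "\<epsilon> * \<epsilon> = 1"
    using eps by auto
  define L where "L = \<epsilon> * \<Lambda>"
  define k where "k = 4 * (L - 1)"
  have \<Lambda>: "\<Lambda> = \<epsilon> * L"
    using ee by (simp add: L_def flip: mult.assoc)
  have K: "(u s)\<^sup>2 * K s = L * h s - 2 * u s * H s" if "s \<in> I" for s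
    using eq_h[OF that] ee unfolding L_def by algebra
  have A: "L * h s - 2 * u s * H s - 2 * h s = (u s)\<^sup>2 * (\<tau> * h s + \<Lambda> * m s)" if s: "s \<in> I" for s
  proof -
    have "(u s)\<^sup>2 * (K s - 2 * h s / (u s)\<^sup>2) = (u s)\<^sup>2 * K s - 2 * h s"
      using nz(3)[OF s] by (simp add: field_simps)
    then show ?thesis
      by (simp add: eq_m[OF s] K[OF s])
  qed
  have B: "(4 * u s - \<tau> * u s ^ 3) * H s = k * h s" if s: "s \<in> I" for s
  proof -
    have "((\<lambda>s. L * h s - 2 * u s * H s - 2 * h s - (u s)\<^sup>2 * (\<tau> * h s + \<Lambda> * m s)) has_real_derivative
      u1 s * (L * H s - 2 * H s - 2 * u s * K s - 2 * H s
        - 2 * u s * (\<tau> * h s + \<Lambda> * m s) - (u s)\<^sup>2 * (\<tau> * H s + \<Lambda> * (\<epsilon> * H s / (u s)\<^sup>2)))) (at s)"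
      by (rule derivative_eq_intros D s refl)+ (simp add: algebra_simps)
    from derivative_of_vanishing[OF I(1) s _ this] A
    have "L * H s - 2 * H s - 2 * u s * K s - 2 * H s
        - 2 * u s * (\<tau> * h s + \<Lambda> * m s) - (u s)\<^sup>2 * (\<tau> * H s + \<Lambda> * (\<epsilon> * H s / (u s)\<^sup>2)) = 0"
      using nz(1)[OF s] by simp
    moreover have "(u s)\<^sup>2 * (\<tau> * H s + \<Lambda> * (\<epsilon> * H s / (u s)\<^sup>2)) = \<tau> * (u s)\<^sup>2 * H s + L * H s"
      using nz(3)[OF s] by (simp add: L_def field_simps)
    ultimately have "- 4 * H s - 2 * u s * K s - 2 * u s * (\<tau> * h s + \<Lambda> * m s) - \<tau> * (u s)\<^sup>2 * H s = 0"
      by simp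
    then show ?thesis
      using K[OF s] A[OF s] unfolding k_def by algebra
  qed
  obtain s0 where s0: "s0 \<in> I" using I by auto
  define y where "y s = (u s)\<^sup>2" for s
  have y: "(y has_real_derivative 2 * u s * u1 s) (at s)" if "s \<in> I" for s
    unfolding y_def by (auto intro!: derivative_eq_intros D that)
  have y0: "2 * u s0 * u1 s0 \<noteq> 0"
    using nz[OF s0] by simp
  have "[:16 * L - k * (k + 4), - k * \<tau> - 8 * L * \<tau>, L * \<tau>\<^sup>2:] = 0"
  proof (rule polynomial_on_nonconstant_range_eq_0[OF I(2) y s0 y0 I(1)])
    fix s assume s: "s \<in> I"
    have "((\<lambda>s. (4 * u s - \<tau> * u s ^ 3) * H s - k * h s) has_real_derivative
        u1 s * ((4 - 3 * \<tau> * (u s)\<^sup>2) * H s + (4 * u s - \<tau> * u s ^ 3) * K s - k * H s)) (at s)"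
      by (auto intro!: derivative_eq_intros D s simp: algebra_simps power2_eq_square)
    from derivative_of_vanishing[OF I(1) s _ this] B
    have "(4 - 3 * \<tau> * (u s)\<^sup>2) * H s + (4 * u s - \<tau> * u s ^ 3) * K s - k * H s = 0"
      using nz(1)[OF s] by simp
    then have "u s * H s * (- 4 - \<tau> * y s - k) + (4 - \<tau> * y s) * L * h s = 0"
      using K[OF s] unfolding y_def by algebra
    moreover have "(4 - \<tau> * y s) * (u s * H s) = k * h s"
      using B[OF s] unfolding y_def by algebra
    ultimately have "h s * (L * (4 - \<tau> * y s)\<^sup>2 - k * (4 + k + \<tau> * y s)) = 0"
      by algebra
    then have "L * (4 - \<tau> * y s)\<^sup>2 - k * (4 + k + \<tau> * y s) = 0"
      using nz(2)[OF s] by simp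
    then show "poly [:16 * L - k * (k + 4), - k * \<tau> - 8 * L * \<tau>, L * \<tau>\<^sup>2:] (y s) = 0"
      by (simp add: algebra_simps power2_eq_square)
  qed
  then have c: "16 * L - k * (k + 4) = 0" "- k * \<tau> - 8 * L * \<tau> = 0" "L * \<tau>\<^sup>2 = 0"
    by auto
  have \<tau>: "\<tau> = 0"
    using c unfolding k_def by auto
  have B': "u s * H s = (L - 1) * h s" if "s \<in> I" for s
    using B[OF that] unfolding \<tau> k_def by algebra
  show ?thesis
  proof (cases "L = 0")
    case True
    have "((\<lambda>s. u s * h s) has_real_derivative 0) (at s)" if s: "s \<in> I" for s
    proof -
      have "((\<lambda>s. u s * h s) has_real_derivative u1 s * (u s * H s + h s)) (at s)"
        by (auto intro!: derivative_eq_intros D s simp: algebra_simps)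
      then show ?thesis by (simp add: B'[OF s] True)
    qed
    from constant_on_interval[OF I(2) this]
    obtain C where C: "\<And>s. s \<in> I \<Longrightarrow> u s * h s = C" by blast
    have C0: "C \<noteq> 0"
      using C[OF s0] nz[OF s0] by auto
    define q where "q = \<epsilon> / (3 * C\<^sup>2)"
    have "((\<lambda>s. m s - q * h s ^ 3) has_real_derivative 0) (at s)" if s: "s \<in> I" for s
    proof -
      have "((\<lambda>s. m s - q * h s ^ 3) has_real_derivative
          u1 s * (\<epsilon> * H s / (u s)\<^sup>2 - 3 * q * (h s)\<^sup>2 * H s)) (at s)"
        by (auto intro!: derivative_eq_intros D s simp: algebra_simps power2_eq_square)
      moreover have "3 * q * (h s)\<^sup>2 * H s = \<epsilon> * H s / (u s)\<^sup>2"
        unfolding q_def using C[OF s, symmetric] nz[OF s] by (simp add: power_mult_distrib)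
      ultimately show ?thesis by simp
    qed
    from constant_on_interval[OF I(2) this]
    obtain t0 where "\<And>s. s \<in> I \<Longrightarrow> m s - q * h s ^ 3 = t0" by blast
    then have "\<forall>s\<in>I. m s = q * h s ^ 3 + t0"
      by (simp add: algebra_simps)
    moreover have "q \<noteq> 0"
      using C0 eps by (auto simp: q_def)
    ultimately show ?thesis by blast
  next
    case False
    have m: "m s = - \<epsilon> * h s / (u s)\<^sup>2" if s: "s \<in> I" for s
    proof -
      have "L * ((u s)\<^sup>2 * m s + \<epsilon> * h s) = 0"
        using A[OF s] B'[OF s] ee unfolding \<tau> \<Lambda> by algebra
      then have "(u s)\<^sup>2 * m s = - \<epsilon> * h s"
        using False by simp
      then show ?thesis
        using nz(3)[OF s] by (simp add: field_simps)
    qed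
    have L: "L = 2"
      using c(1) False by (simp add: k_def algebra_simps)
    have "((\<lambda>s. h s * m s) has_real_derivative 0) (at s)" if s: "s \<in> I" for s
    proof -
      have "((\<lambda>s. h s * m s) has_real_derivative u1 s * H s * (m s + \<epsilon> * h s / (u s)\<^sup>2)) (at s)"
        by (auto intro!: derivative_eq_intros D s simp: algebra_simps)
      then show ?thesis by (simp add: m[OF s])
    qed
    from constant_on_interval[OF I(2) this]
    obtain C where C: "\<And>s. s \<in> I \<Longrightarrow> h s * m s = C" by blast
    moreover have "C \<noteq> 0"
      using C[OF s0] m[OF s0] nz[OF s0] eps by auto
    ultimately show ?thesis by blast
  qed
qed

section \<open>From the Laplace equation to the profile curve\<close>

text \<open>By arclength, \<open>d g' r - a f' e\<close> is already a unit normal. The curvature \<open>k\<close> of the profile curve is the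
  factor in the Frenet equations \<open>f'' = - k d g', g'' = k a f'\<close>, and \<open>\<surd>|e| = |k g'|\<close>.\<close>

lemma axial_profile:
  assumes frame: "rotation_frame r r1 e a 0 d \<rho> (- \<rho> * a) 0"
    and signs: "a = 1 \<or> a = -1" "d = 1 \<or> d = -1" "\<epsilon> = 1 \<or> \<epsilon> = -1"
    and I: "open I" "is_interval I" "I \<noteq> {}"
    and smooth: "smooth_fun_on f I" "smooth_fun_on g I"
    and f: "\<And>s. s \<in> I \<Longrightarrow> f s \<noteq> 0"
    and x: "\<And>s \<theta>. s \<in> I \<Longrightarrow> x s \<theta> = f s *\<^sub>R r \<theta> + g s *\<^sub>R e"
    and arc: "\<And>s. s \<in> I \<Longrightarrow> coeff_E x s 0 = \<epsilon>"
    and nondeg: "\<And>s \<theta>. s \<in> I \<Longrightarrow> nondegenerate_at x s \<theta>"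
    and normal: "unit_normal_field I x n"
    and curved: "\<And>s \<theta>. s \<in> I \<Longrightarrow> coeff_L x n s \<theta> * coeff_N x n s \<theta> - (coeff_M x n s \<theta>)\<^sup>2 \<noteq> 0"
    and laplace: "\<And>s \<theta>. s \<in> I \<Longrightarrow> laplace_III_vec n x s \<theta> = A *v x s \<theta>"
  obtains f1 g1 where
    "\<And>s. s \<in> I \<Longrightarrow> (f has_real_derivative f1 s) (at s)"
    "\<And>s. s \<in> I \<Longrightarrow> (g has_real_derivative g1 s) (at s)"
    "\<And>s. s \<in> I \<Longrightarrow> g1 s \<noteq> 0"
    "\<And>s. s \<in> I \<Longrightarrow> a * (f1 s)\<^sup>2 + d * (g1 s)\<^sup>2 = \<epsilon>"
    "(\<exists>C. C \<noteq> 0 \<and> (\<forall>s\<in>I. a * (f s)\<^sup>2 + d * (g s)\<^sup>2 = C)) \<or>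
     (\<exists>\<alpha> \<sigma> t0. \<alpha> > 0 \<and> (\<sigma> = 1 \<or> \<sigma> = -1) \<and>
       ((a * d = -1 \<and> a * \<epsilon> = 1 \<and> (\<forall>s\<in>I. f s = \<sigma> * (\<alpha> * sinh ((g s - t0) / \<alpha>)))) \<or>
        (a * d = -1 \<and> a * \<epsilon> = -1 \<and> (\<forall>s\<in>I. f s = \<sigma> * (\<alpha> * sin ((g s - t0) / \<alpha>)))) \<or>
        (a * d = 1 \<and> a * \<epsilon> = 1 \<and> (\<forall>s\<in>I. f s = \<sigma> * (\<alpha> * cosh ((g s - t0) / \<alpha>))))))"
proof -
  note ivl = I
  interpret rotation_frame r r1 e a 0 d \<rho> "- \<rho> * a" 0
    by (rule frame)
  have sq: "a * a = 1" "d * d = 1" "\<epsilon> * \<epsilon> = 1" "\<rho> * \<rho> = 1"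
    using signs rho by auto
  then have sq': "a * (a * t) = t" "d * (d * t) = t" "\<epsilon> * (\<epsilon> * t) = t" for t
    by (simp_all flip: mult.assoc)
  define f1 g1 f2 g2 f3 g3 where "f1 = deriv f" "g1 = deriv g"
    "f2 = (deriv ^^ 2) f" "g2 = (deriv ^^ 2) g" "f3 = (deriv ^^ 3) f" "g3 = (deriv ^^ 3) g"
  note defs = this
  have D: "(f has_real_derivative f1 s) (at s)" "(g has_real_derivative g1 s) (at s)"
    "(f1 has_real_derivative f2 s) (at s)" "(g1 has_real_derivative g2 s) (at s)"
    "(f2 has_real_derivative f3 s) (at s)" "(g2 has_real_derivative g3 s) (at s)" if s: "s \<in> I" for s
    using smooth_fun_on_derivative[OF smooth(1) I(1) s, of 0] smooth_fun_on_derivative[OF smooth(2) I(1) s, of 0]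
      smooth_fun_on_derivative[OF smooth(1) I(1) s, of 1] smooth_fun_on_derivative[OF smooth(2) I(1) s, of 1]
      smooth_fun_on_derivative[OF smooth(1) I(1) s, of 2] smooth_fun_on_derivative[OF smooth(2) I(1) s, of 2]
    by (simp_all add: defs numeral_eq_Suc)
  have arc': "a * (f1 s)\<^sup>2 + d * (g1 s)\<^sup>2 = \<epsilon>" if s: "s \<in> I" for s
  proof -
    have "pd 1 x s 0 = f1 s *\<^sub>R r 0 + g1 s *\<^sub>R e"
      by (rule pd1_eqI[OF I(1) s x curve_has_vector_derivative]) (auto intro: D s)
    then show ?thesis
      using arc[OF s] by (simp add: coeff_E_def lorentz_meridian_plane power2_eq_square)
  qed
  have arc2: "a * f1 s * f2 s + d * g1 s * g2 s = 0" if s: "s \<in> I" for s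
  proof -
    have "((\<lambda>s. a * (f1 s)\<^sup>2 + d * (g1 s)\<^sup>2 - \<epsilon>) has_real_derivative
        2 * (a * f1 s * f2 s + d * g1 s * g2 s)) (at s)"
      by (auto intro!: derivative_eq_intros D s simp: algebra_simps)
    from derivative_of_vanishing[OF I(1) s _ this] show ?thesis
      using arc' by simp
  qed
  define k where "k s = \<epsilon> * (f1 s * g2 s - g1 s * f2 s)" for s
  have f2: "f2 s = k s * (- d * g1 s)" if s: "s \<in> I" for s
  proof -
    have "k s * (- d * g1 s) = \<epsilon> * (f2 s * (d * (g1 s)\<^sup>2) - f1 s * (d * g1 s * g2 s))"
      by (simp add: k_def power2_eq_square algebra_simps)
    also have "d * g1 s * g2 s = - (a * f1 s * f2 s)"
      using arc2[OF s] by simp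
    also have "\<epsilon> * (f2 s * (d * (g1 s)\<^sup>2) - f1 s * (- (a * f1 s * f2 s)))
        = \<epsilon> * (f2 s * (a * (f1 s)\<^sup>2 + d * (g1 s)\<^sup>2))"
      by (simp add: power2_eq_square algebra_simps)
    finally show ?thesis
      using sq'(3)[of "f2 s"] by (simp add: arc'[OF s] mult.commute)
  qed
  have g2: "g2 s = k s * (a * f1 s)" if s: "s \<in> I" for s
  proof -
    have "k s * (a * f1 s) = \<epsilon> * (g2 s * (a * (f1 s)\<^sup>2) - g1 s * (a * f1 s * f2 s))"
      by (simp add: k_def power2_eq_square algebra_simps)
    also have "a * f1 s * f2 s = - (d * g1 s * g2 s)"
      using arc2[OF s] by simp
    also have "\<epsilon> * (g2 s * (a * (f1 s)\<^sup>2) - g1 s * (- (d * g1 s * g2 s)))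
        = \<epsilon> * (g2 s * (a * (f1 s)\<^sup>2 + d * (g1 s)\<^sup>2))"
      by (simp add: power2_eq_square algebra_simps)
    finally show ?thesis
      using sq'(3)[of "g2 s"] by (simp add: arc'[OF s] mult.commute)
  qed
  interpret rotation_surface r r1 e a 0 d \<rho> "- \<rho> * a" 0 I x n f g f1 g1 f2 g2
    "\<lambda>s. d * g1 s" "\<lambda>s. - a * f1 s" "\<lambda>s. d * g2 s" "\<lambda>s. - a * f2 s" "a * d * \<epsilon>"
  proof
    show "((\<lambda>s. d * g1 s) has_real_derivative d * g2 s) (at s)"
      "((\<lambda>s. - a * f1 s) has_real_derivative - a * f2 s) (at s)" if "s \<in> I" for s
      by (auto intro!: derivative_eq_intros D that)
    show "(a * (d * g1 s) + 0 * (- a * f1 s)) * f1 s + (0 * (d * g1 s) + d * (- a * f1 s)) * g1 s = 0"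
      if "s \<in> I" for s
      by (simp add: algebra_simps)
    show "(a * (d * g1 s) + 0 * (- a * f1 s)) * (d * g1 s) + (0 * (d * g1 s) + d * (- a * f1 s)) * (- a * f1 s)
        = a * d * \<epsilon>" if "s \<in> I" for s
      unfolding arc'[OF that, symmetric] using signs by (auto simp: power2_eq_square algebra_simps)
    show "a * d * \<epsilon> = 1 \<or> a * d * \<epsilon> = -1"
      using signs by auto
  qed (use I x D nondeg normal curved in auto)
  have g1: "g1 s \<noteq> 0" and k: "k s \<noteq> 0" if "s \<in> I" for s
  proof -
    show "g1 s \<noteq> 0"
      using curvature_nonzero(1)[OF that] by auto
    have "(a * (d * g1 s) + 0 * (- a * f1 s)) * f2 s + (0 * (d * g1 s) + d * (- a * f1 s)) * g2 s
        = - (a * d) * (f1 s * g2 s - g1 s * f2 s)"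
      by (simp add: algebra_simps)
    then show "k s \<noteq> 0"
      using curvature_nonzero(2)[OF that] signs by (auto simp: k_def)
  qed
  define k1 where "k1 s = \<epsilon> * (f1 s * g3 s - g1 s * f3 s)" for s
  have k': "(k has_real_derivative k1 s) (at s)" if "s \<in> I" for s
    unfolding k_def k1_def by (auto intro!: derivative_eq_intros D that simp: algebra_simps)
  define w where "w s = 1 / k s" for s
  define W where "W s = - k1 s / (k s) ^ 3" for s
  have w': "(w has_real_derivative k s * W s) (at s)" if "s \<in> I" for s
    unfolding w_def W_def using k[OF that]
    by (auto intro!: derivative_eq_intros k' that simp: power_eq_if)
  have kw: "k s * w s = 1" if "s \<in> I" for s
    using k[OF that] by (simp add: w_def)
  have w0: "w s \<noteq> 0" if "s \<in> I" for s
    using kw[OF that] by auto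
  define P where "P s = (k s)\<^sup>2 * \<epsilon>" for s
  define V where "V s = k s * (d * g1 s)" for s
  define X where "X s = d * \<epsilon> * k s * (a * (f1 s)\<^sup>2 * w s - d * (g1 s)\<^sup>2 * w s + g1 s * f1 s * W s)" for s
  define Y where "Y s = d * \<epsilon> * k s * (2 * a * g1 s * f1 s * w s + (g1 s)\<^sup>2 * W s)" for s
  have P: "P s = (a * (d * g2 s) + 0 * (- a * f2 s)) * (d * g2 s) + (0 * (d * g2 s) + d * (- a * f2 s)) * (- a * f2 s)"
    if s: "s \<in> I" for s
  proof -
    have "P s = (k s)\<^sup>2 * (a * (f1 s)\<^sup>2 + d * (g1 s)\<^sup>2)"
      by (simp add: P_def arc'[OF s])
    then show ?thesis
      unfolding f2[OF s] g2[OF s] using signs by (auto simp: power2_eq_square algebra_simps)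
  qed
  have V: "(V s)\<^sup>2 = \<bar>P s * (\<rho> * (d * g1 s)\<^sup>2)\<bar>" for s
    using signs rho by (auto simp: V_def P_def abs_mult power_mult_distrib)
  have Vc: "continuous_on I V"
    unfolding V_def
    by (intro continuous_intros continuous_at_imp_continuous_on ballI) (auto intro: DERIV_isCont D k')
  have VP: "V s / P s = d * \<epsilon> * g1 s * w s" if s: "s \<in> I" for s
    using k[OF s] signs by (auto simp: V_def P_def w_def power2_eq_square)
  have X: "((\<lambda>s. V s * f1 s / P s) has_real_derivative X s) (at s)"
    and Y: "((\<lambda>s. V s * g1 s / P s) has_real_derivative Y s) (at s)" if s: "s \<in> I" for s
  proof -
    have "((\<lambda>s. d * \<epsilon> * g1 s * w s * f1 s) has_real_derivative X s) (at s)"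
      unfolding X_def
      by (rule derivative_eq_intros D w' s refl)+ (simp add: f2[OF s] g2[OF s] power2_eq_square algebra_simps)
    then show "((\<lambda>s. V s * f1 s / P s) has_real_derivative X s) (at s)"
      by (rule has_real_derivative_transform_on[OF _ I(1) s]) (simp add: VP[symmetric])
    have "((\<lambda>s. d * \<epsilon> * g1 s * w s * g1 s) has_real_derivative Y s) (at s)"
      unfolding Y_def
      by (rule derivative_eq_intros D w' s refl)+ (simp add: f2[OF s] g2[OF s] power2_eq_square algebra_simps)
    then show "((\<lambda>s. V s * g1 s / P s) has_real_derivative Y s) (at s)"
      by (rule has_real_derivative_transform_on[OF _ I(1) s]) (simp add: VP[symmetric])
  qed
  define p where "p s = - X s / V s - f s * (- \<rho> * a) / (\<rho> * (d * g1 s)\<^sup>2)" for s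
  define q where "q s = - Y s / V s - f s * 0 / (\<rho> * (d * g1 s)\<^sup>2)" for s
  have "p s *\<^sub>R r \<theta> + q s *\<^sub>R e = A *v (f s *\<^sub>R r \<theta> + g s *\<^sub>R e)" if s: "s \<in> I" for s \<theta>
    using laplace[OF s, of \<theta>] laplace_III_eq[OF P V Vc X Y s, of \<theta>]
    by (simp only: p_def q_def x[OF s])
  then obtain \<Lambda> \<mu> where \<Lambda>: "\<And>s. s \<in> I \<Longrightarrow> p s = \<Lambda> * f s" and \<mu>: "\<And>s. s \<in> I \<Longrightarrow> q s = \<mu> * g s"
    using eigenvalues_axial[of I p q A f g] signs rho by fastforce
  have eq_g: "- \<epsilon> * (2 * a * f1 s * w s + g1 s * W s) = \<mu> * g s" if s: "s \<in> I" for s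
  proof -
    have "q s = - \<epsilon> * (2 * a * f1 s * w s + g1 s * W s)"
      using k[OF s] g1[OF s] signs
      by (auto simp: q_def Y_def V_def power2_eq_square field_simps)
    then show ?thesis using \<mu>[OF s] by simp
  qed
  have eq_f: "- \<epsilon> * g1 s * (a * (f1 s)\<^sup>2 * w s - d * (g1 s)\<^sup>2 * w s + g1 s * f1 s * W s)
        + a * f s = \<Lambda> * (g1 s)\<^sup>2 * f s" if s: "s \<in> I" for s
  proof -
    have "X s / V s = \<epsilon> * (a * (f1 s)\<^sup>2 * w s - d * (g1 s)\<^sup>2 * w s + g1 s * f1 s * W s) / g1 s"
      using k[OF s] g1[OF s] signs(2) by (auto simp: X_def V_def)
    moreover have "f s * (- \<rho> * a) / (\<rho> * (d * g1 s)\<^sup>2) = - a * f s / (g1 s)\<^sup>2"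
      using rho signs(2) by (auto simp: power_mult_distrib)
    ultimately have p: "p s = - \<epsilon> * (a * (f1 s)\<^sup>2 * w s - d * (g1 s)\<^sup>2 * w s + g1 s * f1 s * W s) / g1 s
        + a * f s / (g1 s)\<^sup>2"
      by (simp add: p_def)
    have "(g1 s)\<^sup>2 * p s = - \<epsilon> * g1 s * (a * (f1 s)\<^sup>2 * w s - d * (g1 s)\<^sup>2 * w s + g1 s * f1 s * W s) + a * f s"
    proof -
      have "t\<^sup>2 * (- \<epsilon> * Z / t + z / t\<^sup>2) = - \<epsilon> * t * Z + z" if "t \<noteq> 0" for t Z z
        using that by (simp add: field_simps power2_eq_square)
      then show ?thesis
        unfolding p using g1[OF s] by blast
    qed
    moreover have "(g1 s)\<^sup>2 * p s = \<Lambda> * (g1 s)\<^sup>2 * f s"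
      by (simp add: \<Lambda>[OF s])
    ultimately show ?thesis
      by simp
  qed
  have D': "(f has_real_derivative k s * (w s * f1 s)) (at s)" "(g has_real_derivative k s * (w s * g1 s)) (at s)"
    "(f1 has_real_derivative k s * (- d * g1 s)) (at s)" "(g1 has_real_derivative k s * (a * f1 s)) (at s)"
    if s: "s \<in> I" for s
    using D[OF s] kw[OF s] f2[OF s] g2[OF s] by (simp_all flip: mult.assoc)
  have "(\<exists>C. C \<noteq> 0 \<and> (\<forall>s\<in>I. a * (f s)\<^sup>2 + d * (g s)\<^sup>2 = C)) \<or> (\<forall>s\<in>I. a * f s + g1 s * w s = 0)"
    by (rule axial_eigenvalue_dichotomy[where f = f and g = g and k = k and w = w and W = W
          and ?f1.0 = f1 and ?g1.0 = g1 and \<mu> = \<mu> and \<Lambda> = \<Lambda>, OF ivl signs D' w' k w0 f g1 arc' eq_g eq_f])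
  then show thesis
  proof
    assume "\<exists>C. C \<noteq> 0 \<and> (\<forall>s\<in>I. a * (f s)\<^sup>2 + d * (g s)\<^sup>2 = C)"
    with that[OF D(1,2) g1 arc'] show thesis by blast
  next
    assume m: "\<forall>s\<in>I. a * f s + g1 s * w s = 0"
    have "k s * (a * f s) + g1 s = 0" if s: "s \<in> I" for s
    proof -
      have "k s * (a * f s) + g1 s * (k s * w s) = k s * (a * f s + g1 s * w s)"
        by (simp add: algebra_simps)
      then show ?thesis
        using m s kw[OF s] by simp
    qed
    from catenary_profile[where f = f and g = g and k = k and ?f1.0 = f1 and ?g1.0 = g1, OF ivl signs D(1,2) D'(3,4) f g1 arc' this]
    show thesis
      using that[OF D(1,2) g1 arc'] by metis
  qed
qed

text \<open>Non-degeneracy means \<open>h' m' \<noteq> 0\<close>, so \<open>h' / m'\<close> has a constant sign \<open>\<epsilon>\<close> and \<open>u = \<surd>|h' / m'|\<close>, \<open>v = - \<epsilon> / u\<close> are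
  the coefficients of a unit normal. Then \<open>e\<^sub>1\<^sub>1 = - \<epsilon> (u' / u)\<^sup>2\<close> and \<open>\<surd>|e| = |u'|\<close>, which is why \<open>u\<close> is the natural parameter.\<close>

lemma lightlike_axis_profile:
  assumes frame: "rotation_frame r r1 e 0 (- 1 / 2) 0 1 0 2"
    and I: "open I" "is_interval I" "I \<noteq> {}"
    and smooth: "\<And>s. s \<in> I \<Longrightarrow> (h has_real_derivative h1 s) (at s)" "\<And>s. s \<in> I \<Longrightarrow> (m has_real_derivative m1 s) (at s)"
      "\<And>s. s \<in> I \<Longrightarrow> (h1 has_real_derivative h2 s) (at s)" "\<And>s. s \<in> I \<Longrightarrow> (m1 has_real_derivative m2 s) (at s)"
      "\<And>s. s \<in> I \<Longrightarrow> (h2 has_real_derivative h3 s) (at s)" "\<And>s. s \<in> I \<Longrightarrow> (m2 has_real_derivative m3 s) (at s)"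
    and x: "\<And>s \<theta>. s \<in> I \<Longrightarrow> x s \<theta> = h s *\<^sub>R r \<theta> + m s *\<^sub>R e"
    and h: "\<And>s. s \<in> I \<Longrightarrow> h s \<noteq> 0"
    and nondeg: "\<And>s \<theta>. s \<in> I \<Longrightarrow> nondegenerate_at x s \<theta>"
    and normal: "unit_normal_field I x n"
    and curved: "\<And>s \<theta>. s \<in> I \<Longrightarrow> coeff_L x n s \<theta> * coeff_N x n s \<theta> - (coeff_M x n s \<theta>)\<^sup>2 \<noteq> 0"
    and laplace: "\<And>s \<theta>. s \<in> I \<Longrightarrow> laplace_III_vec n x s \<theta> = A *v x s \<theta>"
  shows "\<And>s. s \<in> I \<Longrightarrow> h1 s \<noteq> 0"
    and "(\<exists>C. C \<noteq> 0 \<and> (\<forall>s\<in>I. h s * m s = C)) \<or> (\<exists>C t0. C \<noteq> 0 \<and> (\<forall>s\<in>I. m s = C * h s ^ 3 + t0))"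
proof -
  note ivl = I
  interpret rotation_frame r r1 e 0 "- 1 / 2" 0 1 0 2
    by (rule frame)
  note D = smooth
  have nz: "h1 s * m1 s \<noteq> 0" if s: "s \<in> I" for s
  proof -
    have "pd 1 x s 0 = h1 s *\<^sub>R r 0 + m1 s *\<^sub>R e"
      by (rule pd1_eqI[OF I(1) s x curve_has_vector_derivative]) (auto intro: D s)
    moreover have "pd 2 x s 0 = h s *\<^sub>R r1 0"
      by (rule pd2_eqI[where q = "\<lambda>\<theta>. h s *\<^sub>R r \<theta> + m s *\<^sub>R e"])
         (auto intro!: derivative_eq_intros r_deriv simp: x s)
    ultimately show ?thesis
      using nondeg[OF s, of 0]
      by (auto simp: nondegenerate_at_def coeff_E_def coeff_F_def coeff_G_def
          lorentz_meridian_plane lorentz_scaleR_right)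
  qed
  then show h1: "h1 s \<noteq> 0" if "s \<in> I" for s
    using that by auto
  have m1: "m1 s \<noteq> 0" if "s \<in> I" for s
    using nz that by auto
  obtain \<epsilon> where eps: "\<epsilon> = 1 \<or> \<epsilon> = -1" and \<epsilon>: "\<And>s. s \<in> I \<Longrightarrow> \<bar>h1 s / m1 s\<bar> = \<epsilon> * (h1 s / m1 s)"
  proof -
    have "continuous_on I (\<lambda>s. h1 s / m1 s)"
      using m1 by (intro continuous_intros continuous_at_imp_continuous_on ballI) (auto intro: DERIV_isCont D)
    from constant_sign_on_interval[OF I(2) this] show thesis
      using h1 m1 that by (metis divide_eq_0_iff insert_iff singletonD)
  qed
  have ee: "\<epsilon> * \<epsilon> = 1"
    using eps by auto
  define y where "y s = \<epsilon> * (h1 s / m1 s)" for s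
  have y0: "y s > 0" if "s \<in> I" for s
    unfolding y_def \<epsilon>[OF that, symmetric] using h1[OF that] m1[OF that] by simp
  define y1 where "y1 s = \<epsilon> * ((h2 s * m1 s - h1 s * m2 s) / (m1 s * m1 s))" for s
  have y: "(y has_real_derivative y1 s) (at s)" if s: "s \<in> I" for s
    unfolding y_def y1_def by (intro DERIV_cmult DERIV_divide D m1 s)
  have y1: "\<exists>y2. (y1 has_real_derivative y2) (at s)" if s: "s \<in> I" for s
    unfolding y1_def by (rule exI) (rule derivative_eq_intros D m1 s refl | simp add: m1 s)+
  define u where "u s = sqrt (y s)" for s
  have u0: "u s > 0" and uu: "u s * u s = y s" if "s \<in> I" for s
    using y0[OF that] by (auto simp: u_def)
  define u1 where "u1 s = y1 s / (2 * u s)" for s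
  have u: "(u has_real_derivative u1 s) (at s)" if s: "s \<in> I" for s
    unfolding u_def u1_def using y0[OF s]
    by (auto intro!: derivative_eq_intros y s simp: field_simps)
  have um: "(u s)\<^sup>2 * m1 s = \<epsilon> * h1 s" if s: "s \<in> I" for s
    using uu[OF s] m1[OF s] by (simp add: power2_eq_square y_def)
  interpret rotation_surface r r1 e 0 "- 1 / 2" 0 1 0 2 I x n h m h1 m1 h2 m2
    u "\<lambda>s. - \<epsilon> / u s" u1 "\<lambda>s. \<epsilon> * u1 s / (u s)\<^sup>2" \<epsilon>
  proof
    show "((\<lambda>s. - \<epsilon> / u s) has_real_derivative \<epsilon> * u1 s / (u s)\<^sup>2) (at s)" if "s \<in> I" for s
      using u0[OF that] by (auto intro!: derivative_eq_intros u that simp: power2_eq_square)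
    show "(0 * u s + (- 1 / 2) * (- \<epsilon> / u s)) * h1 s + ((- 1 / 2) * u s + 0 * (- \<epsilon> / u s)) * m1 s = 0"
      if s: "s \<in> I" for s
      using um[OF s] u0[OF s] by (simp add: field_simps power2_eq_square)
    show "(0 * u s + (- 1 / 2) * (- \<epsilon> / u s)) * u s + ((- 1 / 2) * u s + 0 * (- \<epsilon> / u s)) * (- \<epsilon> / u s) = \<epsilon>"
      if s: "s \<in> I" for s
      using u0[OF s] by simp
  qed (use I x D u nondeg normal curved eps in auto)
  define P where "P s = - \<epsilon> * (u1 s)\<^sup>2 / (u s)\<^sup>2" for s
  have P: "P s = (0 * u1 s + (- 1 / 2) * (\<epsilon> * u1 s / (u s)\<^sup>2)) * u1 s
      + ((- 1 / 2) * u1 s + 0 * (\<epsilon> * u1 s / (u s)\<^sup>2)) * (\<epsilon> * u1 s / (u s)\<^sup>2)" for s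
    by (simp add: P_def power2_eq_square)
  have u1: "u1 s \<noteq> 0" if "s \<in> I" for s
    using third_form_nonzero[OF that] by auto
  have V: "(u1 s)\<^sup>2 = \<bar>P s * (1 * (u s)\<^sup>2)\<bar>" if "s \<in> I" for s
    using u0[OF that] eps by (auto simp: P_def)
  have u1': "\<exists>u2. (u1 has_real_derivative u2) (at s)" if s: "s \<in> I" for s
  proof -
    obtain y2 where "(y1 has_real_derivative y2) (at s)"
      using y1[OF s] by blast
    then show ?thesis
      unfolding u1_def using u0[OF s]
      by (intro exI) (rule derivative_eq_intros u s refl | simp | assumption)+
  qed
  have Vc: "continuous_on I u1"
    using u1' DERIV_isCont by (blast intro: continuous_at_imp_continuous_on)
  define H where "H s = h1 s / u1 s" for s
  have H: "h1 s = u1 s * H s" if "s \<in> I" for s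
    using u1[OF that] by (simp add: H_def)
  have "\<exists>K. \<forall>s\<in>I. (H has_real_derivative u1 s * K s) (at s)"
  proof (intro bchoice[rule_format] bchoice ballI)
    fix s assume s: "s \<in> I"
    obtain u2 where "(u1 has_real_derivative u2) (at s)"
      using u1'[OF s] by blast
    then have "(H has_real_derivative u1 s * ((h2 s * u1 s - h1 s * u2) / (u1 s * u1 s) / u1 s)) (at s)"
      unfolding H_def using u1[OF s] by (auto intro!: derivative_eq_intros D s)
    then show "\<exists>K. (H has_real_derivative u1 s * K) (at s)" by blast
  qed
  then obtain K where K: "\<And>s. s \<in> I \<Longrightarrow> (H has_real_derivative u1 s * K s) (at s)"
    by blast
  have X: "((\<lambda>s. u1 s * h1 s / P s) has_real_derivative - \<epsilon> * u1 s * (2 * u s * H s + (u s)\<^sup>2 * K s)) (at s)"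
    and Y: "((\<lambda>s. u1 s * m1 s / P s) has_real_derivative - u1 s * K s) (at s)" if s: "s \<in> I" for s
  proof -
    have "((\<lambda>s. - \<epsilon> * ((u s)\<^sup>2 * H s)) has_real_derivative - \<epsilon> * u1 s * (2 * u s * H s + (u s)\<^sup>2 * K s)) (at s)"
      by (rule derivative_eq_intros u K s refl)+ (simp add: algebra_simps)
    then show "((\<lambda>s. u1 s * h1 s / P s) has_real_derivative - \<epsilon> * u1 s * (2 * u s * H s + (u s)\<^sup>2 * K s)) (at s)"
    proof (rule has_real_derivative_transform_on[OF _ I(1) s])
      fix t assume t: "t \<in> I"
      show "- \<epsilon> * ((u t)\<^sup>2 * H t) = u1 t * h1 t / P t"
        using u1[OF t] u0[OF t] eps by (auto simp: H_def P_def power2_eq_square)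
    qed
    have "((\<lambda>s. - H s) has_real_derivative - u1 s * K s) (at s)"
      by (rule derivative_eq_intros K s refl)+ simp
    then show "((\<lambda>s. u1 s * m1 s / P s) has_real_derivative - u1 s * K s) (at s)"
    proof (rule has_real_derivative_transform_on[OF _ I(1) s])
      fix t assume t: "t \<in> I"
      have "u1 t * m1 t / P t = - \<epsilon> * ((u t)\<^sup>2 * m1 t) / u1 t"
        using u1[OF t] u0[OF t] eps by (auto simp: P_def power2_eq_square)
      also have "\<dots> = - H t"
        by (simp add: um[OF t] H_def mult.assoc[symmetric] ee)
      finally show "- H t = u1 t * m1 t / P t" ..
    qed
  qed
  define p where "p s = - (- \<epsilon> * u1 s * (2 * u s * H s + (u s)\<^sup>2 * K s)) / u1 s - h s * 0 / (1 * (u s)\<^sup>2)" for s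
  define q where "q s = - (- u1 s * K s) / u1 s - h s * 2 / (1 * (u s)\<^sup>2)" for s
  have two: "(2::real) \<noteq> 0" and half: "(- 1 / 2::real) \<noteq> 0"
    by simp_all
  have eig: "p s *\<^sub>R r \<theta> + q s *\<^sub>R e = A *v (h s *\<^sub>R r \<theta> + m s *\<^sub>R e)" if s: "s \<in> I" for s \<theta>
    using laplace[OF s, of \<theta>] laplace_III_eq[OF P V Vc X Y s, of \<theta>]
    by (simp only: p_def q_def x[OF s])
  obtain \<Lambda> \<tau> where \<Lambda>: "\<And>s. s \<in> I \<Longrightarrow> p s = \<Lambda> * h s"
    and \<tau>: "\<And>s. s \<in> I \<Longrightarrow> q s = \<tau> * h s + \<Lambda> * m s"
    by (rule eigenvalues_lightlike[where f = h and g = m and p = p and q = q and A = A and I = I,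
          OF refl two refl half h eig]) (assumption | rule that)+
  show "(\<exists>C. C \<noteq> 0 \<and> (\<forall>s\<in>I. h s * m s = C)) \<or> (\<exists>C t0. C \<noteq> 0 \<and> (\<forall>s\<in>I. m s = C * h s ^ 3 + t0))"
  proof (rule lightlike_profile[where h = h and m = m and u = u and H = H and ?u1.0 = u1 and K = K
        and \<Lambda> = \<Lambda> and \<tau> = \<tau>, OF ivl eps _ _ u K u1 h])
    show "(h has_real_derivative u1 s * H s) (at s)" if "s \<in> I" for s
      using D(1)[OF that] H[OF that] by simp
    show "(m has_real_derivative u1 s * (\<epsilon> * H s / (u s)\<^sup>2)) (at s)" if s: "s \<in> I" for s
    proof -
      have "u1 s * (\<epsilon> * H s / (u s)\<^sup>2) = m1 s"
        using um[OF s] u0[OF s] by (simp add: H[OF s] field_simps)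
      then show ?thesis using D(2)[OF s] by simp
    qed
    show "u s \<noteq> 0" "H s \<noteq> 0" if "s \<in> I" for s
      using u0[OF that] h1[OF that] H[OF that] by auto
    show "\<epsilon> * (2 * u s * H s + (u s)\<^sup>2 * K s) = \<Lambda> * h s" if s: "s \<in> I" for s
      using \<Lambda>[OF s] u1[OF s] by (simp add: p_def)
    show "K s - 2 * h s / (u s)\<^sup>2 = \<tau> * h s + \<Lambda> * m s" if s: "s \<in> I" for s
      using \<tau>[OF s] u1[OF s] by (simp add: q_def mult.commute)
  qed
qed

section \<open>Recognizing open parts of the model surfaces\<close>

lemma open_part_by_coordinate:
  assumes "open J" "open U"
    and S: "\<And>s \<theta>. s \<in> I \<Longrightarrow> x s \<theta> \<in> T" "\<And>s \<theta>. s \<in> I \<Longrightarrow> x s \<theta> \<in> U"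
      "\<And>s \<theta>. s \<in> I \<Longrightarrow> lorentz (x s \<theta>) c \<in> J"
    and T: "\<And>p. p \<in> T \<Longrightarrow> p \<in> U \<Longrightarrow> lorentz p c \<in> J \<Longrightarrow> \<exists>s\<in>I. \<exists>\<theta>. p = x s \<theta>"
  shows "open_part {x s \<theta> | s \<theta>. s \<in> I} T"
proof -
  have "open ((\<lambda>p. lorentz p c) -` J)"
    by (intro open_vimage assms continuous_intros)
  then have "open (U \<inter> (\<lambda>p. lorentz p c) -` J)"
    using assms(2) by blast
  moreover have "{x s \<theta> | s \<theta>. s \<in> I} = T \<inter> (U \<inter> (\<lambda>p. lorentz p c) -` J)"
    using S by (auto dest!: T)
  ultimately show ?thesis
    unfolding open_part_def openin_open by blast
qed

context rotation_frame
begin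

text \<open>The linear part is the identity or, for \<open>\<sigma> = - 1\<close>, minus the identity on the plane orthogonal to \<open>e\<close>. The latter
  serves for profiles with \<open>f\<close> of the sign opposite to that of the model.\<close>

lemma lorentz_isometry_axial:
  assumes "b = 0" "d \<noteq> 0" "\<sigma> = 1 \<or> \<sigma> = -1"
  obtains \<Phi> where "lorentz_isometry \<Phi>"
    "\<And>p q \<theta>. \<Phi> (p *\<^sub>R r \<theta> + q *\<^sub>R e) = (\<sigma> * p) *\<^sub>R r \<theta> + (q + t0) *\<^sub>R e"
proof -
  define L where "L p = \<sigma> *\<^sub>R p + ((1 - \<sigma>) * lorentz p e / d) *\<^sub>R e" for p :: "real^3"
  have "linear L"
    by (rule linearI) (simp_all add: L_def lorentz_linear algebra_simps add_divide_distrib diff_divide_distrib)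
  then have L: "matrix L *v p = L p" for p
    by (simp add: matrix_works)
  have "lorentz (L u) (L v) = lorentz u v" for u v
    using assms(2,3) by (auto simp: L_def lorentz_linear gram lorentz_commute[of e u] lorentz_commute[of e v] field_simps)
  moreover have "L (p *\<^sub>R r \<theta> + q *\<^sub>R e) + t0 *\<^sub>R e = (\<sigma> * p) *\<^sub>R r \<theta> + (q + t0) *\<^sub>R e" for p q \<theta>
  proof -
    have "L (p *\<^sub>R r \<theta> + q *\<^sub>R e) = (\<sigma> * p) *\<^sub>R r \<theta> + (\<sigma> * q + (1 - \<sigma>) * q) *\<^sub>R e"
      unfolding scaleR_add_left using assms(1,2) by (simp add: L_def lorentz_linear gram scaleR_add_right)
    also have "\<sigma> * q + (1 - \<sigma>) * q = q"
      by (simp add: algebra_simps)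
    finally show ?thesis
      by (simp add: scaleR_add_left)
  qed
  moreover have "lorentz_isometry (\<lambda>p. matrix L *v p + t0 *\<^sub>R e)"
    unfolding lorentz_isometry_def
    by (intro exI[of _ "matrix L"] exI[of _ "t0 *\<^sub>R e"]) (simp add: L calculation(1))
  ultimately show thesis
    by (intro that[of "\<lambda>p. matrix L *v p + t0 *\<^sub>R e"]) (simp_all add: L)
qed

text \<open>Both surfaces are graphs over the axis with profile \<open>f = \<sigma> F(g - t0)\<close>, so one lies in the other; differentiating
  this relation carries the non-null speed of the given profile over to the model, which is therefore non-degenerate there.\<close>

lemma open_part_isometric_model:
  assumes frame: "b = 0" "d \<noteq> 0" "\<sigma> = 1 \<or> \<sigma> = -1"
    and I: "open I" "is_interval I"
    and x: "\<And>s \<theta>. s \<in> I \<Longrightarrow> x s \<theta> = f s *\<^sub>R r \<theta> + g s *\<^sub>R e"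
    and D: "\<And>s. s \<in> I \<Longrightarrow> (f has_real_derivative f1 s) (at s)"
      "\<And>s. s \<in> I \<Longrightarrow> (g has_real_derivative g1 s) (at s)"
      "\<And>t. (F has_real_derivative F1 t) (at t)"
    and nz: "\<And>s. s \<in> I \<Longrightarrow> f s \<noteq> 0" "\<And>s. s \<in> I \<Longrightarrow> g1 s \<noteq> 0"
      "\<And>s. s \<in> I \<Longrightarrow> a * (f1 s)\<^sup>2 + d * (g1 s)\<^sup>2 \<noteq> 0"
    and f: "\<And>s. s \<in> I \<Longrightarrow> f s = \<sigma> * F (g s - t0)"
    and M: "\<And>t \<theta>. M t \<theta> = F t *\<^sub>R r \<theta> + t *\<^sub>R e"
  shows "\<exists>\<Phi>. lorentz_isometry \<Phi> \<and> open_part {x s \<theta> | s \<theta>. s \<in> I} (\<Phi> ` nondegenerate_part M)"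
proof -
  obtain \<Phi> where iso: "lorentz_isometry \<Phi>"
    and \<Phi>: "\<And>p q \<theta>. \<Phi> (p *\<^sub>R r \<theta> + q *\<^sub>R e) = (\<sigma> * p) *\<^sub>R r \<theta> + (q + t0) *\<^sub>R e"
    using lorentz_isometry_axial[OF frame] by metis
  have nondeg: "nondegenerate_at M (g s - t0) \<theta>" if s: "s \<in> I" for s \<theta>
  proof -
    let ?t = "g s - t0"
    have M_t: "pd 1 M ?t \<theta> = F1 ?t *\<^sub>R r \<theta> + 1 *\<^sub>R e"
      by (rule pd1_eqI[OF open_UNIV UNIV_I M]) (auto intro!: curve_has_vector_derivative D derivative_eq_intros simp del: scaleR_one)
    have M_\<theta>: "pd 2 M ?t \<theta> = F ?t *\<^sub>R r1 \<theta>"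
      by (rule pd2_eqI[OF M]) (auto intro!: derivative_eq_intros r_deriv)
    have "((\<lambda>s. \<sigma> * F (g s - t0)) has_real_derivative \<sigma> * (F1 ?t * g1 s)) (at s)"
      by (auto intro!: derivative_eq_intros DERIV_chain2[where f = F] D s)
    then have "(f has_real_derivative \<sigma> * (F1 ?t * g1 s)) (at s)"
      by (rule has_field_derivative_transform_within_open[OF _ I(1) s]) (simp add: f)
    then have "f1 s = \<sigma> * (F1 ?t * g1 s)"
      by (rule DERIV_unique[OF D(1)[OF s]])
    then have "a * (f1 s)\<^sup>2 + d * (g1 s)\<^sup>2 = (a * (F1 ?t)\<^sup>2 + d) * (g1 s)\<^sup>2"
      using frame(3) by (auto simp: algebra_simps power_mult_distrib)
    then have "a * (F1 ?t)\<^sup>2 + d \<noteq> 0"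
      using nz(3)[OF s] by auto
    moreover have "F ?t \<noteq> 0"
      using nz(1)[OF s] f[OF s] by auto
    moreover have "coeff_E M ?t \<theta> * coeff_G M ?t \<theta> - (coeff_F M ?t \<theta>)\<^sup>2
        = (a * (F1 ?t)\<^sup>2 + d) * (\<rho> * (F ?t)\<^sup>2)"
      using frame(1) by (simp add: coeff_E_def coeff_F_def coeff_G_def M_t M_\<theta>
          lorentz_linear gram gram' power2_eq_square algebra_simps)
    ultimately show ?thesis
      using rho by (auto simp: nondegenerate_at_def)
  qed
  have "open_part {x s \<theta> | s \<theta>. s \<in> I} (\<Phi> ` nondegenerate_part M)"
  proof (rule open_part_by_coordinate[OF open_image_nonzero_derivative[OF I D(2) nz(2)] open_UNIV, where c = "(1 / d) *\<^sub>R e"])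
    show "x s \<theta> \<in> \<Phi> ` nondegenerate_part M" if s: "s \<in> I" for s \<theta>
    proof -
      have "x s \<theta> = \<Phi> (M (g s - t0) \<theta>)"
        by (simp add: x[OF s] M \<Phi> f[OF s])
      then show ?thesis
        using nondeg[OF s] by (auto simp: nondegenerate_part_def)
    qed
    show "lorentz (x s \<theta>) ((1 / d) *\<^sub>R e) \<in> g ` I" if s: "s \<in> I" for s \<theta>
      using frame s by (auto simp: x[OF s] lorentz_linear gram)
    fix p assume "p \<in> \<Phi> ` nondegenerate_part M" and J: "lorentz p ((1 / d) *\<^sub>R e) \<in> g ` I"
    then obtain t \<theta> where p: "p = \<Phi> (M t \<theta>)"
      by (auto simp: nondegenerate_part_def)
    have "lorentz p ((1 / d) *\<^sub>R e) = t + t0"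
      using frame by (auto simp: p M \<Phi> lorentz_linear gram)
    with J obtain s where s: "s \<in> I" "g s = t + t0"
      by auto
    have "p = x s \<theta>"
      by (simp add: p M \<Phi> x[OF s(1)] f[OF s(1)] s(2))
    with s show "\<exists>s\<in>I. \<exists>\<theta>. p = x s \<theta>" by blast
  qed auto
  with iso show ?thesis by blast
qed

end

lemma central_quadric:
  assumes "C \<noteq> 0" "open_part S {p. lorentz p p = C}"
  shows "(\<exists>c>0. open_part S (pseudosphere c)) \<or> (\<exists>c>0. open_part S (hyperbolic_space c))"
proof (cases "C > 0")
  case True
  then have "pseudosphere (sqrt C) = {p. lorentz p p = C}"
    by (simp add: pseudosphere_def)
  with assms(2) True show ?thesis
    by (metis real_sqrt_gt_zero)
next
  case False
  then have "hyperbolic_space (sqrt (- C)) = {p. lorentz p p = C}" "sqrt (- C) > 0"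
    using assms(1) by (simp_all add: hyperbolic_space_def)
  with assms(2) show ?thesis
    by metis
qed

section \<open>The four rotation groups\<close>

lemma vector_3_eq_scaleR: "(vector [p, q, t] :: real^3) = p *\<^sub>R axis 1 1 + q *\<^sub>R axis 2 1 + t *\<^sub>R axis 3 1"
  by (simp add: vec_eq_iff forall_3 axis_def)

lemma has_vector_derivative_vector_3:
  assumes "(p has_real_derivative p') (at t)" "(q has_real_derivative q') (at t)" "(w has_real_derivative w') (at t)"
  shows "((\<lambda>t. vector [p t, q t, w t] :: real^3) has_vector_derivative vector [p', q', w']) (at t)"
  unfolding vector_3_eq_scaleR
  by (intro has_vector_derivative_add has_real_derivative_scaleR_const assms)

definition circle :: "real \<Rightarrow> real^3" where "circle \<theta> = vector [cos \<theta>, sin \<theta>, 0]"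
definition hyperbola1 :: "real \<Rightarrow> real^3" where "hyperbola1 \<theta> = vector [cosh \<theta>, 0, sinh \<theta>]"
definition hyperbola2 :: "real \<Rightarrow> real^3" where "hyperbola2 \<theta> = vector [sinh \<theta>, 0, cosh \<theta>]"

text \<open>The orbit of the null vector \<open>(0, - 1/2, 1/2)\<close> under the rotations that fix the null vector \<open>(0, 1/2, 1/2)\<close>.\<close>

definition null_parabola :: "real \<Rightarrow> real^3" where
  "null_parabola \<theta> = vector [\<theta>, (\<theta>\<^sup>2 - 1) / 2, (\<theta>\<^sup>2 + 1) / 2]"

lemma frame_timelike:
  "rotation_frame circle (\<lambda>\<theta>. vector [- sin \<theta>, cos \<theta>, 0]) (vector [0, 0, 1]) 1 0 (-1) 1 (- 1 * 1) 0"
proof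
  fix \<theta> :: real
  show "(circle has_vector_derivative vector [- sin \<theta>, cos \<theta>, 0]) (at \<theta>)"
    unfolding circle_def[abs_def]
    by (intro has_vector_derivative_vector_3) (auto intro!: derivative_eq_intros)
  have "((\<lambda>\<theta>. vector [- sin \<theta>, cos \<theta>, 0] :: real^3) has_vector_derivative vector [- cos \<theta>, - sin \<theta>, 0]) (at \<theta>)"
    by (intro has_vector_derivative_vector_3) (auto intro!: derivative_eq_intros)
  moreover have "vector [- cos \<theta>, - sin \<theta>, 0] = (- 1 * 1) *\<^sub>R circle \<theta> + 0 *\<^sub>R vector [0, 0, 1]"
    by (simp add: circle_def vec_eq_iff forall_3)
  ultimately show "((\<lambda>\<theta>. vector [- sin \<theta>, cos \<theta>, 0]) has_vector_derivative
      (- 1 * 1) *\<^sub>R circle \<theta> + 0 *\<^sub>R vector [0, 0, 1]) (at \<theta>)"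
    by simp
qed (simp_all add: circle_def lorentz_def flip: power2_eq_square)

lemma frame_spacelike1:
  "rotation_frame hyperbola1 (\<lambda>\<theta>. vector [sinh \<theta>, 0, cosh \<theta>]) (vector [0, 1, 0]) 1 0 1 (-1) (- (-1) * 1) 0"
proof
  fix \<theta> :: real
  show "(hyperbola1 has_vector_derivative vector [sinh \<theta>, 0, cosh \<theta>]) (at \<theta>)"
    unfolding hyperbola1_def[abs_def]
    by (intro has_vector_derivative_vector_3) (auto intro!: derivative_eq_intros)
  have "((\<lambda>\<theta>. vector [sinh \<theta>, 0, cosh \<theta>] :: real^3) has_vector_derivative vector [cosh \<theta>, 0, sinh \<theta>]) (at \<theta>)"
    by (intro has_vector_derivative_vector_3) (auto intro!: derivative_eq_intros)
  then show "((\<lambda>\<theta>. vector [sinh \<theta>, 0, cosh \<theta>]) has_vector_derivative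
      (- (-1) * 1) *\<^sub>R hyperbola1 \<theta> + 0 *\<^sub>R vector [0, 1, 0]) (at \<theta>)"
    by (simp add: hyperbola1_def)
  have "(cosh \<theta>)\<^sup>2 - (sinh \<theta>)\<^sup>2 = 1"
    by (rule hyperbolic_pythagoras)
  then show "lorentz (hyperbola1 \<theta>) (hyperbola1 \<theta>) = 1"
    "lorentz (vector [sinh \<theta>, 0, cosh \<theta>]) (vector [sinh \<theta>, 0, cosh \<theta>]) = -1"
    by (simp_all add: hyperbola1_def lorentz_def power2_eq_square)
qed (simp_all add: hyperbola1_def lorentz_def)

lemma frame_spacelike2:
  "rotation_frame hyperbola2 (\<lambda>\<theta>. vector [cosh \<theta>, 0, sinh \<theta>]) (vector [0, 1, 0]) (-1) 0 1 1 (- 1 * (-1)) 0"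
proof
  fix \<theta> :: real
  show "(hyperbola2 has_vector_derivative vector [cosh \<theta>, 0, sinh \<theta>]) (at \<theta>)"
    unfolding hyperbola2_def[abs_def]
    by (intro has_vector_derivative_vector_3) (auto intro!: derivative_eq_intros)
  have "((\<lambda>\<theta>. vector [cosh \<theta>, 0, sinh \<theta>] :: real^3) has_vector_derivative vector [sinh \<theta>, 0, cosh \<theta>]) (at \<theta>)"
    by (intro has_vector_derivative_vector_3) (auto intro!: derivative_eq_intros)
  then show "((\<lambda>\<theta>. vector [cosh \<theta>, 0, sinh \<theta>]) has_vector_derivative
      (- 1 * (-1)) *\<^sub>R hyperbola2 \<theta> + 0 *\<^sub>R vector [0, 1, 0]) (at \<theta>)"
    by (simp add: hyperbola2_def)
  have "(cosh \<theta>)\<^sup>2 - (sinh \<theta>)\<^sup>2 = 1"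
    by (rule hyperbolic_pythagoras)
  then show "lorentz (hyperbola2 \<theta>) (hyperbola2 \<theta>) = -1"
    "lorentz (vector [cosh \<theta>, 0, sinh \<theta>]) (vector [cosh \<theta>, 0, sinh \<theta>]) = 1"
    by (simp_all add: hyperbola2_def lorentz_def power2_eq_square)
qed (simp_all add: hyperbola2_def lorentz_def)

lemma frame_lightlike:
  "rotation_frame null_parabola (\<lambda>\<theta>. vector [1, \<theta>, \<theta>]) (vector [0, 1 / 2, 1 / 2]) 0 (- 1 / 2) 0 1 0 2"
proof
  fix \<theta> :: real
  show "(null_parabola has_vector_derivative vector [1, \<theta>, \<theta>]) (at \<theta>)"
    unfolding null_parabola_def[abs_def]
    by (intro has_vector_derivative_vector_3) (auto intro!: derivative_eq_intros)
  have "((\<lambda>\<theta>. vector [1, \<theta>, \<theta>] :: real^3) has_vector_derivative vector [0, 1, 1]) (at \<theta>)"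
    by (intro has_vector_derivative_vector_3) (auto intro!: derivative_eq_intros)
  moreover have "vector [0, 1, 1] = 0 *\<^sub>R null_parabola \<theta> + 2 *\<^sub>R vector [0, 1 / 2, 1 / 2 :: real]"
    by (simp add: vec_eq_iff forall_3)
  ultimately show "((\<lambda>\<theta>. vector [1, \<theta>, \<theta>]) has_vector_derivative
      0 *\<^sub>R null_parabola \<theta> + 2 *\<^sub>R vector [0, 1 / 2, 1 / 2]) (at \<theta>)"
    by simp
qed (simp_all add: null_parabola_def lorentz_def power2_eq_square field_simps)

lemma rev_timelike_eq: "rev_timelike f g s \<theta> = f s *\<^sub>R circle \<theta> + g s *\<^sub>R vector [0, 0, 1]"
  and rev_spacelike1_eq: "rev_spacelike1 f g s \<theta> = f s *\<^sub>R hyperbola1 \<theta> + g s *\<^sub>R vector [0, 1, 0]"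
  and rev_spacelike2_eq: "rev_spacelike2 f g s \<theta> = f s *\<^sub>R hyperbola2 \<theta> + g s *\<^sub>R vector [0, 1, 0]"
  and rev_lightlike_eq: "rev_lightlike f g s \<theta>
      = (f s - g s) *\<^sub>R null_parabola \<theta> + (f s + g s) *\<^sub>R vector [0, 1 / 2, 1 / 2]"
  by (simp_all add: rev_timelike_def rev_spacelike1_def rev_spacelike2_def rev_lightlike_def Let_def
      circle_def hyperbola1_def hyperbola2_def null_parabola_def vec_eq_iff forall_3 field_simps)

text \<open>A point off the axis is determined, up to rotation, by its coordinate along the axis and by its square, except that the
  square does not distinguish the two branches of a hyperbola. The open set \<open>U\<close> selects the branch that belongs to
  the sign \<open>\<sigma>\<close> of the coefficient \<open>c\<close>.\<close>

definition orbits_separated :: "(real \<Rightarrow> real^3) \<Rightarrow> real^3 \<Rightarrow> real \<Rightarrow> real \<Rightarrow> bool" where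
  "orbits_separated r e a d \<longleftrightarrow> (\<forall>\<sigma>. \<sigma> = 1 \<or> \<sigma> = -1 \<longrightarrow> (\<exists>U. open U \<and>
     (\<forall>c q \<theta>. \<sigma> * c > 0 \<longrightarrow> c *\<^sub>R r \<theta> + q *\<^sub>R e \<in> U) \<and>
     (\<forall>c p. p \<in> U \<and> \<sigma> * c > 0 \<and> lorentz p p = a * c\<^sup>2 + d * (lorentz p e / d)\<^sup>2 \<longrightarrow>
       (\<exists>\<theta>. p = c *\<^sub>R r \<theta> + (lorentz p e / d) *\<^sub>R e))))"

lemma orbit_circle: "orbits_separated circle (vector [0, 0, 1]) 1 (-1)"
  unfolding orbits_separated_def
proof (intro allI impI)
  fix \<sigma> :: real assume \<sigma>: "\<sigma> = 1 \<or> \<sigma> = -1"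
  show "\<exists>U. open U \<and> (\<forall>c q \<theta>. \<sigma> * c > 0 \<longrightarrow> c *\<^sub>R circle \<theta> + q *\<^sub>R vector [0, 0, 1] \<in> U) \<and>
    (\<forall>c p. p \<in> U \<and> \<sigma> * c > 0 \<and>
      lorentz p p = 1 * c\<^sup>2 + (-1) * (lorentz p (vector [0, 0, 1]) / -1)\<^sup>2 \<longrightarrow>
      (\<exists>\<theta>. p = c *\<^sub>R circle \<theta> + (lorentz p (vector [0, 0, 1]) / -1) *\<^sub>R vector [0, 0, 1]))"
  proof (intro exI[of _ UNIV] conjI allI impI)
    fix c p assume p: "p \<in> UNIV \<and> \<sigma> * c > 0 \<and>
        lorentz p p = 1 * c\<^sup>2 + (-1) * (lorentz p (vector [0, 0, 1]) / -1)\<^sup>2"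
    then have c: "c \<noteq> 0" by auto
    have "(p $ 1)\<^sup>2 + (p $ 2)\<^sup>2 = c\<^sup>2"
      using p by (simp add: lorentz_def power2_eq_square)
    then have "(p $ 1 / c)\<^sup>2 + (p $ 2 / c)\<^sup>2 = 1"
      using c by (simp add: power_divide flip: add_divide_distrib)
    then obtain \<theta> where "p $ 1 / c = cos \<theta>" "p $ 2 / c = sin \<theta>"
      using sincos_total_2pi by metis
    then have "p = c *\<^sub>R circle \<theta> + (lorentz p (vector [0, 0, 1]) / -1) *\<^sub>R vector [0, 0, 1]"
      using c by (simp add: vec_eq_iff forall_3 circle_def lorentz_def field_simps)
    then show "\<exists>\<theta>. p = c *\<^sub>R circle \<theta> + (lorentz p (vector [0, 0, 1]) / -1) *\<^sub>R vector [0, 0, 1]" ..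
  qed auto
qed

lemma hyperbola_parameter:
  fixes y z c \<sigma> :: real
  assumes "y\<^sup>2 - z\<^sup>2 = c\<^sup>2" "\<sigma> * y > 0" "\<sigma> * c > 0" "\<sigma> = 1 \<or> \<sigma> = -1"
  obtains \<theta> where "y = c * cosh \<theta>" "z = c * sinh \<theta>"
proof -
  have c: "c \<noteq> 0" "y / c > 0"
    using assms by (auto simp: zero_less_divide_iff)
  have "(y / c)\<^sup>2 = 1 + (z / c)\<^sup>2"
    using assms(1) c(1) by (simp add: field_simps)
  then have "cosh (arsinh (z / c)) = y / c"
    using c(2) by (simp add: cosh_arsinh_real real_sqrt_unique add.commute)
  then show thesis
    using that[of "arsinh (z / c)"] c(1) by simp
qed

lemma orbit_hyperbola1: "orbits_separated hyperbola1 (vector [0, 1, 0]) 1 1"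
  unfolding orbits_separated_def
proof (intro allI impI)
  fix \<sigma> :: real assume \<sigma>: "\<sigma> = 1 \<or> \<sigma> = -1"
  show "\<exists>U. open U \<and> (\<forall>c q \<theta>. \<sigma> * c > 0 \<longrightarrow> c *\<^sub>R hyperbola1 \<theta> + q *\<^sub>R vector [0, 1, 0] \<in> U) \<and>
    (\<forall>c p. p \<in> U \<and> \<sigma> * c > 0 \<and>
      lorentz p p = 1 * c\<^sup>2 + 1 * (lorentz p (vector [0, 1, 0]) / 1)\<^sup>2 \<longrightarrow>
      (\<exists>\<theta>. p = c *\<^sub>R hyperbola1 \<theta> + (lorentz p (vector [0, 1, 0]) / 1) *\<^sub>R vector [0, 1, 0]))"
  proof (intro exI[of _ "{p. \<sigma> * p $ 1 > 0}"] conjI allI impI)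
    show "open {p::real^3. \<sigma> * p $ 1 > 0}"
      by (intro open_Collect_less continuous_intros)
    show "c *\<^sub>R hyperbola1 \<theta> + q *\<^sub>R vector [0, 1, 0] \<in> {p. \<sigma> * p $ 1 > 0}" if "\<sigma> * c > 0" for c q \<theta>
      using that by (simp add: hyperbola1_def flip: mult.assoc)
    fix c p assume p: "p \<in> {p. \<sigma> * p $ 1 > 0} \<and> \<sigma> * c > 0 \<and>
        lorentz p p = 1 * c\<^sup>2 + 1 * (lorentz p (vector [0, 1, 0]) / 1)\<^sup>2"
    then have "(p $ 1)\<^sup>2 - (p $ 3)\<^sup>2 = c\<^sup>2"
      by (simp add: lorentz_def power2_eq_square)
    then obtain \<theta> where "p $ 1 = c * cosh \<theta>" "p $ 3 = c * sinh \<theta>"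
      using hyperbola_parameter[of "p $ 1" "p $ 3" c \<sigma>] p \<sigma> by auto
    then have "p = c *\<^sub>R hyperbola1 \<theta> + (lorentz p (vector [0, 1, 0]) / 1) *\<^sub>R vector [0, 1, 0]"
      by (simp add: vec_eq_iff forall_3 hyperbola1_def lorentz_def)
    then show "\<exists>\<theta>. p = c *\<^sub>R hyperbola1 \<theta> + (lorentz p (vector [0, 1, 0]) / 1) *\<^sub>R vector [0, 1, 0]" ..
  qed
qed

lemma orbit_hyperbola2: "orbits_separated hyperbola2 (vector [0, 1, 0]) (-1) 1"
  unfolding orbits_separated_def
proof (intro allI impI)
  fix \<sigma> :: real assume \<sigma>: "\<sigma> = 1 \<or> \<sigma> = -1"
  show "\<exists>U. open U \<and> (\<forall>c q \<theta>. \<sigma> * c > 0 \<longrightarrow> c *\<^sub>R hyperbola2 \<theta> + q *\<^sub>R vector [0, 1, 0] \<in> U) \<and>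
    (\<forall>c p. p \<in> U \<and> \<sigma> * c > 0 \<and>
      lorentz p p = (-1) * c\<^sup>2 + 1 * (lorentz p (vector [0, 1, 0]) / 1)\<^sup>2 \<longrightarrow>
      (\<exists>\<theta>. p = c *\<^sub>R hyperbola2 \<theta> + (lorentz p (vector [0, 1, 0]) / 1) *\<^sub>R vector [0, 1, 0]))"
  proof (intro exI[of _ "{p. \<sigma> * p $ 3 > 0}"] conjI allI impI)
    show "open {p::real^3. \<sigma> * p $ 3 > 0}"
      by (intro open_Collect_less continuous_intros)
    show "c *\<^sub>R hyperbola2 \<theta> + q *\<^sub>R vector [0, 1, 0] \<in> {p. \<sigma> * p $ 3 > 0}" if "\<sigma> * c > 0" for c q \<theta>
      using that by (simp add: hyperbola2_def flip: mult.assoc)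
    fix c p assume p: "p \<in> {p. \<sigma> * p $ 3 > 0} \<and> \<sigma> * c > 0 \<and>
        lorentz p p = (-1) * c\<^sup>2 + 1 * (lorentz p (vector [0, 1, 0]) / 1)\<^sup>2"
    then have "(p $ 3)\<^sup>2 - (p $ 1)\<^sup>2 = c\<^sup>2"
      by (simp add: lorentz_def power2_eq_square)
    then obtain \<theta> where "p $ 3 = c * cosh \<theta>" "p $ 1 = c * sinh \<theta>"
      using hyperbola_parameter[of "p $ 3" "p $ 1" c \<sigma>] p \<sigma> by auto
    then have "p = c *\<^sub>R hyperbola2 \<theta> + (lorentz p (vector [0, 1, 0]) / 1) *\<^sub>R vector [0, 1, 0]"
      by (simp add: vec_eq_iff forall_3 hyperbola2_def lorentz_def)
    then show "\<exists>\<theta>. p = c *\<^sub>R hyperbola2 \<theta> + (lorentz p (vector [0, 1, 0]) / 1) *\<^sub>R vector [0, 1, 0]" ..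
  qed
qed

section \<open>Classification\<close>

lemma axial_surface_classification:
  assumes frame: "rotation_frame r r1 e a 0 d \<rho> (- \<rho> * a) 0"
    and signs: "a = 1 \<or> a = -1" "d = 1 \<or> d = -1"
    and I: "open I" "is_interval I" "I \<noteq> {}"
    and smooth: "smooth_fun_on f I" "smooth_fun_on g I"
    and f: "\<And>s. s \<in> I \<Longrightarrow> f s \<noteq> 0"
    and x: "\<And>s \<theta>. s \<in> I \<Longrightarrow> x s \<theta> = f s *\<^sub>R r \<theta> + g s *\<^sub>R e"
    and arc: "arclength_profile I x"
    and nondeg: "\<forall>s\<in>I. \<forall>\<theta>. nondegenerate_at x s \<theta>"
    and normal: "unit_normal_field I x n"
    and curved: "\<forall>s\<in>I. \<forall>\<theta>. coeff_L x n s \<theta> * coeff_N x n s \<theta> - (coeff_M x n s \<theta>)\<^sup>2 \<noteq> 0"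
    and laplace: "\<forall>s\<in>I. \<forall>\<theta>. laplace_III_vec n x s \<theta> = A *v x s \<theta>"
    and orbit: "orbits_separated r e a d"
  defines "S \<equiv> {x s \<theta> | s \<theta>. s \<in> I}"
  shows "(\<exists>C. C \<noteq> 0 \<and> open_part S {p. lorentz p p = C}) \<or>
    (\<exists>\<alpha> F \<Phi>. \<alpha> > 0 \<and> ((a * d = -1 \<and> F = sinh) \<or> (a * d = -1 \<and> F = sin) \<or> (a * d = 1 \<and> F = cosh)) \<and>
      lorentz_isometry \<Phi> \<and>
      open_part S (\<Phi> ` nondegenerate_part (\<lambda>t \<theta>. (\<alpha> * F (t / \<alpha>)) *\<^sub>R r \<theta> + t *\<^sub>R e)))"
proof -
  interpret rotation_frame r r1 e a 0 d \<rho> "- \<rho> * a" 0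
    by (rule frame)
  obtain \<epsilon> where eps: "\<epsilon> = 1 \<or> \<epsilon> = -1" and arc': "\<And>s. s \<in> I \<Longrightarrow> coeff_E x s 0 = \<epsilon>"
    using arc unfolding arclength_profile_def by metis
  show ?thesis
  proof (rule axial_profile[OF frame signs eps I smooth f x arc' _ normal])
    fix f1 g1
    assume D: "\<And>s. s \<in> I \<Longrightarrow> (f has_real_derivative f1 s) (at s)" "\<And>s. s \<in> I \<Longrightarrow> (g has_real_derivative g1 s) (at s)"
      and g1: "\<And>s. s \<in> I \<Longrightarrow> g1 s \<noteq> 0"
      and speed: "\<And>s. s \<in> I \<Longrightarrow> a * (f1 s)\<^sup>2 + d * (g1 s)\<^sup>2 = \<epsilon>"
      and profile: "(\<exists>C. C \<noteq> 0 \<and> (\<forall>s\<in>I. a * (f s)\<^sup>2 + d * (g s)\<^sup>2 = C)) \<or>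
       (\<exists>\<alpha> \<sigma> t0. \<alpha> > 0 \<and> (\<sigma> = 1 \<or> \<sigma> = -1) \<and>
         ((a * d = -1 \<and> a * \<epsilon> = 1 \<and> (\<forall>s\<in>I. f s = \<sigma> * (\<alpha> * sinh ((g s - t0) / \<alpha>)))) \<or>
          (a * d = -1 \<and> a * \<epsilon> = -1 \<and> (\<forall>s\<in>I. f s = \<sigma> * (\<alpha> * sin ((g s - t0) / \<alpha>)))) \<or>
          (a * d = 1 \<and> a * \<epsilon> = 1 \<and> (\<forall>s\<in>I. f s = \<sigma> * (\<alpha> * cosh ((g s - t0) / \<alpha>))))))"
    from profile show ?thesis
    proof
      assume "\<exists>C. C \<noteq> 0 \<and> (\<forall>s\<in>I. a * (f s)\<^sup>2 + d * (g s)\<^sup>2 = C)"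
      then obtain C where C: "C \<noteq> 0" "\<And>s. s \<in> I \<Longrightarrow> a * (f s)\<^sup>2 + d * (g s)\<^sup>2 = C"
        by blast
      obtain \<sigma> where \<sigma>: "\<sigma> = 1 \<or> \<sigma> = -1" "\<And>s. s \<in> I \<Longrightarrow> \<sigma> * f s > 0"
      proof -
        have "continuous_on I f"
          using D(1) by (auto intro!: continuous_at_imp_continuous_on DERIV_isCont)
        from constant_sign_on_interval[OF I(2) this f] show thesis
          using that f by (metis insert_iff singletonD zero_less_abs_iff)
      qed
      from orbit[unfolded orbits_separated_def, rule_format, OF \<sigma>(1)] obtain U where U: "open U" "\<forall>c q \<theta>. \<sigma> * c > 0 \<longrightarrow> c *\<^sub>R r \<theta> + q *\<^sub>R e \<in> U"
        "\<forall>c p. p \<in> U \<and> \<sigma> * c > 0 \<and> lorentz p p = a * c\<^sup>2 + d * (lorentz p e / d)\<^sup>2 \<longrightarrow>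
          (\<exists>\<theta>. p = c *\<^sub>R r \<theta> + (lorentz p e / d) *\<^sub>R e)"
        by (elim exE conjE)
      have "open_part S {p. lorentz p p = C}"
        unfolding S_def
      proof (rule open_part_by_coordinate[OF open_image_nonzero_derivative[OF I(1,2) D(2) g1] U(1), where c = "(1 / d) *\<^sub>R e"])
        fix s \<theta> assume s: "s \<in> I"
        show "x s \<theta> \<in> {p. lorentz p p = C}"
          using C(2)[OF s] by (simp add: x[OF s] lorentz_meridian_plane power2_eq_square)
        show "x s \<theta> \<in> U"
          unfolding x[OF s] using U(2)[rule_format, OF \<sigma>(2)[OF s]] .
        show "lorentz (x s \<theta>) ((1 / d) *\<^sub>R e) \<in> g ` I"
          using signs s by (auto simp: x[OF s] lorentz_linear gram)
      next
        fix p assume p: "p \<in> {p. lorentz p p = C}" "p \<in> U" "lorentz p ((1 / d) *\<^sub>R e) \<in> g ` I"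
        then obtain s where s: "s \<in> I" "lorentz p e / d = g s"
          by (auto simp: lorentz_linear)
        have "\<exists>\<theta>. p = f s *\<^sub>R r \<theta> + g s *\<^sub>R e"
          using U(3)[rule_format, of p "f s"] p(1,2) \<sigma>(2)[OF s(1)] C(2)[OF s(1)] unfolding s(2) by simp
        then show "\<exists>s\<in>I. \<exists>\<theta>. p = x s \<theta>"
          using s(1) x by metis
      qed auto
      with C(1) show ?thesis by blast
    next
      assume "\<exists>\<alpha> \<sigma> t0. \<alpha> > 0 \<and> (\<sigma> = 1 \<or> \<sigma> = -1) \<and>
         ((a * d = -1 \<and> a * \<epsilon> = 1 \<and> (\<forall>s\<in>I. f s = \<sigma> * (\<alpha> * sinh ((g s - t0) / \<alpha>)))) \<or>
          (a * d = -1 \<and> a * \<epsilon> = -1 \<and> (\<forall>s\<in>I. f s = \<sigma> * (\<alpha> * sin ((g s - t0) / \<alpha>)))) \<or>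
          (a * d = 1 \<and> a * \<epsilon> = 1 \<and> (\<forall>s\<in>I. f s = \<sigma> * (\<alpha> * cosh ((g s - t0) / \<alpha>)))))"
      then obtain \<alpha> \<sigma> t0 and F :: "real \<Rightarrow> real" where \<alpha>: "\<alpha> > 0" and \<sigma>: "\<sigma> = 1 \<or> \<sigma> = -1"
        and F: "(a * d = -1 \<and> F = sinh) \<or> (a * d = -1 \<and> F = sin) \<or> (a * d = 1 \<and> F = cosh)"
        and fF: "\<And>s. s \<in> I \<Longrightarrow> f s = \<sigma> * (\<alpha> * F ((g s - t0) / \<alpha>))"
        by metis
      obtain F' where F': "\<And>t. (F has_real_derivative F' t) (at t)"
      proof -
        have "(sinh has_real_derivative cosh t) (at t)" "(sin has_real_derivative cos t) (at t)"
          "(cosh has_real_derivative sinh t) (at t)" for t :: real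
          by (auto intro!: derivative_eq_intros)
        with F that show thesis by blast
      qed
      have "\<exists>\<Phi>. lorentz_isometry \<Phi> \<and>
          open_part S (\<Phi> ` nondegenerate_part (\<lambda>t \<theta>. (\<alpha> * F (t / \<alpha>)) *\<^sub>R r \<theta> + t *\<^sub>R e))"
        unfolding S_def
      proof (rule open_part_isometric_model[OF _ _ \<sigma> I(1,2) x D _ f g1])
        show "((\<lambda>t. \<alpha> * F (t / \<alpha>)) has_real_derivative F' (t / \<alpha>)) (at t)" for t
          using \<alpha> by (auto intro!: derivative_eq_intros DERIV_chain2[OF F'])
      qed (use signs speed eps fF in auto)
      then obtain \<Phi> where "lorentz_isometry \<Phi>"
        "open_part S (\<Phi> ` nondegenerate_part (\<lambda>t \<theta>. (\<alpha> * F (t / \<alpha>)) *\<^sub>R r \<theta> + t *\<^sub>R e))"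
        by (elim exE conjE)
      with \<alpha> F show ?thesis
        by - (rule disjI2, intro exI[of _ \<alpha>] exI[of _ F] exI[of _ \<Phi>] conjI)
    qed
  qed (use nondeg curved laplace in auto)
qed

text \<open>In the null coordinates \<open>z - y = h\<close> and \<open>z + y = m + \<theta>\<^sup>2 h\<close> one has \<open>\<langle>x, x\<rangle> = - h m\<close>, and the surface of Enneper
  with parameter \<open>\<alpha>\<close> is \<open>m = - \<alpha> h\<^sup>3 / 4\<close>, reached at \<open>- h / 2\<close>.\<close>

lemma lightlike_surface_classification:
  assumes I: "open I" "is_interval I" "I \<noteq> {}"
    and smooth: "smooth_fun_on f I" "smooth_fun_on g I"
    and h: "\<And>s. s \<in> I \<Longrightarrow> f s - g s \<noteq> 0"
    and x: "\<And>s \<theta>. s \<in> I \<Longrightarrow> x s \<theta> = rev_lightlike f g s \<theta>"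
    and nondeg: "\<forall>s\<in>I. \<forall>\<theta>. nondegenerate_at x s \<theta>"
    and normal: "unit_normal_field I x n"
    and curved: "\<forall>s\<in>I. \<forall>\<theta>. coeff_L x n s \<theta> * coeff_N x n s \<theta> - (coeff_M x n s \<theta>)\<^sup>2 \<noteq> 0"
    and laplace: "\<forall>s\<in>I. \<forall>\<theta>. laplace_III_vec n x s \<theta> = A *v x s \<theta>"
  defines "S \<equiv> {x s \<theta> | s \<theta>. s \<in> I}"
  shows "(\<exists>C. C \<noteq> 0 \<and> open_part S {p. lorentz p p = C}) \<or>
    (\<exists>\<alpha> \<Phi>. \<alpha> \<noteq> 0 \<and> lorentz_isometry \<Phi> \<and> open_part S (\<Phi> ` enneper_surface \<alpha>))"
proof -
  define h where "h = (\<lambda>s. f s - g s)"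
  define m where "m = (\<lambda>s. f s + g s)"
  have h0: "h s \<noteq> 0" if "s \<in> I" for s
    using assms(6)[OF that] by (simp add: h_def)
  have D: "(h has_real_derivative deriv f s - deriv g s) (at s)"
    "(m has_real_derivative deriv f s + deriv g s) (at s)"
    "((\<lambda>s. deriv f s - deriv g s) has_real_derivative deriv (deriv f) s - deriv (deriv g) s) (at s)"
    "((\<lambda>s. deriv f s + deriv g s) has_real_derivative deriv (deriv f) s + deriv (deriv g) s) (at s)"
    "((\<lambda>s. deriv (deriv f) s - deriv (deriv g) s) has_real_derivative
        deriv (deriv (deriv f)) s - deriv (deriv (deriv g)) s) (at s)"
    "((\<lambda>s. deriv (deriv f) s + deriv (deriv g) s) has_real_derivative
        deriv (deriv (deriv f)) s + deriv (deriv (deriv g)) s) (at s)" if s: "s \<in> I" for s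
    using smooth_fun_on_derivative[OF smooth(1) I(1) s, of 0] smooth_fun_on_derivative[OF smooth(2) I(1) s, of 0]
      smooth_fun_on_derivative[OF smooth(1) I(1) s, of 1] smooth_fun_on_derivative[OF smooth(2) I(1) s, of 1]
      smooth_fun_on_derivative[OF smooth(1) I(1) s, of 2] smooth_fun_on_derivative[OF smooth(2) I(1) s, of 2]
    by (auto simp: h_def m_def numeral_eq_Suc intro!: DERIV_add DERIV_diff)
  have x': "x s \<theta> = h s *\<^sub>R null_parabola \<theta> + m s *\<^sub>R vector [0, 1 / 2, 1 / 2]" if "s \<in> I" for s \<theta>
    by (simp add: x[OF that] rev_lightlike_eq h_def m_def)
  note profile = lightlike_axis_profile[OF frame_lightlike I D x' h0 _ normal, where A = A]
  have h1: "deriv f s - deriv g s \<noteq> 0" if "s \<in> I" for s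
    using profile(1)[OF _ _ _ _ _ _ _ _ _ _ _ that] nondeg curved laplace by blast
  have alternatives: "(\<exists>C. C \<noteq> 0 \<and> (\<forall>s\<in>I. h s * m s = C)) \<or>
      (\<exists>C t0. C \<noteq> 0 \<and> (\<forall>s\<in>I. m s = C * h s ^ 3 + t0))"
    using profile(2) nondeg curved laplace by blast
  have xc: "x s \<theta> = vector [\<theta> * h s, (m s - h s + \<theta>\<^sup>2 * h s) / 2, (m s + h s + \<theta>\<^sup>2 * h s) / 2]"
    if "s \<in> I" for s \<theta>
    by (simp add: x'[OF that] null_parabola_def vec_eq_iff forall_3 field_simps)
  have J: "open (h ` I)"
    by (rule open_image_nonzero_derivative[OF I(1,2) D(1) h1])
  define c :: "real^3" where "c = vector [0, - 1, - 1]"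
  have coord: "lorentz p c = p $ 3 - p $ 2" for p
    by (simp add: lorentz_def c_def)
  from alternatives show ?thesis
  proof
    assume "\<exists>C. C \<noteq> 0 \<and> (\<forall>s\<in>I. h s * m s = C)"
    then obtain C where C: "C \<noteq> 0" "\<And>s. s \<in> I \<Longrightarrow> h s * m s = C" by blast
    have "open_part S {p. lorentz p p = - C}"
      unfolding S_def
    proof (rule open_part_by_coordinate[OF J open_UNIV, where c = c])
      fix s \<theta> assume s: "s \<in> I"
      show "x s \<theta> \<in> {p. lorentz p p = - C}"
      proof -
        have "t * y * (t * y) + (z - y + t\<^sup>2 * y) / 2 * ((z - y + t\<^sup>2 * y) / 2)
            - (z + y + t\<^sup>2 * y) / 2 * ((z + y + t\<^sup>2 * y) / 2) = - (y * z)" for t y z :: real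
          by (simp add: power2_eq_square field_simps)
        then show ?thesis
          by (simp add: xc[OF s] lorentz_def C(2)[OF s])
      qed
      show "lorentz (x s \<theta>) c \<in> h ` I"
        using s by (auto simp: coord xc[OF s] field_simps)
    next
      fix p assume p: "p \<in> {p. lorentz p p = - C}" "lorentz p c \<in> h ` I"
      then obtain s where s: "s \<in> I" "h s = p $ 3 - p $ 2"
        by (auto simp: coord)
      define \<theta> where "\<theta> = p $ 1 / h s"
      have 1: "p $ 1 = \<theta> * h s"
        using h0[OF s(1)] by (simp add: \<theta>_def)
      have "h s * (p $ 3 + p $ 2) = (p $ 1)\<^sup>2 - lorentz p p"
        by (simp add: s(2) lorentz_def power2_eq_square algebra_simps)
      also have "\<dots> = h s * (m s + \<theta>\<^sup>2 * h s)"
        using p(1) C(2)[OF s(1)] by (simp add: 1 power2_eq_square algebra_simps)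
      finally have "p $ 3 + p $ 2 = m s + \<theta>\<^sup>2 * h s"
        using h0[OF s(1)] by simp
      then have "p = x s \<theta>"
        using s(2) 1 by (simp add: xc[OF s(1)] vec_eq_iff forall_3)
      with s(1) show "\<exists>s\<in>I. \<exists>\<theta>. p = x s \<theta>" by blast
    qed auto
    with C(1) show ?thesis by (metis neg_equal_0_iff_equal)
  next
    assume "\<exists>C t0. C \<noteq> 0 \<and> (\<forall>s\<in>I. m s = C * h s ^ 3 + t0)"
    then obtain C t0 where C: "C \<noteq> 0" "\<And>s. s \<in> I \<Longrightarrow> m s = C * h s ^ 3 + t0" by blast
    define \<Phi> :: "real^3 \<Rightarrow> real^3" where "\<Phi> = (\<lambda>p. p + vector [0, t0 / 2, t0 / 2])"
    have \<Phi>: "\<Phi> (enneper (- 4 * C) (- y / 2) \<theta>)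
        = vector [\<theta> * y, (C * y ^ 3 + t0 - y + \<theta>\<^sup>2 * y) / 2, (C * y ^ 3 + t0 + y + \<theta>\<^sup>2 * y) / 2]" for y \<theta>
      by (simp add: \<Phi>_def enneper_def vec_eq_iff forall_3 power3_eq_cube field_simps)
    have "open_part S (\<Phi> ` enneper_surface (- 4 * C))"
      unfolding S_def
    proof (rule open_part_by_coordinate[OF J open_UNIV, where c = c])
      fix s \<theta> assume s: "s \<in> I"
      have "x s \<theta> = \<Phi> (enneper (- 4 * C) (- h s / 2) \<theta>)"
        by (simp only: \<Phi> xc[OF s] C(2)[OF s])
      moreover have "- h s / 2 \<noteq> 0"
        using h0[OF s] by simp
      ultimately show "x s \<theta> \<in> \<Phi> ` enneper_surface (- 4 * C)"
        unfolding enneper_surface_def by blast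
      show "lorentz (x s \<theta>) c \<in> h ` I"
        using s by (auto simp: coord xc[OF s] field_simps)
    next
      fix p assume p: "p \<in> \<Phi> ` enneper_surface (- 4 * C)" "lorentz p c \<in> h ` I"
      then obtain t \<theta> where p_eq: "p = \<Phi> (enneper (- 4 * C) t \<theta>)"
        by (auto simp: enneper_surface_def)
      have p_eq': "p = \<Phi> (enneper (- 4 * C) (- (- 2 * t) / 2) \<theta>)"
        by (simp add: p_eq)
      from p(2) obtain s where s: "s \<in> I" "h s = p $ 3 - p $ 2"
        by (auto simp: coord)
      then have "h s = - 2 * t"
        unfolding p_eq' \<Phi> by (simp add: field_simps)
      then have "p = x s \<theta>"
        unfolding p_eq' \<Phi> xc[OF s(1)] C(2)[OF s(1)] by simp
      with s(1) show "\<exists>s\<in>I. \<exists>\<theta>. p = x s \<theta>" by blast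
    qed auto
    moreover have "lorentz_isometry \<Phi>"
      unfolding \<Phi>_def by (rule lorentz_isometry_translation)
    moreover have "- 4 * C \<noteq> 0"
      using C(1) by simp
    ultimately show ?thesis by blast
  qed
qed

theorem theorem4:
  fixes a b :: ereal
    and x n :: "real \<Rightarrow> real \<Rightarrow> real^3"
    and A :: "real^3^3"
  defines "I \<equiv> einterval a b"
  assumes "a < b"
    and "surface_of_revolution I x"
    and "\<forall>s\<in>I. \<forall>\<theta>. nondegenerate_at x s \<theta>"
    and "unit_normal_field I x n"
    and "\<forall>s\<in>I. \<forall>\<theta>. coeff_L x n s \<theta> * coeff_N x n s \<theta> - (coeff_M x n s \<theta>)\<^sup>2 \<noteq> 0"
    and "\<forall>s\<in>I. \<forall>\<theta>. laplace_III_vec n x s \<theta> = A *v x s \<theta>"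
  defines "S \<equiv> {x s \<theta> | s \<theta>. s \<in> I}"
  shows "(open_part_of_catenoid catenoid1 S \<or> open_part_of_catenoid catenoid2 S \<or>
          open_part_of_catenoid catenoid3 S \<or> open_part_of_catenoid catenoid4 S \<or>
          open_part_of_catenoid catenoid5 S) \<or>
         (open_part_of_enneper2 S \<or> open_part_of_enneper3 S) \<or>
         (\<exists>c>0. open_part S (pseudosphere c)) \<or>
         (\<exists>c>0. open_part S (hyperbolic_space c))"
proof -
  have I: "open I" "is_interval I" "I \<noteq> {}"
  proof -
    show "open I" by (simp add: I_def)
    show "is_interval I"
      unfolding is_interval_1 I_def einterval_def
      by (auto intro: less_le_trans le_less_trans simp flip: ereal_less_eq(3))
    show "I \<noteq> {}"
      using einterval_nonempty[OF \<open>a < b\<close>] by (auto simp: I_def)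
  qed
  note surface = assms(4-7)
  note catenoids = catenoid1_def catenoid2_def catenoid3_def catenoid4_def catenoid5_def
  obtain f g where smooth: "smooth_fun_on f I" "smooth_fun_on g I"
    and kinds: "((\<forall>s\<in>I. f s \<noteq> 0) \<and> arclength_profile I x \<and>
           ((\<forall>s\<in>I. \<forall>\<theta>. x s \<theta> = rev_spacelike1 f g s \<theta>) \<or>
            (\<forall>s\<in>I. \<forall>\<theta>. x s \<theta> = rev_spacelike2 f g s \<theta>) \<or>
            (\<forall>s\<in>I. \<forall>\<theta>. x s \<theta> = rev_timelike f g s \<theta>))) \<or>
        ((\<forall>s\<in>I. f s - g s \<noteq> 0) \<and> (\<forall>s\<in>I. \<forall>\<theta>. x s \<theta> = rev_lightlike f g s \<theta>))"
    using assms(3) unfolding surface_of_revolution_def by blast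
  from kinds consider
      (spacelike1) "\<forall>s\<in>I. f s \<noteq> 0" "arclength_profile I x" "\<forall>s\<in>I. \<forall>\<theta>. x s \<theta> = rev_spacelike1 f g s \<theta>"
    | (spacelike2) "\<forall>s\<in>I. f s \<noteq> 0" "arclength_profile I x" "\<forall>s\<in>I. \<forall>\<theta>. x s \<theta> = rev_spacelike2 f g s \<theta>"
    | (timelike) "\<forall>s\<in>I. f s \<noteq> 0" "arclength_profile I x" "\<forall>s\<in>I. \<forall>\<theta>. x s \<theta> = rev_timelike f g s \<theta>"
    | (lightlike) "\<forall>s\<in>I. f s - g s \<noteq> 0" "\<forall>s\<in>I. \<forall>\<theta>. x s \<theta> = rev_lightlike f g s \<theta>"
    by blast
  then show ?thesis
  proof cases
    case spacelike1
    have "(\<exists>C. C \<noteq> 0 \<and> open_part S {p. lorentz p p = C}) \<or>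
      (\<exists>\<alpha> F \<Phi>. \<alpha> > 0 \<and> ((1 * 1 = (-1::real) \<and> F = sinh) \<or> (1 * 1 = (-1::real) \<and> F = sin) \<or> (1 * 1 = (1::real) \<and> F = cosh)) \<and>
      lorentz_isometry \<Phi> \<and>
      open_part S (\<Phi> ` nondegenerate_part (\<lambda>t \<theta>. (\<alpha> * F (t / \<alpha>)) *\<^sub>R hyperbola1 \<theta> + t *\<^sub>R vector [0, 1, 0])))"
      unfolding S_def
      by (rule axial_surface_classification[OF frame_spacelike1 _ _ I smooth _ _ spacelike1(2) surface orbit_hyperbola1])
         (use spacelike1 in \<open>auto simp: rev_spacelike1_eq\<close>)
    then have "(\<exists>C. C \<noteq> 0 \<and> open_part S {p. lorentz p p = C}) \<or> open_part_of_catenoid catenoid4 S"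
      unfolding open_part_of_catenoid_def catenoids by (auto simp: rev_spacelike1_eq[abs_def])
    then show ?thesis
      using central_quadric by blast
  next
    case spacelike2
    have "(\<exists>C. C \<noteq> 0 \<and> open_part S {p. lorentz p p = C}) \<or>
      (\<exists>\<alpha> F \<Phi>. \<alpha> > 0 \<and> ((-1 * 1 = (-1::real) \<and> F = sinh) \<or> (-1 * 1 = (-1::real) \<and> F = sin) \<or> (-1 * 1 = (1::real) \<and> F = cosh)) \<and>
      lorentz_isometry \<Phi> \<and>
      open_part S (\<Phi> ` nondegenerate_part (\<lambda>t \<theta>. (\<alpha> * F (t / \<alpha>)) *\<^sub>R hyperbola2 \<theta> + t *\<^sub>R vector [0, 1, 0])))"
      unfolding S_def
      by (rule axial_surface_classification[OF frame_spacelike2 _ _ I smooth _ _ spacelike2(2) surface orbit_hyperbola2])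
         (use spacelike2 in \<open>auto simp: rev_spacelike2_eq\<close>)
    then have "(\<exists>C. C \<noteq> 0 \<and> open_part S {p. lorentz p p = C}) \<or> open_part_of_catenoid catenoid5 S \<or> open_part_of_catenoid catenoid2 S"
      unfolding open_part_of_catenoid_def catenoids by (auto simp: rev_spacelike2_eq[abs_def])
    then show ?thesis
      using central_quadric by blast
  next
    case timelike
    have "(\<exists>C. C \<noteq> 0 \<and> open_part S {p. lorentz p p = C}) \<or>
      (\<exists>\<alpha> F \<Phi>. \<alpha> > 0 \<and> ((1 * -1 = (-1::real) \<and> F = sinh) \<or> (1 * -1 = (-1::real) \<and> F = sin) \<or> (1 * -1 = (1::real) \<and> F = cosh)) \<and>
      lorentz_isometry \<Phi> \<and>
      open_part S (\<Phi> ` nondegenerate_part (\<lambda>t \<theta>. (\<alpha> * F (t / \<alpha>)) *\<^sub>R circle \<theta> + t *\<^sub>R vector [0, 0, 1])))"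
      unfolding S_def
      by (rule axial_surface_classification[OF frame_timelike _ _ I smooth _ _ timelike(2) surface orbit_circle])
         (use timelike in \<open>auto simp: rev_timelike_eq\<close>)
    then have "(\<exists>C. C \<noteq> 0 \<and> open_part S {p. lorentz p p = C}) \<or> open_part_of_catenoid catenoid1 S \<or> open_part_of_catenoid catenoid3 S"
      unfolding open_part_of_catenoid_def catenoids by (auto simp: rev_timelike_eq[abs_def])
    then show ?thesis
      using central_quadric by blast
  next
    case lightlike
    have "(\<exists>C. C \<noteq> 0 \<and> open_part S {p. lorentz p p = C}) \<or>
      (\<exists>\<alpha> \<Phi>. \<alpha> \<noteq> 0 \<and> lorentz_isometry \<Phi> \<and> open_part S (\<Phi> ` enneper_surface \<alpha>))"
      unfolding S_def
      by (rule lightlike_surface_classification[OF I smooth _ _ surface]) (use lightlike in auto)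
    then have "(\<exists>C. C \<noteq> 0 \<and> open_part S {p. lorentz p p = C}) \<or> open_part_of_enneper2 S \<or> open_part_of_enneper3 S"
      unfolding open_part_of_enneper2_def open_part_of_enneper3_def by (metis linorder_neqE_linordered_idom)
    then show ?thesis
      using central_quadric by blast
  qed
qed

end
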